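(* Let $\mathbb K\in\{\mathbb R,\mathbb C\}$, let $G$ be a compact group, $X$ a homogeneous space of $G$, and $\rho_l:G\to\mathrm U(V_l)$, $\rho_J:G\to\mathrm U(V_J)$ irreducible unitary representations over $\mathbb K$ (with $l,J\in\widehat G$). Let $\{c_r\mid r=1,\dots,E_J\}$ be a basis of $\mathrm{End}_{G,\mathbb K}(V_J)$, $E_J=\dim_{\mathbb K}\mathrm{End}_{G,\mathbb K}(V_J)$. Then the space $\mathrm{Hom}_G(X,\mathrm{Hom}_{\mathbb K}(V_l,V_J))$ of steerable kernels has as basis the kernels $$\{K_{jisr}:X\to\mathrm{Hom}_{\mathbb K}(V_l,V_J)\mid j\in\widehat G,\ i\le m_j,\ s\le[J(jl)],\ r\le E_J\}$$ with matrix elements $$\langle JM|K_{jisr}(x)|ln\rangle=\sum_{m=1}^{d_j}\sum_{M'=1}^{d_J}\langle JM|c_r|JM'\rangle\cdot\langle s,JM'|jm;ln\rangle\cdot\langle i,jm|x\rangle .$$ Thus a general steerable kernel is of the form $K=\sum_{j\in\widehat G}\sum_{i=1}^{m_j}\sum_{s=1}^{[J(jl)]}\sum_{r=1}^{E_J}\lambda_{jisr}K_{jisr}$ with a total of $\Lambda_{Jl}=E_J\cdot\sum_{j\in\widehat G}[J(jl)]\cdot m_j$ parameters $\lambda_{jisr}\in\mathbb K$, and there is an isomorphism $$\overline{\mathrm{GKer}}:\mathbb K^{\Lambda_{Jl}}\to\mathrm{Hom}_G(X,\mathrm{Hom}_{\mathbb K}(V_l,V_J)),\qquad \overline{\mathrm{GKer}}=\mathrm{GKer}\circ\Omega,$$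 where $\Omega:\mathbb K^{\Lambda_{Jl}}\cong\bigoplus_{j}\bigoplus_{i=1}^{m_j}\bigoplus_{s=1}^{[J(jl)]}\mathbb K^{E_J}\to\bigoplus_j\bigoplus_{i=1}^{m_j}\bigoplus_{s=1}^{[J(jl)]}\mathrm{End}_{G,\mathbb K}(V_J)$ is the isomorphism that uses the same basis $(c_r)_r$ for each copy of $\mathrm{End}_{G,\mathbb K}(V_J)$.
   Context: Compact groups are compact Hausdorff topological groups. A homogeneous space $X$ of $G$ is a nonempty Hausdorff space with a continuous transitive left $G$-action; it carries the unique $G$-invariant normalized (Haar) measure, with respect to which $L^2_{\mathbb K}(X)$ is formed. Inner products are antilinear in the first and linear in the second argument. Representations are continuous (i.e. $g\mapsto\rho(g)v$ is continuous for each $v$); for $\mathbb K=\mathbb R$, "unitary" means orthogonal. $\widehat G$ is the set of isomorphism classes of irreducible unitary representations over $\mathbb K$ (all finite-dimensional), with fixed representatives $\rho_j:G\to\mathrm U(V_j)$, $d_j=\dim_{\mathbb K} V_j$, and $\{Y_j^m\}_{m=1}^{d_j}$ is a fixed orthonormal basis of $V_j$; $\rho_j^{m'm}(g)=\langle Y_j^{m'}|\rho_j(g)Y_j^m\rangle$. A $G$-steerable kernel is any function $K:X\to\mathrm{Hom}_{\mathbb K}(V_l,V_J)$ (linear maps) with $K(gx)=\rho_J(g)\circ K(x)\circ\rho_l(g)^{-1}$ for all $g\in G,x\in X$; the vector space of these is $\mathrm{Hom}_G(X,\mathrm{Hom}_{\mathbb K}(V_l,V_J))$. $\mathrm{End}_{G,\mathbb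 K}(V_J)$ is the space of linear maps $c:V_J\to V_J$ commuting with all $\rho_J(g)$. Harmonic basis functions: by the Peter-Weyl theorem there are multiplicities $m_j\in\mathbb N_{\ge0}$, $m_j\le d_j$, and functions $Y_{ji}^m:X\to\mathbb K$ ($j\in\widehat G$, $1\le i\le m_j$, $1\le m\le d_j$) with $Y_{ji}^m(g^{-1}x)=\sum_{m'}\rho_j^{m'm}(g)Y_{ji}^{m'}(x)$ for all $g,x$, which form an orthonormal (Hilbert) basis of $L^2_{\mathbb K}(X)$. These are fixed. Write $\langle i,jm|x\rangle:=\overline{Y_{ji}^m(x)}$. Clebsch-Gordan coefficients: $[J(jl)]$ is the multiplicity of $V_J$ in the decomposition of $V_j\otimes V_l$ into irreducibles; fix an equivariant isomorphism $\mathrm{CG}_{jl}:V_j\otimes V_l\to\bigoplus_{J\in\widehat G}\bigoplus_{s=1}^{[J(jl)]}V_J$, let $Y_{Js}^M$ be the copy of $Y_J^M$ in the $s$-th summand $V_J$, and put $\langle s,JM|jm;ln\rangle:=\langle Y_{Js}^M|\mathrm{CG}_{jl}(Y_j^m\otimes Y_l^n)\rangle$. For fixed $l,J$ one has $[J(jl)]\neq0$ for only finitely many $j$. Matrix elements: $\langle JM|f|ln\rangle=\langle Y_J^M|f(Y_l^n)\rangle$ for linear $f:V_l\to V_J$, and $\langle JM|c|JM'\rangle=\langle Y_J^M|c(Y_J^{M'})\rangle$. $\mathrm{GKer}:\bigoplus_j\bigoplus_{i=1}^{m_j}\bigoplus_{s=1}^{[J(jl)]}\mathrm{End}_{G,\mathbb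 K}(V_J)\to\mathrm{Hom}_G(X,\mathrm{Hom}_{\mathbb K}(V_l,V_J))$ is the linear map sending $(c_{jis})_{jis}$ to the kernel $K$ with $\langle JM|K(x)|ln\rangle=\sum_{j,i,s}\sum_{m=1}^{d_j}\sum_{M'=1}^{d_J}\langle JM|c_{jis}|JM'\rangle\langle s,JM'|jm;ln\rangle\langle i,jm|x\rangle$. *)

theory Defs
  imports
    "HOL-Analysis.Analysis"
    "HOL-Library.Function_Algebras"
    "HOL-Algebra.Group_Action"
begin

section \<open>The scalar field\<close>

text \<open>The types of this class are exactly the isometric copies of the real and of the complex
  numbers; \<open>to_complex\<close> is the inclusion into the complex numbers.\<close>

class real_or_complex = real_normed_field + banach + second_countable_topology +
  fixes to_complex :: "'a \<Rightarrow> complex"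
    and kcnj :: "'a \<Rightarrow> 'a"
  assumes to_complex_add: "to_complex (x + y) = to_complex x + to_complex y"
    and to_complex_mult: "to_complex (x * y) = to_complex x * to_complex y"
    and to_complex_one: "to_complex 1 = 1"
    and to_complex_scaleR: "to_complex (r *\<^sub>R x) = r *\<^sub>R to_complex x"
    and norm_to_complex: "norm (to_complex x) = norm x"
    and range_to_complex: "range to_complex = \<real> \<or> range to_complex = UNIV"
    and to_complex_kcnj: "to_complex (kcnj x) = cnj (to_complex x)"

instantiation real :: real_or_complex
begin
definition to_complex_real :: "real \<Rightarrow> complex" where "to_complex_real = complex_of_real"
definition kcnj_real :: "real \<Rightarrow> real" where "kcnj_real = id"
instance
  by standard (auto simp: to_complex_real_def kcnj_real_def Reals_def scaleR_conv_of_real)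
end

instantiation complex :: real_or_complex
begin
definition to_complex_complex :: "complex \<Rightarrow> complex" where "to_complex_complex = id"
definition kcnj_complex :: "complex \<Rightarrow> complex" where "kcnj_complex = cnj"
instance
  by standard (auto simp: to_complex_complex_def kcnj_complex_def)
end

section \<open>Linear algebra on subspaces of an ambient vector space\<close>

text \<open>Vector spaces such as the \<open>V\<^sub>j\<close> are subspaces, given by their carriers, of an ambient
  space with scalar multiplication \<open>sc\<close>. A function space carries pointwise operations.\<close>

definition fun_scale :: "('k \<Rightarrow> 'b \<Rightarrow> 'b) \<Rightarrow> 'k \<Rightarrow> ('a \<Rightarrow> 'b) \<Rightarrow> 'a \<Rightarrow> 'b" where
  "fun_scale sc a f = (\<lambda>x. sc a (f x))"

lemma vector_space_fun_scale:
  assumes "vector_space sc"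
  shows "vector_space (fun_scale sc)"
proof -
  interpret vector_space sc by fact
  show ?thesis
    by standard (auto simp: fun_scale_def fun_eq_iff scale_right_distrib scale_left_distrib)
qed

locale inner_product_space = vector_space sc
  for sc :: "'k::real_or_complex \<Rightarrow> 'v::ab_group_add \<Rightarrow> 'v" +
  fixes ip :: "'v \<Rightarrow> 'v \<Rightarrow> 'k"
  assumes ip_add_right: "ip u (v + w) = ip u v + ip u w"
    and ip_scale_right: "ip u (sc a v) = a * ip u v"
    and ip_commute: "ip v u = kcnj (ip u v)"
    and ip_pos: "v \<noteq> 0 \<Longrightarrow> \<exists>r>0. ip v v = of_real r"

definition ip_dist :: "('v::ab_group_add \<Rightarrow> 'v \<Rightarrow> 'k::real_or_complex) \<Rightarrow> 'v \<Rightarrow> 'v \<Rightarrow> real" where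
  "ip_dist ip v w = sqrt (norm (ip (v - w) (v - w)))"

definition finite_dim_subspace ::
  "('k::field \<Rightarrow> 'v::ab_group_add \<Rightarrow> 'v) \<Rightarrow> 'v set \<Rightarrow> bool" where
  "finite_dim_subspace sc V \<longleftrightarrow> (\<exists>B. finite B \<and> module.span sc B = V)"

definition basis_family ::
  "('k::field \<Rightarrow> 'v::ab_group_add \<Rightarrow> 'v) \<Rightarrow> 'i set \<Rightarrow> ('i \<Rightarrow> 'v) \<Rightarrow> 'v set \<Rightarrow> bool" where
  "basis_family sc I b V \<longleftrightarrow>
     inj_on b I \<and> \<not> module.dependent sc (b ` I) \<and> module.span sc (b ` I) = V"

definition orthonormal_basis ::
  "('k::real_or_complex \<Rightarrow> 'v::ab_group_add \<Rightarrow> 'v) \<Rightarrow> ('v \<Rightarrow> 'v \<Rightarrow> 'k) \<Rightarrow> 'v set \<Rightarrow> (nat \<Rightarrow> 'v) \<Rightarrow> bool"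
  where
  "orthonormal_basis sc ip V Y \<longleftrightarrow>
     basis_family sc {1..vector_space.dim sc V} Y V \<and>
     (\<forall>m\<in>{1..vector_space.dim sc V}. \<forall>n\<in>{1..vector_space.dim sc V}.
        ip (Y m) (Y n) = (if m = n then 1 else 0))"

definition linear_between ::
  "('k::field \<Rightarrow> 'a::ab_group_add \<Rightarrow> 'a) \<Rightarrow> ('k \<Rightarrow> 'b::ab_group_add \<Rightarrow> 'b) \<Rightarrow> 'a set \<Rightarrow> 'b set
    \<Rightarrow> ('a \<Rightarrow> 'b) \<Rightarrow> bool" where
  "linear_between s1 s2 V W f \<longleftrightarrow>
     (\<forall>x\<in>V. f x \<in> W) \<and>
     (\<forall>x\<in>V. \<forall>y\<in>V. f (x + y) = f x + f y) \<and>
     (\<forall>a. \<forall>x\<in>V. f (s1 a x) = s2 a (f x))"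

definition linear_iso ::
  "('k::field \<Rightarrow> 'a::ab_group_add \<Rightarrow> 'a) \<Rightarrow> ('k \<Rightarrow> 'b::ab_group_add \<Rightarrow> 'b) \<Rightarrow> 'a set \<Rightarrow> 'b set
    \<Rightarrow> ('a \<Rightarrow> 'b) \<Rightarrow> bool" where
  "linear_iso s1 s2 V W f \<longleftrightarrow> linear_between s1 s2 V W f \<and> bij_betw f V W"

text \<open>A linear map \<open>V \<rightarrow> W\<close> is represented by the function that extends it by zero outside of \<open>V\<close>,
  so that equality of linear maps is equality of functions.\<close>

definition hom_space ::
  "('k::field \<Rightarrow> 'v::ab_group_add \<Rightarrow> 'v) \<Rightarrow> 'v set \<Rightarrow> 'v set \<Rightarrow> ('v \<Rightarrow> 'v) set" where
  "hom_space sc V W = {f. linear_between sc sc V W f \<and> (\<forall>x. x \<notin> V \<longrightarrow> f x = 0)}"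

text \<open>The linear map \<open>V \<rightarrow> W\<close> whose matrix elements with respect to the orthonormal bases \<open>YV\<close>
  and \<open>YW\<close> are \<open>A\<close>.\<close>

definition hom_of_matrix ::
  "('k::field \<Rightarrow> 'v::ab_group_add \<Rightarrow> 'v) \<Rightarrow> ('v \<Rightarrow> 'v \<Rightarrow> 'k) \<Rightarrow> 'v set \<Rightarrow> (nat \<Rightarrow> 'v)
    \<Rightarrow> 'v set \<Rightarrow> (nat \<Rightarrow> 'v) \<Rightarrow> (nat \<Rightarrow> nat \<Rightarrow> 'k) \<Rightarrow> 'v \<Rightarrow> 'v" where
  "hom_of_matrix sc ip V YV W YW A = (\<lambda>v. if v \<in> V
     then \<Sum>M = 1..vector_space.dim sc W. \<Sum>n = 1..vector_space.dim sc V.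
            sc (A M n * ip (YV n) v) (YW M)
     else 0)"

definition coord_space :: "nat \<Rightarrow> (nat \<Rightarrow> 'k::zero) set" where
  "coord_space n = {v. \<forall>i. i \<notin> {1..n} \<longrightarrow> v i = 0}"

definition coord_ip :: "nat \<Rightarrow> (nat \<Rightarrow> 'k::real_or_complex) \<Rightarrow> (nat \<Rightarrow> 'k) \<Rightarrow> 'k" where
  "coord_ip n v w = (\<Sum>i = 1..n. kcnj (v i) * w i)"

subsection \<open>Direct sums\<close>

definition direct_sum :: "'i set \<Rightarrow> ('i \<Rightarrow> 'v::zero set) \<Rightarrow> ('i \<Rightarrow> 'v) set" where
  "direct_sum I V = {u. (\<forall>p\<in>I. u p \<in> V p) \<and> (\<forall>p. p \<notin> I \<longrightarrow> u p = 0) \<and> finite {p. u p \<noteq> 0}}"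

definition direct_sum_ip :: "('v::zero \<Rightarrow> 'v \<Rightarrow> 'k::comm_monoid_add) \<Rightarrow> ('i \<Rightarrow> 'v) \<Rightarrow> ('i \<Rightarrow> 'v) \<Rightarrow> 'k" where
  "direct_sum_ip ip u w = (\<Sum>p | u p \<noteq> 0 \<and> w p \<noteq> 0. ip (u p) (w p))"

definition direct_sum_single :: "'i \<Rightarrow> 'v::zero \<Rightarrow> 'i \<Rightarrow> 'v" where
  "direct_sum_single p v = (\<lambda>q. if q = p then v else 0)"

subsection \<open>Tensor products\<close>

text \<open>\<open>V \<otimes> W\<close> is realized inside the dual of the space of bilinear forms on \<open>V \<times> W\<close>, with
  \<open>v \<otimes> w\<close> the evaluation of a form at \<open>(v, w)\<close>. The functionals are extended by zero to functions
  that are not bilinear on \<open>V \<times> W\<close>.\<close>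

definition bilinear_form_on ::
  "('k::field \<Rightarrow> 'v::ab_group_add \<Rightarrow> 'v) \<Rightarrow> 'v set \<Rightarrow> 'v set \<Rightarrow> ('v \<Rightarrow> 'v \<Rightarrow> 'k) \<Rightarrow> bool" where
  "bilinear_form_on sc V W b \<longleftrightarrow>
     (\<forall>v\<in>V. linear_between sc (*) W UNIV (b v)) \<and>
     (\<forall>w\<in>W. linear_between sc (*) V UNIV (\<lambda>v. b v w))"

definition pure_tensor ::
  "('k::field \<Rightarrow> 'v::ab_group_add \<Rightarrow> 'v) \<Rightarrow> 'v set \<Rightarrow> 'v set \<Rightarrow> 'v \<Rightarrow> 'v
    \<Rightarrow> ('v \<Rightarrow> 'v \<Rightarrow> 'k) \<Rightarrow> 'k" where
  "pure_tensor sc V W v w = (\<lambda>b. if bilinear_form_on sc V W b then b v w else 0)"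

definition tensor_space ::
  "('k::field \<Rightarrow> 'v::ab_group_add \<Rightarrow> 'v) \<Rightarrow> 'v set \<Rightarrow> 'v set \<Rightarrow> (('v \<Rightarrow> 'v \<Rightarrow> 'k) \<Rightarrow> 'k) set" where
  "tensor_space sc V W =
     module.span (fun_scale (*)) {pure_tensor sc V W v w | v w. v \<in> V \<and> w \<in> W}"

definition tensor_action ::
  "('k::field \<Rightarrow> 'v::ab_group_add \<Rightarrow> 'v) \<Rightarrow> 'v set \<Rightarrow> 'v set
    \<Rightarrow> ('g \<Rightarrow> 'v \<Rightarrow> 'v) \<Rightarrow> ('g \<Rightarrow> 'v \<Rightarrow> 'v)
    \<Rightarrow> 'g \<Rightarrow> (('v \<Rightarrow> 'v \<Rightarrow> 'k) \<Rightarrow> 'k) \<Rightarrow> ('v \<Rightarrow> 'v \<Rightarrow> 'k) \<Rightarrow> 'k" where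
  "tensor_action sc V W \<rho> \<sigma> g t =
     (\<lambda>b. if bilinear_form_on sc V W b then t (\<lambda>v w. b (\<rho> g v) (\<sigma> g w)) else 0)"

lemma tensor_action_pure_tensor:
  assumes "linear_between sc sc V V (\<rho> g)" "linear_between sc sc W W (\<sigma> g)"
  shows "tensor_action sc V W \<rho> \<sigma> g (pure_tensor sc V W v w)
       = pure_tensor sc V W (\<rho> g v) (\<sigma> g w)"
proof -
  have "bilinear_form_on sc V W (\<lambda>v w. b (\<rho> g v) (\<sigma> g w))" if "bilinear_form_on sc V W b" for b
    using that assms unfolding bilinear_form_on_def linear_between_def by auto
  then show ?thesis
    unfolding tensor_action_def pure_tensor_def by (auto simp: fun_eq_iff)
qed

section \<open>Compact groups, homogeneous spaces and their Haar measure\<close>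

definition compact_group :: "('g, 'z) monoid_scheme \<Rightarrow> 'g topology \<Rightarrow> bool" where
  "compact_group G TG \<longleftrightarrow>
     group G \<and> topspace TG = carrier G \<and>
     continuous_map (prod_topology TG TG) TG (\<lambda>(g, h). g \<otimes>\<^bsub>G\<^esub> h) \<and>
     continuous_map TG TG (\<lambda>g. inv\<^bsub>G\<^esub> g) \<and>
     compact_space TG \<and> Hausdorff_space TG"

definition homogeneous_space ::
  "('g, 'z) monoid_scheme \<Rightarrow> 'g topology \<Rightarrow> ('g \<Rightarrow> 'x::t2_space \<Rightarrow> 'x) \<Rightarrow> bool" where
  "homogeneous_space G TG act \<longleftrightarrow>
     transitive_action G UNIV act \<and>
     continuous_map (prod_topology TG euclidean) euclidean (\<lambda>(g, x). act g x)"

text \<open>Inner regularity is what makes the normalized invariant measure unique when the topology has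
  no countable base.\<close>

definition haar_measure ::
  "('g, 'z) monoid_scheme \<Rightarrow> ('g \<Rightarrow> 'x::t2_space \<Rightarrow> 'x) \<Rightarrow> 'x measure \<Rightarrow> bool" where
  "haar_measure G act \<mu> \<longleftrightarrow>
     sets \<mu> = sets borel \<and> emeasure \<mu> UNIV = 1 \<and>
     (\<forall>g\<in>carrier G. distr \<mu> borel (act g) = \<mu>) \<and>
     (\<forall>A\<in>sets \<mu>. emeasure \<mu> A = (SUP C\<in>{C. compact C \<and> C \<subseteq> A}. emeasure \<mu> C))"

definition square_integrable :: "'x measure \<Rightarrow> ('x \<Rightarrow> 'k::real_or_complex) \<Rightarrow> bool" where
  "square_integrable \<mu> f \<longleftrightarrow> f \<in> borel_measurable \<mu> \<and> integrable \<mu> (\<lambda>x. (norm (f x))\<^sup>2)"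

definition L2_ip :: "'x measure \<Rightarrow> ('x \<Rightarrow> 'k::real_or_complex) \<Rightarrow> ('x \<Rightarrow> 'k) \<Rightarrow> 'k" where
  "L2_ip \<mu> f g = (LINT x|\<mu>. kcnj (f x) * g x)"

definition hilbert_basis_L2 ::
  "'x measure \<Rightarrow> 'i set \<Rightarrow> ('i \<Rightarrow> 'x \<Rightarrow> 'k::real_or_complex) \<Rightarrow> bool" where
  "hilbert_basis_L2 \<mu> I e \<longleftrightarrow>
     (\<forall>p\<in>I. square_integrable \<mu> (e p)) \<and>
     (\<forall>p\<in>I. \<forall>q\<in>I. L2_ip \<mu> (e p) (e q) = (if p = q then 1 else 0)) \<and>
     (\<forall>f. square_integrable \<mu> f \<longrightarrow>
        (\<forall>\<epsilon>>0. \<exists>F a. finite F \<and> F \<subseteq> I \<and>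
           (LINT x|\<mu>. (norm (f x - (\<Sum>p\<in>F. a p * e p x)))\<^sup>2) < \<epsilon>))"

section \<open>Representations\<close>

definition unitary_rep ::
  "('g, 'z) monoid_scheme \<Rightarrow> 'g topology
    \<Rightarrow> ('k::real_or_complex \<Rightarrow> 'v::ab_group_add \<Rightarrow> 'v) \<Rightarrow> ('v \<Rightarrow> 'v \<Rightarrow> 'k)
    \<Rightarrow> 'v set \<Rightarrow> ('g \<Rightarrow> 'v \<Rightarrow> 'v) \<Rightarrow> bool" where
  "unitary_rep G TG sc ip V \<rho> \<longleftrightarrow>
     finite_dim_subspace sc V \<and>
     (\<forall>g\<in>carrier G. linear_iso sc sc V V (\<rho> g) \<and>
        (\<forall>v\<in>V. \<forall>w\<in>V. ip (\<rho> g v) (\<rho> g w) = ip v w)) \<and>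
     (\<forall>v\<in>V. \<rho> \<one>\<^bsub>G\<^esub> v = v) \<and>
     (\<forall>g\<in>carrier G. \<forall>h\<in>carrier G. \<forall>v\<in>V. \<rho> (g \<otimes>\<^bsub>G\<^esub> h) v = \<rho> g (\<rho> h v)) \<and>
     (\<forall>v\<in>V. continuous_map TG (Metric_space.mtopology V (ip_dist ip)) (\<lambda>g. \<rho> g v))"

definition irreducible_unitary_rep ::
  "('g, 'z) monoid_scheme \<Rightarrow> 'g topology
    \<Rightarrow> ('k::real_or_complex \<Rightarrow> 'v::ab_group_add \<Rightarrow> 'v) \<Rightarrow> ('v \<Rightarrow> 'v \<Rightarrow> 'k)
    \<Rightarrow> 'v set \<Rightarrow> ('g \<Rightarrow> 'v \<Rightarrow> 'v) \<Rightarrow> bool" where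
  "irreducible_unitary_rep G TG sc ip V \<rho> \<longleftrightarrow>
     unitary_rep G TG sc ip V \<rho> \<and> V \<noteq> {0} \<and>
     (\<forall>W. module.subspace sc W \<and> W \<subseteq> V \<and> (\<forall>g\<in>carrier G. \<forall>w\<in>W. \<rho> g w \<in> W)
          \<longrightarrow> W = {0} \<or> W = V)"

definition equivariant_iso ::
  "('g, 'z) monoid_scheme
    \<Rightarrow> ('k::field \<Rightarrow> 'a::ab_group_add \<Rightarrow> 'a) \<Rightarrow> 'a set \<Rightarrow> ('g \<Rightarrow> 'a \<Rightarrow> 'a)
    \<Rightarrow> ('k \<Rightarrow> 'b::ab_group_add \<Rightarrow> 'b) \<Rightarrow> 'b set \<Rightarrow> ('g \<Rightarrow> 'b \<Rightarrow> 'b) \<Rightarrow> ('a \<Rightarrow> 'b) \<Rightarrow> bool" where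
  "equivariant_iso G s1 V \<rho> s2 W \<sigma> f \<longleftrightarrow>
     linear_iso s1 s2 V W f \<and> (\<forall>g\<in>carrier G. \<forall>v\<in>V. f (\<rho> g v) = \<sigma> g (f v))"

text \<open>\<open>Ghat\<close> indexes one representative of each isomorphism class of irreducible unitary
  representations. Exhaustiveness is stated for representations on the coordinate spaces, to which
  every finite-dimensional one is isomorphic, so that it does not depend on the ambient type.\<close>

definition unitary_dual ::
  "('g, 'z) monoid_scheme \<Rightarrow> 'g topology
    \<Rightarrow> ('k::real_or_complex \<Rightarrow> 'v::ab_group_add \<Rightarrow> 'v) \<Rightarrow> ('v \<Rightarrow> 'v \<Rightarrow> 'k)
    \<Rightarrow> 'j set \<Rightarrow> ('j \<Rightarrow> 'v set) \<Rightarrow> ('j \<Rightarrow> 'g \<Rightarrow> 'v \<Rightarrow> 'v) \<Rightarrow> bool" where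
  "unitary_dual G TG sc ip Ghat V \<rho> \<longleftrightarrow>
     (\<forall>j\<in>Ghat. irreducible_unitary_rep G TG sc ip (V j) (\<rho> j)) \<and>
     (\<forall>j\<in>Ghat. \<forall>k\<in>Ghat.
        (\<exists>f. equivariant_iso G sc (V j) (\<rho> j) sc (V k) (\<rho> k) f) \<longrightarrow> j = k) \<and>
     (\<forall>n \<sigma>. irreducible_unitary_rep G TG (fun_scale (*)) (coord_ip n) (coord_space n :: (nat \<Rightarrow> 'k) set) \<sigma>
        \<longrightarrow> (\<exists>j\<in>Ghat. \<exists>f.
              equivariant_iso G (fun_scale (*)) (coord_space n) \<sigma> sc (V j) (\<rho> j) f))"

definition endo_space ::
  "('g, 'z) monoid_scheme \<Rightarrow> ('k::field \<Rightarrow> 'v::ab_group_add \<Rightarrow> 'v) \<Rightarrow> 'v set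
    \<Rightarrow> ('g \<Rightarrow> 'v \<Rightarrow> 'v) \<Rightarrow> ('v \<Rightarrow> 'v) set" where
  "endo_space G sc V \<rho> =
     {c \<in> hom_space sc V V. \<forall>g\<in>carrier G. \<forall>v\<in>V. c (\<rho> g v) = \<rho> g (c v)}"

section \<open>Harmonic basis functions and Clebsch-Gordan coefficients\<close>

text \<open>\<open>mlt j\<close> is the multiplicity \<open>m\<^sub>j\<close>, and \<open>Yh j i m\<close> is the function \<open>Y\<^sub>j\<^sub>i\<^sup>m\<close> on the homogeneous
  space.\<close>

definition harmonic_basis ::
  "('g, 'z) monoid_scheme \<Rightarrow> ('g \<Rightarrow> 'x \<Rightarrow> 'x) \<Rightarrow> 'x measure
    \<Rightarrow> ('k::real_or_complex \<Rightarrow> 'v::ab_group_add \<Rightarrow> 'v) \<Rightarrow> ('v \<Rightarrow> 'v \<Rightarrow> 'k)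
    \<Rightarrow> 'j set \<Rightarrow> ('j \<Rightarrow> 'v set) \<Rightarrow> ('j \<Rightarrow> 'g \<Rightarrow> 'v \<Rightarrow> 'v) \<Rightarrow> ('j \<Rightarrow> nat \<Rightarrow> 'v)
    \<Rightarrow> ('j \<Rightarrow> nat) \<Rightarrow> ('j \<Rightarrow> nat \<Rightarrow> nat \<Rightarrow> 'x \<Rightarrow> 'k) \<Rightarrow> bool" where
  "harmonic_basis G act \<mu> sc ip Ghat V \<rho> Y mlt Yh \<longleftrightarrow>
     (\<forall>j\<in>Ghat. mlt j \<le> vector_space.dim sc (V j)) \<and>
     (\<forall>j\<in>Ghat. \<forall>i\<in>{1..mlt j}. \<forall>m\<in>{1..vector_space.dim sc (V j)}. \<forall>g\<in>carrier G. \<forall>x.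
        Yh j i m (act (inv\<^bsub>G\<^esub> g) x) =
          (\<Sum>m' = 1..vector_space.dim sc (V j). ip (Y j m') (\<rho> j g (Y j m)) * Yh j i m' x)) \<and>
     hilbert_basis_L2 \<mu>
       {(j, i, m). j \<in> Ghat \<and> i \<in> {1..mlt j} \<and> m \<in> {1..vector_space.dim sc (V j)}}
       (\<lambda>(j, i, m). Yh j i m)"

text \<open>\<open>cgm J j l\<close> is the multiplicity \<open>[J(jl)]\<close> of \<open>V\<^sub>J\<close> in \<open>V\<^sub>j \<otimes> V\<^sub>l\<close>; it is determined by the
  existence of the isomorphism \<open>CG j l\<close> onto the corresponding direct sum, whose summands are
  indexed by the pairs \<open>(J, s)\<close>.\<close>

definition cg_index :: "'j set \<Rightarrow> ('j \<Rightarrow> 'j \<Rightarrow> 'j \<Rightarrow> nat) \<Rightarrow> 'j \<Rightarrow> 'j \<Rightarrow> ('j \<times> nat) set" where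
  "cg_index Ghat cgm j l = (SIGMA J:Ghat. {1..cgm J j l})"

definition clebsch_gordan ::
  "('g, 'z) monoid_scheme \<Rightarrow> ('k::field \<Rightarrow> 'v::ab_group_add \<Rightarrow> 'v)
    \<Rightarrow> 'j set \<Rightarrow> ('j \<Rightarrow> 'v set) \<Rightarrow> ('j \<Rightarrow> 'g \<Rightarrow> 'v \<Rightarrow> 'v) \<Rightarrow> ('j \<Rightarrow> 'j \<Rightarrow> 'j \<Rightarrow> nat)
    \<Rightarrow> ('j \<Rightarrow> 'j \<Rightarrow> (('v \<Rightarrow> 'v \<Rightarrow> 'k) \<Rightarrow> 'k) \<Rightarrow> 'j \<times> nat \<Rightarrow> 'v) \<Rightarrow> bool" where
  "clebsch_gordan G sc Ghat V \<rho> cgm CG \<longleftrightarrow>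
     (\<forall>j\<in>Ghat. \<forall>l\<in>Ghat.
        equivariant_iso G
          (fun_scale (*)) (tensor_space sc (V j) (V l))
            (tensor_action sc (V j) (V l) (\<rho> j) (\<rho> l))
          (fun_scale sc) (direct_sum (cg_index Ghat cgm j l) (\<lambda>p. V (fst p)))
            (\<lambda>g u p. if p \<in> cg_index Ghat cgm j l then \<rho> (fst p) g (u p) else 0)
          (CG j l))"

text \<open>\<open>cg_coeff sc ip V Y CG s J M j m l n\<close> is \<open>\<langle>s, JM | jm; ln\<rangle>\<close>.\<close>

definition cg_coeff ::
  "('k::field \<Rightarrow> 'v::ab_group_add \<Rightarrow> 'v) \<Rightarrow> ('v \<Rightarrow> 'v \<Rightarrow> 'k) \<Rightarrow> ('j \<Rightarrow> 'v set) \<Rightarrow> ('j \<Rightarrow> nat \<Rightarrow> 'v)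
    \<Rightarrow> ('j \<Rightarrow> 'j \<Rightarrow> (('v \<Rightarrow> 'v \<Rightarrow> 'k) \<Rightarrow> 'k) \<Rightarrow> 'j \<times> nat \<Rightarrow> 'v)
    \<Rightarrow> nat \<Rightarrow> 'j \<Rightarrow> nat \<Rightarrow> 'j \<Rightarrow> nat \<Rightarrow> 'j \<Rightarrow> nat \<Rightarrow> 'k" where
  "cg_coeff sc ip V Y CG s J M j m l n =
     direct_sum_ip ip (direct_sum_single (J, s) (Y J M)) (CG j l (pure_tensor sc (V j) (V l) (Y j m) (Y l n)))"

section \<open>Steerable kernels\<close>

definition steerable_kernels ::
  "('g, 'z) monoid_scheme \<Rightarrow> ('g \<Rightarrow> 'x \<Rightarrow> 'x) \<Rightarrow> ('k::field \<Rightarrow> 'v::ab_group_add \<Rightarrow> 'v)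
    \<Rightarrow> 'v set \<Rightarrow> ('g \<Rightarrow> 'v \<Rightarrow> 'v) \<Rightarrow> 'v set \<Rightarrow> ('g \<Rightarrow> 'v \<Rightarrow> 'v) \<Rightarrow> ('x \<Rightarrow> 'v \<Rightarrow> 'v) set" where
  "steerable_kernels G act sc V \<rho> W \<sigma> =
     {K. (\<forall>x. K x \<in> hom_space sc V W) \<and>
         (\<forall>g\<in>carrier G. \<forall>x. \<forall>v\<in>V. K (act g x) v = \<sigma> g (K x (inv_into V (\<rho> g) v)))}"

text \<open>The summand of the matrix element \<open>\<langle>JM|K(x)|ln\<rangle>\<close> that an endomorphism \<open>c\<close> in the \<open>(j, i, s)\<close>
  component contributes.\<close>

definition kernel_coeff ::
  "('k::real_or_complex \<Rightarrow> 'v::ab_group_add \<Rightarrow> 'v) \<Rightarrow> ('v \<Rightarrow> 'v \<Rightarrow> 'k) \<Rightarrow> ('j \<Rightarrow> 'v set)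
    \<Rightarrow> ('j \<Rightarrow> nat \<Rightarrow> 'v) \<Rightarrow> ('j \<Rightarrow> nat \<Rightarrow> nat \<Rightarrow> 'x \<Rightarrow> 'k)
    \<Rightarrow> ('j \<Rightarrow> 'j \<Rightarrow> (('v \<Rightarrow> 'v \<Rightarrow> 'k) \<Rightarrow> 'k) \<Rightarrow> 'j \<times> nat \<Rightarrow> 'v)
    \<Rightarrow> 'j \<Rightarrow> 'j \<Rightarrow> ('v \<Rightarrow> 'v) \<Rightarrow> 'j \<Rightarrow> nat \<Rightarrow> nat \<Rightarrow> 'x \<Rightarrow> nat \<Rightarrow> nat \<Rightarrow> 'k" where
  "kernel_coeff sc ip V Y Yh CG l J c j i s x M n =
     (\<Sum>m = 1..vector_space.dim sc (V j). \<Sum>M' = 1..vector_space.dim sc (V J).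
        ip (Y J M) (c (Y J M')) * cg_coeff sc ip V Y CG s J M' j m l n * kcnj (Yh j i m x))"

definition basis_kernel ::
  "('k::real_or_complex \<Rightarrow> 'v::ab_group_add \<Rightarrow> 'v) \<Rightarrow> ('v \<Rightarrow> 'v \<Rightarrow> 'k) \<Rightarrow> ('j \<Rightarrow> 'v set)
    \<Rightarrow> ('j \<Rightarrow> nat \<Rightarrow> 'v) \<Rightarrow> ('j \<Rightarrow> nat \<Rightarrow> nat \<Rightarrow> 'x \<Rightarrow> 'k)
    \<Rightarrow> ('j \<Rightarrow> 'j \<Rightarrow> (('v \<Rightarrow> 'v \<Rightarrow> 'k) \<Rightarrow> 'k) \<Rightarrow> 'j \<times> nat \<Rightarrow> 'v)
    \<Rightarrow> 'j \<Rightarrow> 'j \<Rightarrow> (nat \<Rightarrow> 'v \<Rightarrow> 'v) \<Rightarrow> 'j \<Rightarrow> nat \<Rightarrow> nat \<Rightarrow> nat \<Rightarrow> 'x \<Rightarrow> 'v \<Rightarrow> 'v" where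
  "basis_kernel sc ip V Y Yh CG l J c j i s r = (\<lambda>x.
     hom_of_matrix sc ip (V l) (Y l) (V J) (Y J)
       (kernel_coeff sc ip V Y Yh CG l J (c r) j i s x))"

definition GKer ::
  "('k::real_or_complex \<Rightarrow> 'v::ab_group_add \<Rightarrow> 'v) \<Rightarrow> ('v \<Rightarrow> 'v \<Rightarrow> 'k) \<Rightarrow> ('j \<Rightarrow> 'v set)
    \<Rightarrow> ('j \<Rightarrow> nat \<Rightarrow> 'v) \<Rightarrow> ('j \<Rightarrow> nat \<Rightarrow> nat \<Rightarrow> 'x \<Rightarrow> 'k)
    \<Rightarrow> ('j \<Rightarrow> 'j \<Rightarrow> (('v \<Rightarrow> 'v \<Rightarrow> 'k) \<Rightarrow> 'k) \<Rightarrow> 'j \<times> nat \<Rightarrow> 'v)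
    \<Rightarrow> 'j \<Rightarrow> 'j \<Rightarrow> ('j \<times> nat \<times> nat \<Rightarrow> 'v \<Rightarrow> 'v) \<Rightarrow> 'x \<Rightarrow> 'v \<Rightarrow> 'v" where
  "GKer sc ip V Y Yh CG l J c = (\<lambda>x.
     hom_of_matrix sc ip (V l) (Y l) (V J) (Y J)
       (\<lambda>M n. \<Sum>(j, i, s) | c (j, i, s) \<noteq> 0.
          kernel_coeff sc ip V Y Yh CG l J (c (j, i, s)) j i s x M n))"

definition block_index ::
  "'j set \<Rightarrow> ('j \<Rightarrow> nat) \<Rightarrow> ('j \<Rightarrow> 'j \<Rightarrow> 'j \<Rightarrow> nat) \<Rightarrow> 'j \<Rightarrow> 'j \<Rightarrow> ('j \<times> nat \<times> nat) set" where
  "block_index Ghat mlt cgm l J =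
     {(j, i, s). j \<in> Ghat \<and> i \<in> {1..mlt j} \<and> s \<in> {1..cgm J j l}}"

definition kernel_index ::
  "'j set \<Rightarrow> ('j \<Rightarrow> nat) \<Rightarrow> ('j \<Rightarrow> 'j \<Rightarrow> 'j \<Rightarrow> nat) \<Rightarrow> nat \<Rightarrow> 'j \<Rightarrow> 'j
    \<Rightarrow> ('j \<times> nat \<times> nat \<times> nat) set" where
  "kernel_index Ghat mlt cgm E l J =
     {(j, i, s, r). j \<in> Ghat \<and> i \<in> {1..mlt j} \<and> s \<in> {1..cgm J j l} \<and> r \<in> {1..E}}"

text \<open>The sum over all of \<open>Ghat\<close> is written over its support.\<close>

definition num_params ::
  "'j set \<Rightarrow> ('j \<Rightarrow> nat) \<Rightarrow> ('j \<Rightarrow> 'j \<Rightarrow> 'j \<Rightarrow> nat) \<Rightarrow> nat \<Rightarrow> 'j \<Rightarrow> 'j \<Rightarrow> nat" where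
  "num_params Ghat mlt cgm E l J = E * (\<Sum>j | j \<in> Ghat \<and> cgm J j l \<noteq> 0. cgm J j l * mlt j)"

text \<open>The identification of the coordinate space with a direct sum of copies of the \<open>E\<close>-dimensional
  one depends on a numbering \<open>\<nu>\<close> of the quadruples \<open>(j, i, s, r)\<close>.\<close>

definition Omega ::
  "('k::field \<Rightarrow> 'v::ab_group_add \<Rightarrow> 'v)
    \<Rightarrow> 'j set \<Rightarrow> ('j \<Rightarrow> nat) \<Rightarrow> ('j \<Rightarrow> 'j \<Rightarrow> 'j \<Rightarrow> nat) \<Rightarrow> nat \<Rightarrow> 'j \<Rightarrow> 'j
    \<Rightarrow> (nat \<Rightarrow> 'v \<Rightarrow> 'v) \<Rightarrow> ('j \<times> nat \<times> nat \<times> nat \<Rightarrow> nat)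
    \<Rightarrow> (nat \<Rightarrow> 'k) \<Rightarrow> 'j \<times> nat \<times> nat \<Rightarrow> 'v \<Rightarrow> 'v" where
  "Omega sc Ghat mlt cgm E l J c \<nu> a = (\<lambda>(j, i, s).
     if (j, i, s) \<in> block_index Ghat mlt cgm l J
     then \<Sum>r = 1..E. fun_scale sc (a (\<nu> (j, i, s, r))) (c r)
     else 0)"

end

theory Submission
  imports Defs
begin

text \<open>Read as the vector of its coordinates \<open>\<langle>i, jm|x\<rangle>\<close>, the family \<open>Y\<^sub>j\<^sub>i\<close> is an equivariant map
  \<open>\<psi>\<^sub>j\<^sub>i\<close> from the homogeneous space to \<open>V\<^sub>j\<close>, so each equivariant \<open>b : V\<^sub>j \<otimes> V\<^sub>l \<rightarrow> V\<^sub>J\<close> gives the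
  steerable kernel \<open>x \<mapsto> b (\<psi>\<^sub>j\<^sub>i x \<otimes> \<cdot>)\<close>; by Schur's lemma \<open>b\<close> is a unique sum of endomorphisms of
  \<open>V\<^sub>J\<close> applied to the Clebsch-Gordan components. Conversely, integrating a steerable kernel \<open>K\<close>
  against \<open>\<psi>\<^sub>j\<^sub>i\<close> gives such a \<open>b\<^sub>j\<^sub>i\<close>, and \<open>K - \<Sum> b\<^sub>j\<^sub>i (\<psi>\<^sub>j\<^sub>i x \<otimes> \<cdot>)\<close> has matrix elements orthogonal to the
  whole harmonic basis. It therefore vanishes almost everywhere, and being equivariant on a
  homogeneous space it vanishes identically. Orthonormality of the harmonic basis recovers the
  \<open>b\<^sub>j\<^sub>i\<close> from the kernel, which gives uniqueness. Steerable kernels are automatically continuous,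
  hence integrable, because the orbit maps of a compact group are quotient maps.\<close>

section \<open>Scalars, bases and inner products\<close>

text \<open>Over the reals \<open>endo\<close> may be a copy of the reals, the complex numbers or
  the quaternions. Schur's lemma is therefore used only in the form that a nonzero intertwiner of
  irreducibles is an isomorphism, and each Clebsch-Gordan copy of V_J keeps a whole endomorphism as
  its coefficient; this is the origin of the factor E_J in the parameter count.
  \<open>CG j l\<close> is an equivariant linear isomorphism that is not assumed isometric, so
  orthogonality between different j has to come from elsewhere: from the Hilbert-Schmidt pairing on
  Hom(V_l, V_J). It shows that only finitely many j contribute, and thereby the expansion of a
  kernel is a finite sum without any question of convergence. The conjugate in <i,jm|x> places the
  equivariant map in V_j rather than in its dual. When a kernel is integrated, that map enters
  through the antilinear slot of the inner product, which undoes the conjugate and makes the result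
  linear in the vector of V_j. Since the V_j are carriers in an ambient type without topology, all
  integrals are taken over scalar matrix elements.\<close>

lemma to_complex_eq_iff: "to_complex x = to_complex y \<longleftrightarrow> x = (y::'k::real_or_complex)"
proof
  assume eq: "to_complex x = to_complex y"
  have "to_complex (x - y) + to_complex y = to_complex x"
    by (simp flip: to_complex_add)
  then have "norm (to_complex (x - y)) = 0" using eq by simp
  then show "x = y" by (simp add: norm_to_complex)
qed simp

lemma to_complex_of_real: "to_complex (of_real r :: 'k::real_or_complex) = of_real r"
  by (simp add: of_real_def to_complex_scaleR to_complex_one)

text \<open>The class describes \<open>kcnj\<close> only through its image under
  \<open>to_complex\<close>, so each identity is checked among complex numbers and pulled back along
  injectivity.\<close>

lemma kcnj_add: "kcnj (x + y) = kcnj x + kcnj (y::'k::real_or_complex)"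
  and kcnj_mult: "kcnj (x * y) = kcnj x * kcnj y"
  and kcnj_kcnj [simp]: "kcnj (kcnj x) = x"
  and kcnj_of_real [simp]: "kcnj (of_real r :: 'k) = of_real r"
  and kcnj_scaleR: "kcnj (r *\<^sub>R x) = r *\<^sub>R kcnj x"
  by (simp_all flip: to_complex_eq_iff
      add: to_complex_add to_complex_mult to_complex_kcnj to_complex_of_real to_complex_scaleR)

lemma norm_kcnj [simp]: "norm (kcnj x) = norm (x::'k::real_or_complex)"
  by (metis norm_to_complex to_complex_kcnj complex_mod_cnj)

text \<open>Real linearity is what both fields share, and it carries conjugation through finite
  sums, continuity and Bochner integrals.\<close>

lemma bounded_linear_kcnj: "bounded_linear (kcnj :: 'k::real_or_complex \<Rightarrow> 'k)"
  by (rule bounded_linear_intro[where K = 1]) (simp_all add: kcnj_add kcnj_scaleR)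

lemma kcnj_0 [simp]: "kcnj (0::'k::real_or_complex) = 0"
  and kcnj_1 [simp]: "kcnj (1::'k) = 1"
  using kcnj_of_real[of 0, where 'k = 'k] kcnj_of_real[of 1, where 'k = 'k] by simp_all

lemma kcnj_eq_0_iff [simp]: "kcnj x = 0 \<longleftrightarrow> x = (0::'k::real_or_complex)"
  by (metis kcnj_0 kcnj_kcnj)

lemma kcnj_minus: "kcnj (- x) = - kcnj (x::'k::real_or_complex)"
  by (rule linear_neg[OF bounded_linear.linear[OF bounded_linear_kcnj]])

lemma kcnj_diff: "kcnj (x - y) = kcnj x - kcnj (y::'k::real_or_complex)"
  by (rule linear_simps(2)[OF bounded_linear_kcnj])

lemma kcnj_sum: "kcnj (sum f A) = (\<Sum>i\<in>A. kcnj (f i :: 'k::real_or_complex))"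
  by (rule linear_sum[OF bounded_linear.linear[OF bounded_linear_kcnj]])

lemma mult_kcnj: "x * kcnj x = (of_real ((norm x)\<^sup>2) :: 'k::real_or_complex)"
proof -
  have "to_complex (x * kcnj x) = of_real ((norm (to_complex x))\<^sup>2)"
    unfolding to_complex_mult to_complex_kcnj complex_norm_square ..
  then show ?thesis
    by (metis norm_to_complex to_complex_of_real to_complex_eq_iff)
qed

section \<open>Linear maps between carriers and coordinates in finite bases\<close>

lemma linear_between_in: "linear_between s1 s2 V W f \<Longrightarrow> x \<in> V \<Longrightarrow> f x \<in> W"
  and linear_between_add: "linear_between s1 s2 V W f \<Longrightarrow> x \<in> V \<Longrightarrow> y \<in> V \<Longrightarrow> f (x + y) = f x + f y"
  and linear_between_scale: "linear_between s1 s2 V W f \<Longrightarrow> x \<in> V \<Longrightarrow> f (s1 a x) = s2 a (f x)"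
  by (auto simp: linear_between_def)

lemma linear_between_0:
  assumes "linear_between s1 s2 V W f" "0 \<in> V"
  shows "f 0 = 0"
  using linear_between_add[OF assms(1) assms(2) assms(2)] by simp

lemma linear_between_sum:
  assumes "module s1" "module.subspace s1 V" "linear_between s1 s2 V W f"
    and "\<And>i. i \<in> I \<Longrightarrow> h i \<in> V"
  shows "f (\<Sum>i\<in>I. h i) = (\<Sum>i\<in>I. f (h i))"
  using assms(4)
proof (induction I rule: infinite_finite_induct)
  case (insert i I)
  interpret module s1 by fact
  show ?case
    using insert assms(2) linear_between_add[OF assms(3)] by (simp add: subspace_sum)
qed (use linear_between_0[OF assms(3)] module.subspace_0[OF assms(1,2)] in auto)

lemma linear_between_diff:
  assumes "module s1" "module.subspace s1 V" "linear_between s1 s2 V W f" "x \<in> V" "y \<in> V"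
  shows "f (x - y) = f x - f y"
proof -
  interpret module s1 by fact
  have "f (x - y) + f y = f (x - y + y)"
    using assms by (intro linear_between_add[symmetric]) (auto intro: subspace_diff)
  then show ?thesis by (simp add: eq_diff_eq)
qed

text \<open>Together with the image version below, this supplies the invariant subspaces to which
  irreducibility is applied in Schur's lemma.\<close>

lemma linear_between_subspace_kernel:
  assumes "module s1" "module s2" "module.subspace s1 V" "linear_between s1 s2 V W f"
  shows "module.subspace s1 {x \<in> V. f x = 0}"
proof -
  interpret m1: module s1 by fact
  interpret m2: module s2 by fact
  show ?thesis
    using assms(3) linear_between_0[OF assms(4)] linear_between_add[OF assms(4)]
      linear_between_scale[OF assms(4)]
    by (auto simp: m1.subspace_def)
qed

lemma linear_between_subspace_image:
  assumes "module s1" "module s2" "module.subspace s1 V" "linear_between s1 s2 V W f"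
  shows "module.subspace s2 (f ` V)"
proof -
  interpret m1: module s1 by fact
  interpret m2: module s2 by fact
  have "0 \<in> V" using assms(3) m1.subspace_0 by blast
  then show ?thesis
    using assms(3) linear_between_0[OF assms(4), symmetric]
      linear_between_add[OF assms(4), symmetric] linear_between_scale[OF assms(4), symmetric]
    by (fastforce simp: m1.subspace_def m2.subspace_def)
qed

lemma sum_fun_apply: "(\<Sum>i\<in>I. f i) x = (\<Sum>i\<in>I. f i x)"
  by (induction I rule: infinite_finite_induct) auto

text \<open>Unique coordinates include the injectivity that \<^const>\<open>basis_family\<close> demands.\<close>

lemma basis_familyI:
  fixes s :: "'k::field \<Rightarrow> 'v::ab_group_add \<Rightarrow> 'v"
  assumes vs: "vector_space s" and "finite I" and V: "module.subspace s V"
    and b: "\<And>i. i \<in> I \<Longrightarrow> b i \<in> V"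
    and ex: "\<And>v. v \<in> V \<Longrightarrow> \<exists>a. v = (\<Sum>i\<in>I. s (a i) (b i))"
    and un: "\<And>a i. (\<Sum>i\<in>I. s (a i) (b i)) = 0 \<Longrightarrow> i \<in> I \<Longrightarrow> a i = 0"
  shows "basis_family s I b V"
proof -
  interpret vector_space s by fact
  have inj: "inj_on b I"
  proof (rule inj_onI, rule ccontr)
    fix i k assume ik: "i \<in> I" "k \<in> I" "b i = b k" "i \<noteq> k"
    \<comment> \<open>If two indices carried the same vector, the coefficients 1 and -1 on them
      would be a nontrivial relation.\<close>
    let ?a = "\<lambda>p. (if p = i then 1 else 0) - (if p = k then 1 else 0) :: 'k"
    have "(\<Sum>p\<in>I. s (?a p) (b p)) = (\<Sum>p\<in>I. (if p = i then b p else 0) - (if p = k then b p else 0))"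
      by (intro sum.cong) (auto simp: scale_left_diff_distrib)
    also have "\<dots> = 0" using ik \<open>finite I\<close> by (simp add: sum_subtractf)
    finally have "?a i = 0" by (rule un[OF _ ik(1)])
    then show False using ik by simp
  qed
  moreover have "independent (b ` I)"
  proof (rule independent_if_scalars_zero)
    fix u y assume 0: "(\<Sum>y\<in>b ` I. s (u y) y) = 0" and y: "y \<in> b ` I"
    from 0 have "(\<Sum>i\<in>I. s (u (b i)) (b i)) = 0" using inj by (simp add: sum.reindex)
    then show "u y = 0" using un[of "\<lambda>i. u (b i)"] y by auto
  qed (use \<open>finite I\<close> in simp)
  moreover have "span (b ` I) = V"
  proof (rule span_unique[OF _ V])
    show "b ` I \<subseteq> V" using b by auto
  next
    fix T assume T: "b ` I \<subseteq> T" "subspace T"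
    show "V \<subseteq> T"
    proof
      fix v assume "v \<in> V"
      then obtain a where "v = (\<Sum>i\<in>I. s (a i) (b i))" using ex by blast
      then show "v \<in> T" using T by (auto intro!: subspace_sum subspace_scale)
    qed
  qed
  ultimately show ?thesis by (simp add: basis_family_def)
qed

text \<open>Injectivity of \<open>b\<close> lets coefficients attached to basis vectors be
  re-attached to indices, so that span and independence of a set become statements about coordinate
  families.\<close>

lemma basis_familyD:
  assumes vs: "vector_space s" and "finite I" and bf: "basis_family s I b V"
  shows "module.subspace s V"
    and "i \<in> I \<Longrightarrow> b i \<in> V"
    and "v \<in> V \<Longrightarrow> \<exists>a. v = (\<Sum>i\<in>I. s (a i) (b i))"
    and "(\<Sum>i\<in>I. s (a i) (b i)) = 0 \<Longrightarrow> i \<in> I \<Longrightarrow> a i = 0"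
proof -
  interpret vector_space s by fact
  have inj: "inj_on b I" and ind: "independent (b ` I)" and sp: "span (b ` I) = V"
    using bf by (auto simp: basis_family_def)
  show "subspace V" using sp by auto
  show "b i \<in> V" if "i \<in> I" using that span_base[of "b i" "b ` I"] by (simp add: sp)
  show "\<exists>a. v = (\<Sum>i\<in>I. s (a i) (b i))" if "v \<in> V"
  proof -
    have "v \<in> range (\<lambda>u. \<Sum>y\<in>b ` I. s (u y) y)"
      using that sp span_finite[of "b ` I"] \<open>finite I\<close> by simp
    then obtain u where "v = (\<Sum>y\<in>b ` I. s (u y) y)" by blast
    then have "v = (\<Sum>i\<in>I. s (u (b i)) (b i))" using inj by (simp add: sum.reindex)
    then show ?thesis by (rule exI[of _ "\<lambda>i. u (b i)"])
  qed
  show "a i = 0" if 0: "(\<Sum>i\<in>I. s (a i) (b i)) = 0" and i: "i \<in> I"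
  proof -
    have "(\<Sum>y\<in>b ` I. s (a (inv_into I b y)) y) = 0"
      using inj 0 by (simp add: sum.reindex)
    then have "a (inv_into I b (b i)) = 0"
      using independentD[OF ind, where u = "\<lambda>y. a (inv_into I b y)" and v = "b i"]
        \<open>finite I\<close> i by blast
    then show ?thesis using i inj by simp
  qed
qed

text \<open>Both isomorphisms of the theorem are instances: \<open>Omega\<close> and its composite
  with \<open>GKer\<close> are the linear-combination maps of two bases with the same index set,
  read through the numbering \<open>\<nu>\<close>.\<close>

lemma basis_family_linear_iso:
  assumes vs: "vector_space s" and "finite I" and bf: "basis_family s I b V"
    and \<nu>: "bij_betw \<nu> I {1..n}"
  shows "linear_iso (fun_scale (*)) s (coord_space n) V (\<lambda>a. \<Sum>i\<in>I. s (a (\<nu> i)) (b i))"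
    (is "linear_iso _ _ _ _ ?f")
proof -
  interpret vector_space s by fact
  note D = basis_familyD[OF vs \<open>finite I\<close> bf]
  have lin: "linear_between (fun_scale (*)) s (coord_space n) V ?f"
    using D(1,2) by (auto simp: linear_between_def fun_scale_def scale_left_distrib sum.distrib
        scale_sum_right intro!: subspace_sum subspace_scale)
  have "inj_on ?f (coord_space n)"
  proof (rule inj_onI)
    fix a a' :: "nat \<Rightarrow> 'a"
    assume a: "a \<in> coord_space n" "a' \<in> coord_space n" "?f a = ?f a'"
    then have "(\<Sum>i\<in>I. s (a (\<nu> i) - a' (\<nu> i)) (b i)) = 0"
      by (simp add: scale_left_diff_distrib sum_subtractf)
    then have *: "a (\<nu> i) = a' (\<nu> i)" if "i \<in> I" for i
      using D(4)[of "\<lambda>i. a (\<nu> i) - a' (\<nu> i)" i] that by simp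
    show "a = a'"
    proof
      fix k show "a k = a' k"
      proof (cases "k \<in> {1..n}")
        case True
        then obtain i where "i \<in> I" "k = \<nu> i"
          using bij_betw_imp_surj_on[OF \<nu>] by (metis imageE)
        then show ?thesis using * by simp
      qed (use a in \<open>auto simp: coord_space_def\<close>)
    qed
  qed
  moreover have "V \<subseteq> ?f ` coord_space n"
  proof
    fix v assume "v \<in> V"
    then obtain a where a: "v = (\<Sum>i\<in>I. s (a i) (b i))" using D(3) by blast
    \<comment> \<open>Entries outside \<open>{1..n}\<close> are set to 0 because
      \<open>coord_space\<close> demands it.\<close>
    let ?a = "\<lambda>k. if k \<in> {1..n} then a (inv_into I \<nu> k) else 0"
    have "\<nu> i \<in> {1..n}" if "i \<in> I" for i using \<nu> that bij_betw_apply by fast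
    then have "?f ?a = v"
      unfolding a using \<nu> by (intro sum.cong) (auto simp: bij_betw_def)
    moreover have "?a \<in> coord_space n" by (auto simp: coord_space_def)
    ultimately show "v \<in> ?f ` coord_space n" by (intro image_eqI[of _ _ ?a]) auto
  qed
  ultimately show ?thesis
    using lin unfolding linear_iso_def bij_betw_def linear_between_def by blast
qed

lemma continuous_map_mult:
  fixes f g :: "'a \<Rightarrow> 'b::real_normed_algebra"
  shows "\<lbrakk>continuous_map T euclidean f; continuous_map T euclidean g\<rbrakk>
    \<Longrightarrow> continuous_map T euclidean (\<lambda>x. f x * g x)"
  by (simp add: continuous_map_atin tendsto_mult)

section \<open>Inner products and orthonormal coordinates\<close>

context inner_product_space
begin

lemma ip_zero_right [simp]: "ip u 0 = 0"
  using ip_add_right[of u 0 0] by simp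

lemma ip_zero_left [simp]: "ip 0 u = 0"
  using ip_commute[of 0 u] by simp

lemma ip_sum_right: "ip u (\<Sum>i\<in>I. h i) = (\<Sum>i\<in>I. ip u (h i))"
  by (induction I rule: infinite_finite_induct) (auto simp: ip_add_right)

lemma ip_minus_right: "ip u (- v) = - ip u v"
  using ip_add_right[of u v "- v"] by (simp add: minus_unique)

lemma ip_diff_right: "ip u (v - w) = ip u v - ip u w"
  using ip_add_right[of u v "- w"] by (simp add: ip_minus_right)

lemma ip_add_left: "ip (u + v) w = ip u w + ip v w"
  by (metis ip_add_right ip_commute kcnj_add)

lemma ip_scale_left: "ip (sc a u) w = kcnj a * ip u w"
  by (metis ip_scale_right ip_commute kcnj_mult)

lemma ip_sum_left: "ip (\<Sum>i\<in>I. h i) u = (\<Sum>i\<in>I. ip (h i) u)"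
  by (induction I rule: infinite_finite_induct) (auto simp: ip_add_left)

lemma ip_self_eq_0_iff: "ip v v = 0 \<longleftrightarrow> v = 0"
  using ip_pos[of v] by (cases "v = 0") auto

lemma ip_dist_commute: "ip_dist ip v w = ip_dist ip w v"
proof -
  have "ip (v - w) (v - w) = ip (w - v) (w - v)"
    using ip_scale_right[of "- (w - v)" "- 1" "w - v"] ip_scale_left[of "- 1" "w - v" "w - v"]
    by (simp add: kcnj_minus)
  then show ?thesis by (simp add: ip_dist_def)
qed

lemma orthonormal_basisD:
  assumes "orthonormal_basis sc ip V Y"
  shows onb_subspace: "subspace V"
    and onb_in: "m \<in> {1..dim V} \<Longrightarrow> Y m \<in> V"
    and onb_ip: "m \<in> {1..dim V} \<Longrightarrow> n \<in> {1..dim V} \<Longrightarrow> ip (Y m) (Y n) = (if m = n then 1 else 0)"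
  using assms basis_familyD(1,2)[OF vector_space_axioms, of "{1..dim V}" Y V]
  by (auto simp: orthonormal_basis_def)

lemma onb_expand:
  assumes Y: "orthonormal_basis sc ip V Y" and v: "v \<in> V"
  shows "(\<Sum>m = 1..dim V. sc (ip (Y m) v) (Y m)) = v"
proof -
  obtain a where a: "v = (\<Sum>m = 1..dim V. sc (a m) (Y m))"
    using basis_familyD(3)[OF vector_space_axioms, of "{1..dim V}" Y V] Y v
    by (auto simp: orthonormal_basis_def)
  have "ip (Y m) v = a m" if "m \<in> {1..dim V}" for m
    using that by (simp add: a ip_sum_right ip_scale_right onb_ip[OF Y] if_distrib sum.delta' cong: if_cong)
  then show ?thesis using a by simp
qed

lemma onb_parseval:
  assumes Y: "orthonormal_basis sc ip V Y" and v: "v \<in> V"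
  shows "ip u v = (\<Sum>m = 1..dim V. ip u (Y m) * ip (Y m) v)"
  by (subst onb_expand[OF Y v, symmetric]) (simp add: ip_sum_right ip_scale_right mult.commute)

lemma onb_eqI:
  assumes "orthonormal_basis sc ip V Y" "v \<in> V" "w \<in> V"
    and "\<And>m. m \<in> {1..dim V} \<Longrightarrow> ip (Y m) v = ip (Y m) w"
  shows "v = w"
  using assms onb_expand[OF assms(1,2)] onb_expand[OF assms(1,3)] by (metis (no_types, lifting) sum.cong)

text \<open>In orthonormal coordinates the distance is Euclidean, so the triangle inequality and the
  bounds on single coordinates are those of \<open>L2_set\<close>.\<close>

lemma ip_dist_onb:
  assumes Y: "orthonormal_basis sc ip V Y" and "v \<in> V" "w \<in> V"
  shows "ip_dist ip v w = L2_set (\<lambda>m. norm (ip (Y m) (v - w))) {1..dim V}"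
proof -
  have vw: "v - w \<in> V" using assms onb_subspace[OF Y] subspace_diff by blast
  have "ip (v - w) (v - w) = (\<Sum>m = 1..dim V. ip (Y m) (v - w) * kcnj (ip (Y m) (v - w)))"
    by (subst onb_parseval[OF Y vw]) (simp flip: ip_commute add: mult.commute)
  also have "\<dots> = of_real (\<Sum>m = 1..dim V. (norm (ip (Y m) (v - w)))\<^sup>2)"
    by (simp add: mult_kcnj)
  finally show ?thesis
    by (simp add: ip_dist_def L2_set_def sum_nonneg abs_of_nonneg del: of_real_sum of_real_power)
qed

text \<open>The continuity clause of \<open>unitary_rep\<close> is phrased with
  \<open>Metric_space.mtopology\<close>, whose facts become available once \<open>ip_dist\<close> is
  a metric on the carrier.\<close>

lemma onb_Metric_space:
  assumes Y: "orthonormal_basis sc ip V Y"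
  shows "Metric_space V (ip_dist ip)"
proof
  fix x y show "0 \<le> ip_dist ip x y" by (simp add: ip_dist_def)
  show "ip_dist ip x y = ip_dist ip y x" by (rule ip_dist_commute)
next
  fix x y assume "x \<in> V" "y \<in> V"
  then show "ip_dist ip x y = 0 \<longleftrightarrow> x = y"
    by (simp add: ip_dist_def ip_self_eq_0_iff)
next
  fix x y z assume xyz: "x \<in> V" "y \<in> V" "z \<in> V"
  have "ip_dist ip x z = L2_set (\<lambda>m. norm (ip (Y m) (x - y) + ip (Y m) (y - z))) {1..dim V}"
    using xyz by (simp add: ip_dist_onb[OF Y] flip: ip_add_right)
  also have "\<dots> \<le> L2_set (\<lambda>m. norm (ip (Y m) (x - y)) + norm (ip (Y m) (y - z))) {1..dim V}"
    by (intro L2_set_mono norm_triangle_ineq norm_ge_zero)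
  also have "\<dots> \<le> ip_dist ip x y + ip_dist ip y z"
    using xyz by (simp add: ip_dist_onb[OF Y] L2_set_triangle_ineq)
  finally show "ip_dist ip x z \<le> ip_dist ip x y + ip_dist ip y z" .
qed

text \<open>Each orthonormal coordinate is 1-Lipschitz for \<open>ip_dist\<close>, and the inner
  product with any \<open>u\<close> is a fixed linear combination of coordinates; \<open>u\<close>
  may lie outside \<open>V\<close>.\<close>

lemma continuous_map_ip:
  assumes Y: "orthonormal_basis sc ip V Y" and f: "continuous_map T (Metric_space.mtopology V (ip_dist ip)) f"
  shows "continuous_map T euclidean (\<lambda>t. ip u (f t))"
proof -
  interpret M: Metric_space V "ip_dist ip" by (rule onb_Metric_space[OF Y])
  have fV: "f t \<in> V" if "t \<in> topspace T" for t
    using f that by (auto simp: continuous_map_def)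
  have coord: "continuous_map T euclidean (\<lambda>t. ip (Y m) (f t))" if m: "m \<in> {1..dim V}" for m
    unfolding mtopology_is_euclidean[symmetric] Met_TC.continuous_map_to_metric
  proof (intro ballI allI impI)
    fix t and \<epsilon> :: real assume t: "t \<in> topspace T" and \<epsilon>: "\<epsilon> > 0"
    obtain U where U: "openin T U" "t \<in> U" "\<forall>y\<in>U. f y \<in> M.mball (f t) \<epsilon>"
      using f t \<epsilon> unfolding M.continuous_map_to_metric by blast
    have "dist (ip (Y m) (f t)) (ip (Y m) (f y)) < \<epsilon>" if "y \<in> U" for y
    proof -
      have y: "f y \<in> M.mball (f t) \<epsilon>" using U(3) that by blast
      have "dist (ip (Y m) (f t)) (ip (Y m) (f y)) = norm (ip (Y m) (f t - f y))"
        by (simp add: dist_norm ip_diff_right)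
      also have "\<dots> \<le> L2_set (\<lambda>m. norm (ip (Y m) (f t - f y))) {1..dim V}"
        using m by (intro member_le_L2_set) auto
      also have "\<dots> = ip_dist ip (f t) (f y)"
        using y by (simp add: ip_dist_onb[OF Y])
      finally show ?thesis using y by simp
    qed
    then show "\<exists>U. openin T U \<and> t \<in> U \<and> (\<forall>y\<in>U. ip (Y m) (f y) \<in> Met_TC.mball (ip (Y m) (f t)) \<epsilon>)"
      using U by (intro exI[of _ U]) auto
  qed
  have "continuous_map T euclidean (\<lambda>t. \<Sum>m = 1..dim V. ip u (Y m) * ip (Y m) (f t))"
    using coord by (intro continuous_map_sum continuous_map_mult) auto
  then show ?thesis
    by (rule continuous_map_eq) (rule onb_parseval[OF Y fV, symmetric])
qed

end

section \<open>Representations and tensor products\<close>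

lemma vector_space_mult: "vector_space ((*) :: 'k::field \<Rightarrow> 'k \<Rightarrow> 'k)"
  by standard (auto simp: algebra_simps)

lemma module_fun_scale:
  assumes "vector_space s"
  shows "module (fun_scale s)"
  using vector_space_fun_scale[OF assms] by (simp add: module_iff_vector_space)

lemma linear_iso_inv_into:
  assumes m: "module s1" and V: "module.subspace s1 V" and f: "linear_iso s1 s2 V W f"
  shows "linear_iso s2 s1 W V (inv_into V f)"
proof -
  interpret module s1 by fact
  have lin: "linear_between s1 s2 V W f" and bij: "bij_betw f V W"
    using f by (auto simp: linear_iso_def)
  have inj: "inj_on f V" and im: "f ` V = W" using bij by (auto simp: bij_betw_def)
  have iV: "inv_into V f w \<in> V" and fi: "f (inv_into V f w) = w" if "w \<in> W" for w
    using that im by (auto intro: inv_into_into f_inv_into_f)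
  have "linear_between s2 s1 W V (inv_into V f)"
    unfolding linear_between_def
  proof (intro conjI ballI allI)
    fix x y assume xy: "x \<in> W" "y \<in> W"
    let ?v = "inv_into V f x + inv_into V f y"
    have "?v \<in> V" using xy iV V by (auto intro: subspace_add)
    moreover have "f ?v = x + y" using xy iV fi linear_between_add[OF lin] by simp
    ultimately show "inv_into V f (x + y) = ?v" using inv_into_f_eq[OF inj] by blast
  next
    fix a x assume x: "x \<in> W"
    let ?v = "s1 a (inv_into V f x)"
    have "?v \<in> V" using x iV V by (auto intro: subspace_scale)
    moreover have "f ?v = s2 a x" using x iV fi linear_between_scale[OF lin] by simp
    ultimately show "inv_into V f (s2 a x) = ?v" using inv_into_f_eq[OF inj] by blast
  qed (use iV in auto)
  then show ?thesis using bij_betw_inv_into[OF bij] by (simp add: linear_iso_def)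
qed

context inner_product_space
begin

lemma unitary_repD:
  assumes "unitary_rep G TG sc ip V \<rho>"
  shows rep_linear: "g \<in> carrier G \<Longrightarrow> linear_between sc sc V V (\<rho> g)"
    and rep_bij: "g \<in> carrier G \<Longrightarrow> bij_betw (\<rho> g) V V"
    and rep_in: "g \<in> carrier G \<Longrightarrow> v \<in> V \<Longrightarrow> \<rho> g v \<in> V"
    and rep_ip: "g \<in> carrier G \<Longrightarrow> v \<in> V \<Longrightarrow> w \<in> V \<Longrightarrow> ip (\<rho> g v) (\<rho> g w) = ip v w"
    and rep_one: "v \<in> V \<Longrightarrow> \<rho> \<one>\<^bsub>G\<^esub> v = v"
    and rep_mult: "g \<in> carrier G \<Longrightarrow> h \<in> carrier G \<Longrightarrow> v \<in> V \<Longrightarrow> \<rho> (g \<otimes>\<^bsub>G\<^esub> h) v = \<rho> g (\<rho> h v)"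
    and rep_cont: "v \<in> V \<Longrightarrow> continuous_map TG (Metric_space.mtopology V (ip_dist ip)) (\<lambda>g. \<rho> g v)"
  using assms by (auto simp: unitary_rep_def linear_iso_def linear_between_def)

lemma rep_subspace:
  assumes "unitary_rep G TG sc ip V \<rho>"
  shows "subspace V"
  using assms by (auto simp: unitary_rep_def finite_dim_subspace_def)

text \<open>Unitarity makes the action of the inverse the adjoint of \<open>\<rho> g\<close>; this
  is how group elements are moved across inner products.\<close>

lemma rep_inverse:
  assumes "group G" and U: "unitary_rep G TG sc ip V \<rho>" and g: "g \<in> carrier G" and v: "v \<in> V"
  shows rep_inv_right: "\<rho> g (\<rho> (inv\<^bsub>G\<^esub> g) v) = v"
    and rep_ip_left: "w \<in> V \<Longrightarrow> ip (\<rho> g v) w = ip v (\<rho> (inv\<^bsub>G\<^esub> g) w)"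
proof -
  interpret group G by fact
  have inv: "\<rho> g (\<rho> (inv\<^bsub>G\<^esub> g) x) = x" if "x \<in> V" for x
    using g that by (simp flip: rep_mult[OF U] add: rep_one[OF U])
  then show "\<rho> g (\<rho> (inv\<^bsub>G\<^esub> g) v) = v" using v .
  show "ip (\<rho> g v) w = ip v (\<rho> (inv\<^bsub>G\<^esub> g) w)" if w: "w \<in> V"
    using rep_ip[OF U g v, of "\<rho> (inv\<^bsub>G\<^esub> g) w"] inv[OF w] rep_in[OF U _ w, of "inv\<^bsub>G\<^esub> g"] g
    by simp
qed

lemma rep_matrix_coeff_continuous:
  assumes "unitary_rep G TG sc ip V \<rho>" "orthonormal_basis sc ip V Y" "v \<in> V"
  shows "continuous_map TG euclidean (\<lambda>g. ip u (\<rho> g v))"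
  using continuous_map_ip[OF assms(2) rep_cont[OF assms(1,3)]] .

text \<open>Kernel and image of \<open>f\<close> are invariant, so a single nonzero value forces the
  kernel to be 0 and the image to be \<open>W\<close>. Nothing is claimed about scalars, so the
  statement is the same over both fields.\<close>

lemma schur:
  assumes V: "irreducible_unitary_rep G TG sc ip V \<rho>" and W: "irreducible_unitary_rep G TG sc ip W \<sigma>"
    and lin: "linear_between sc sc V W f"
    and eqv: "\<And>g v. g \<in> carrier G \<Longrightarrow> v \<in> V \<Longrightarrow> f (\<rho> g v) = \<sigma> g (f v)"
    and v: "v \<in> V" "f v \<noteq> 0"
  shows "equivariant_iso G sc V \<rho> sc W \<sigma> f"
proof -
  have UV: "unitary_rep G TG sc ip V \<rho>" and UW: "unitary_rep G TG sc ip W \<sigma>"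
    using V W by (auto simp: irreducible_unitary_rep_def)
  have sV: "subspace V" and sW: "subspace W" using UV UW rep_subspace by auto
  have "\<sigma> g 0 = 0" if "g \<in> carrier G" for g
    using linear_between_0[OF rep_linear[OF UW that]] sW subspace_0 by blast
  then have "\<forall>g\<in>carrier G. \<forall>x\<in>{x \<in> V. f x = 0}. \<rho> g x \<in> {x \<in> V. f x = 0}"
    using eqv rep_in[OF UV] by auto
  then have "{x \<in> V. f x = 0} = {0} \<or> {x \<in> V. f x = 0} = V"
    using V linear_between_subspace_kernel[OF module_axioms module_axioms sV lin]
    unfolding irreducible_unitary_rep_def by blast
  then have ker: "x = 0" if "x \<in> V" "f x = 0" for x using v that by blast
  have "inj_on f V"
  proof (rule inj_onI)
    fix x y assume xy: "x \<in> V" "y \<in> V" "f x = f y"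
    then have "f (x - y) = 0" using linear_between_diff[OF module_axioms sV lin] by simp
    then show "x = y" using ker[of "x - y"] xy sV subspace_diff by auto
  qed
  moreover have "f ` V = W"
  proof -
    have "\<forall>g\<in>carrier G. \<forall>w\<in>f ` V. \<sigma> g w \<in> f ` V"
      using eqv[symmetric] rep_in[OF UV] by auto
    moreover have "f ` V \<subseteq> W" using lin by (auto simp: linear_between_def)
    moreover have "f ` V \<noteq> {0}" using v by blast
    ultimately show ?thesis
      using W linear_between_subspace_image[OF module_axioms module_axioms sV lin]
      unfolding irreducible_unitary_rep_def by blast
  qed
  ultimately show ?thesis
    using lin eqv by (simp add: equivariant_iso_def linear_iso_def bij_betw_def)
qed

section \<open>Tensor products and their universal property\<close>

lemma tensor_space_subspace: "module.subspace (fun_scale (*)) (tensor_space sc V W)"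
proof -
  interpret t: module "fun_scale ((*) :: 'k \<Rightarrow> _)" by (rule module_fun_scale[OF vector_space_mult])
  show ?thesis by (simp add: tensor_space_def)
qed

lemma pure_tensor_in: "v \<in> V \<Longrightarrow> w \<in> W \<Longrightarrow> pure_tensor sc V W v w \<in> tensor_space sc V W"
proof -
  interpret t: module "fun_scale ((*) :: 'k \<Rightarrow> _)" by (rule module_fun_scale[OF vector_space_mult])
  show "v \<in> V \<Longrightarrow> w \<in> W \<Longrightarrow> pure_tensor sc V W v w \<in> tensor_space sc V W"
    unfolding tensor_space_def by (rule t.span_base) auto
qed

text \<open>A pure tensor evaluates forms that are bilinear on the carriers and is 0 on all other
  functions, so linearity in each factor is inherited from the tested form.\<close>

lemma pure_tensor_linear_left:
  assumes "w \<in> W"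
  shows "linear_between sc (fun_scale (*)) V (tensor_space sc V W) (\<lambda>v. pure_tensor sc V W v w)"
  using assms pure_tensor_in
  by (auto simp: linear_between_def pure_tensor_def bilinear_form_on_def fun_scale_def fun_eq_iff)

lemma pure_tensor_linear_right:
  assumes "v \<in> V"
  shows "linear_between sc (fun_scale (*)) W (tensor_space sc V W) (pure_tensor sc V W v)"
  using assms pure_tensor_in
  by (auto simp: linear_between_def pure_tensor_def bilinear_form_on_def fun_scale_def fun_eq_iff)

lemma tensor_space_subset:
  assumes "module.subspace (fun_scale (*)) S" "\<And>v w. v \<in> V \<Longrightarrow> w \<in> W \<Longrightarrow> pure_tensor sc V W v w \<in> S"
  shows "tensor_space sc V W \<subseteq> S"
proof -
  interpret t: module "fun_scale ((*) :: 'k \<Rightarrow> _)" by (rule module_fun_scale[OF vector_space_mult])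
  show ?thesis unfolding tensor_space_def using assms by (intro t.span_minimal) auto
qed

text \<open>The set where two linear maps agree is a subspace containing the pure tensors. The
  targets \<open>U\<close> and \<open>U'\<close> may differ, which allows comparison with the zero
  map into \<open>{0}\<close>.\<close>

lemma tensor_linear_eqI:
  assumes s: "module s" and F: "linear_between (fun_scale (*)) s (tensor_space sc V W) U F"
    and F': "linear_between (fun_scale (*)) s (tensor_space sc V W) U' F'"
    and eq: "\<And>v w. v \<in> V \<Longrightarrow> w \<in> W \<Longrightarrow> F (pure_tensor sc V W v w) = F' (pure_tensor sc V W v w)"
    and t: "t \<in> tensor_space sc V W"
  shows "F t = F' t"
proof -
  interpret t: module "fun_scale ((*) :: 'k \<Rightarrow> _)" by (rule module_fun_scale[OF vector_space_mult])
  interpret s: module s by fact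
  let ?T = "tensor_space sc V W"
  have "t.subspace {t \<in> ?T. F t = F' t}"
  proof (rule t.subspaceI)
    have 0: "0 \<in> ?T" by (rule t.subspace_0[OF tensor_space_subspace])
    then show "0 \<in> {t \<in> ?T. F t = F' t}"
      using linear_between_0[OF F] linear_between_0[OF F'] by simp
  qed (use tensor_space_subspace linear_between_add[OF F] linear_between_add[OF F']
        linear_between_scale[OF F] linear_between_scale[OF F']
      in \<open>auto intro: t.subspace_add t.subspace_scale\<close>)
  then have "?T \<subseteq> {t \<in> ?T. F t = F' t}"
    using eq pure_tensor_in by (intro tensor_space_subset) auto
  then show ?thesis using t by blast
qed

text \<open>Tensors are functionals on bilinear forms, so a lift can be written down: its
  \<open>M\<close>-th coordinate is the value of \<open>t\<close> on the scalar form
  \<open>\<lambda>v w. ip (Y M) (b v w)\<close>.\<close>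

lemma tensor_lift_exists:
  assumes Y: "orthonormal_basis sc ip U Y"
    and r: "\<And>v. v \<in> V \<Longrightarrow> linear_between sc sc W U (b v)"
    and l: "\<And>w. w \<in> W \<Longrightarrow> linear_between sc sc V U (\<lambda>v. b v w)"
  shows "\<exists>F. linear_between (fun_scale (*)) sc (tensor_space sc V W) U F \<and>
    (\<forall>v\<in>V. \<forall>w\<in>W. F (pure_tensor sc V W v w) = b v w)"
proof (intro exI conjI ballI)
  let ?F = "\<lambda>t. \<Sum>M = 1..dim U. sc (t (\<lambda>v w. ip (Y M) (b v w))) (Y M)"
  show "linear_between (fun_scale (*)) sc (tensor_space sc V W) U ?F"
    using onb_in[OF Y] onb_subspace[OF Y]
    by (auto simp: linear_between_def fun_scale_def scale_left_distrib sum.distrib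
        scale_sum_right intro!: subspace_sum subspace_scale)
  show "?F (pure_tensor sc V W v w) = b v w" if "v \<in> V" "w \<in> W" for v w
  proof -
    have "bilinear_form_on sc V W (\<lambda>v w. ip u (b v w))" for u
      using r l by (auto simp: bilinear_form_on_def linear_between_def ip_add_right ip_scale_right)
    then show ?thesis
      using onb_expand[OF Y linear_between_in[OF r[OF that(1)] that(2)]]
      by (simp add: pure_tensor_def)
  qed
qed

lemma tensor_action_linear:
  assumes "linear_between sc sc V V (\<rho> g)" "linear_between sc sc W W (\<sigma> g)"
  shows "linear_between (fun_scale (*)) (fun_scale (*)) (tensor_space sc V W) (tensor_space sc V W)
    (tensor_action sc V W \<rho> \<sigma> g)"
proof -
  interpret t: module "fun_scale ((*) :: 'k \<Rightarrow> _)" by (rule module_fun_scale[OF vector_space_mult])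
  let ?T = "tensor_space sc V W" and ?A = "tensor_action sc V W \<rho> \<sigma> g"
  have add: "?A (x + y) = ?A x + ?A y" and scale: "?A (fun_scale (*) a x) = fun_scale (*) a (?A x)"
    and zero: "?A 0 = 0" for x y a
    by (auto simp: tensor_action_def fun_scale_def fun_eq_iff)
  \<comment> \<open>The action is additive and homogeneous on all functionals, so the preimage of
    the tensor space is a subspace and only pure tensors remain to be tested.\<close>
  have "t.subspace {t. ?A t \<in> ?T}"
    using tensor_space_subspace[of V W] by (simp add: t.subspace_def add scale zero)
  then have "?T \<subseteq> {t. ?A t \<in> ?T}"
    using tensor_action_pure_tensor[of sc V \<rho> g W \<sigma>] assms
    by (intro tensor_space_subset) (auto intro!: pure_tensor_in dest: linear_between_in)
  then show ?thesis unfolding linear_between_def using add scale by blast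
qed

end

section \<open>The Clebsch-Gordan decomposition\<close>

lemma linear_between_compose:
  assumes "linear_between s1 s2 V W f" "linear_between s2 s3 W U h"
  shows "linear_between s1 s3 V U (\<lambda>x. h (f x))"
  using assms by (auto simp: linear_between_def)

lemma (in vector_space) linear_between_sum_fun:
  assumes "subspace W" "\<And>i. i \<in> I \<Longrightarrow> linear_between s1 scale V W (f i)"
  shows "linear_between s1 scale V W (\<lambda>x. \<Sum>i\<in>I. f i x)"
  using assms by (auto simp: linear_between_def sum.distrib scale_sum_right intro!: subspace_sum sum.cong)

lemma direct_sum_single_in:
  assumes "p \<in> I" "v \<in> V p" "\<And>q. q \<in> I \<Longrightarrow> 0 \<in> V q"
  shows "direct_sum_single p v \<in> direct_sum I V"
proof -
  have "{q. direct_sum_single p v q \<noteq> 0} \<subseteq> {p}" by (auto simp: direct_sum_single_def)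
  then have "finite {q. direct_sum_single p v q \<noteq> 0}" using finite_subset by blast
  then show ?thesis using assms by (auto simp: direct_sum_def direct_sum_single_def)
qed

lemma direct_sum_subspace:
  assumes "vector_space s" "\<And>p. p \<in> I \<Longrightarrow> module.subspace s (V p)"
  shows "module.subspace (fun_scale s) (direct_sum I V)"
proof -
  interpret vector_space s by fact
  interpret f: module "fun_scale s" by (rule module_fun_scale[OF assms(1)])
  show ?thesis
  proof (rule f.subspaceI)
    show "0 \<in> direct_sum I V" using assms(2) subspace_0 by (auto simp: direct_sum_def)
  next
    fix x y assume xy: "x \<in> direct_sum I V" "y \<in> direct_sum I V"
    then have "finite ({p. x p \<noteq> 0} \<union> {p. y p \<noteq> 0})" by (auto simp: direct_sum_def)
    then have "finite {p. (x + y) p \<noteq> 0}" by (rule rev_finite_subset) auto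
    then show "x + y \<in> direct_sum I V"
      using xy assms(2) subspace_add by (auto simp: direct_sum_def)
  next
    fix a x assume x: "x \<in> direct_sum I V"
    then have "finite {p. x p \<noteq> 0}" by (auto simp: direct_sum_def)
    then have "finite {p. fun_scale s a x p \<noteq> 0}"
      by (rule rev_finite_subset) (auto simp: fun_scale_def)
    then show "fun_scale s a x \<in> direct_sum I V"
      using x assms(2) subspace_scale by (auto simp: direct_sum_def fun_scale_def)
  qed
qed

lemma direct_sum_decompose:
  assumes "u \<in> direct_sum I V"
  shows "u = (\<Sum>p | u p \<noteq> 0. direct_sum_single p (u p))"
proof
  fix q
  have "finite {p. u p \<noteq> 0}" using assms by (simp add: direct_sum_def)
  then show "u q = (\<Sum>p | u p \<noteq> 0. direct_sum_single p (u p)) q"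
    by (simp add: sum_fun_apply direct_sum_single_def)
qed

locale steerable_setting = inner_product_space sc ip
  for sc :: "'k::real_or_complex \<Rightarrow> 'v::ab_group_add \<Rightarrow> 'v" and ip :: "'v \<Rightarrow> 'v \<Rightarrow> 'k" +
  fixes G :: "('g, 'z) monoid_scheme" and TG :: "'g topology"
    and act :: "'g \<Rightarrow> 'x::t2_space \<Rightarrow> 'x" and \<mu> :: "'x measure"
    and Ghat :: "'j set" and V :: "'j \<Rightarrow> 'v set" and \<rho> :: "'j \<Rightarrow> 'g \<Rightarrow> 'v \<Rightarrow> 'v"
    and Y :: "'j \<Rightarrow> nat \<Rightarrow> 'v"
    and mlt :: "'j \<Rightarrow> nat" and Yh :: "'j \<Rightarrow> nat \<Rightarrow> nat \<Rightarrow> 'x \<Rightarrow> 'k"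
    and cgm :: "'j \<Rightarrow> 'j \<Rightarrow> 'j \<Rightarrow> nat"
    and CG :: "'j \<Rightarrow> 'j \<Rightarrow> (('v \<Rightarrow> 'v \<Rightarrow> 'k) \<Rightarrow> 'k) \<Rightarrow> 'j \<times> nat \<Rightarrow> 'v"
    and l J :: 'j
  assumes cg: "compact_group G TG"
    and hs: "homogeneous_space G TG act"
    and haar: "haar_measure G act \<mu>"
    and dual: "unitary_dual G TG sc ip Ghat V \<rho>"
    and onb: "j \<in> Ghat \<Longrightarrow> orthonormal_basis sc ip (V j) (Y j)"
    and harm: "harmonic_basis G act \<mu> sc ip Ghat V \<rho> Y mlt Yh"
    and clg: "clebsch_gordan G sc Ghat V \<rho> cgm CG"
    and l: "l \<in> Ghat" and J: "J \<in> Ghat"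
begin

lemma grp: "group G"
  using cg by (simp add: compact_group_def)

sublocale G: group G
  by (rule grp)

lemma irr: "j \<in> Ghat \<Longrightarrow> irreducible_unitary_rep G TG sc ip (V j) (\<rho> j)"
  using dual by (auto simp: unitary_dual_def)

lemma rep: "j \<in> Ghat \<Longrightarrow> unitary_rep G TG sc ip (V j) (\<rho> j)"
  using irr by (auto simp: irreducible_unitary_rep_def)

lemma subspace_V: "j \<in> Ghat \<Longrightarrow> subspace (V j)"
  using rep_subspace[OF rep] .

lemma zero_in_V: "j \<in> Ghat \<Longrightarrow> 0 \<in> V j"
  using subspace_V subspace_0 by blast

lemma rep_zero: "j \<in> Ghat \<Longrightarrow> g \<in> carrier G \<Longrightarrow> \<rho> j g 0 = 0"
  using linear_between_0[OF rep_linear[OF rep]] zero_in_V by blast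

lemma schur_Ghat:
  assumes "j \<in> Ghat" "k \<in> Ghat" "j \<noteq> k" "linear_between sc sc (V j) (V k) f"
    and "\<And>g v. g \<in> carrier G \<Longrightarrow> v \<in> V j \<Longrightarrow> f (\<rho> j g v) = \<rho> k g (f v)"
    and "v \<in> V j"
  shows "f v = 0"
proof (rule ccontr)
  assume "f v \<noteq> 0"
  then have "equivariant_iso G sc (V j) (\<rho> j) sc (V k) (\<rho> k) f"
    using schur[OF irr[OF assms(1)] irr[OF assms(2)] assms(4)] assms(5,6) by blast
  then show False using assms(1-3) dual unfolding unitary_dual_def by blast
qed

abbreviation "endo \<equiv> endo_space G sc (V J) (\<rho> J)"

lemma endoD:
  assumes "c \<in> endo"
  shows endo_linear: "linear_between sc sc (V J) (V J) c"
    and endo_equivariant: "g \<in> carrier G \<Longrightarrow> v \<in> V J \<Longrightarrow> c (\<rho> J g v) = \<rho> J g (c v)"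
    and endo_outside: "v \<notin> V J \<Longrightarrow> c v = 0"
    and endo_0: "c 0 = 0"
  using assms linear_between_0[OF _ zero_in_V[OF J]] by (auto simp: endo_space_def hom_space_def)

text \<open>These are the equivariant linear maps from V_j \<otimes> V_l to V_J in curried form;
  values off the carriers are left unconstrained.\<close>

definition equivariant_bilinear :: "'j \<Rightarrow> ('v \<Rightarrow> 'v \<Rightarrow> 'v) \<Rightarrow> bool" where
  "equivariant_bilinear j b \<longleftrightarrow>
     (\<forall>v\<in>V j. linear_between sc sc (V l) (V J) (b v)) \<and>
     (\<forall>w\<in>V l. linear_between sc sc (V j) (V J) (\<lambda>v. b v w)) \<and>
     (\<forall>g\<in>carrier G. \<forall>v\<in>V j. \<forall>w\<in>V l. b (\<rho> j g v) (\<rho> l g w) = \<rho> J g (b v w))"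

lemma equivariant_bilinearD:
  assumes "equivariant_bilinear j b"
  shows eqb_right: "v \<in> V j \<Longrightarrow> linear_between sc sc (V l) (V J) (b v)"
    and eqb_left: "w \<in> V l \<Longrightarrow> linear_between sc sc (V j) (V J) (\<lambda>v. b v w)"
    and eqb_equivariant: "g \<in> carrier G \<Longrightarrow> v \<in> V j \<Longrightarrow> w \<in> V l \<Longrightarrow> b (\<rho> j g v) (\<rho> l g w) = \<rho> J g (b v w)"
    and eqb_in: "v \<in> V j \<Longrightarrow> w \<in> V l \<Longrightarrow> b v w \<in> V J"
  using assms by (auto simp: equivariant_bilinear_def linear_between_def)

definition cg_proj :: "'j \<Rightarrow> nat \<Rightarrow> 'v \<Rightarrow> 'v \<Rightarrow> 'v" where
  "cg_proj j s v w = CG j l (pure_tensor sc (V j) (V l) v w) (J, s)"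

abbreviation "tensor j \<equiv> tensor_space sc (V j) (V l)"
abbreviation "cg_sum j \<equiv> direct_sum (cg_index Ghat cgm j l) (\<lambda>p. V (fst p))"

lemma cg_iso:
  assumes "j \<in> Ghat"
  shows "linear_iso (fun_scale (*)) (fun_scale sc) (tensor j) (cg_sum j) (CG j l)"
  using clg assms l by (auto simp: clebsch_gordan_def equivariant_iso_def)

lemma cg_linear: "j \<in> Ghat \<Longrightarrow> linear_between (fun_scale (*)) (fun_scale sc) (tensor j) (cg_sum j) (CG j l)"
  using cg_iso by (simp add: linear_iso_def)

lemma cg_equivariant:
  assumes "j \<in> Ghat" "g \<in> carrier G" "t \<in> tensor j"
  shows "CG j l (tensor_action sc (V j) (V l) (\<rho> j) (\<rho> l) g t) =
    (\<lambda>p. if p \<in> cg_index Ghat cgm j l then \<rho> (fst p) g (CG j l t p) else 0)"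
  using clg assms l by (auto simp: clebsch_gordan_def equivariant_iso_def)

lemma cg_index_fst: "p \<in> cg_index Ghat cgm j l \<Longrightarrow> fst p \<in> Ghat"
  by (auto simp: cg_index_def)

lemma J_in_cg_index [simp]: "(J, s) \<in> cg_index Ghat cgm j l \<longleftrightarrow> s \<in> {1..cgm J j l}"
  using J by (auto simp: cg_index_def)

lemma cg_component_linear:
  assumes "j \<in> Ghat" "p \<in> cg_index Ghat cgm j l"
  shows "linear_between (fun_scale (*)) sc (tensor j) (V (fst p)) (\<lambda>t. CG j l t p)"
  using cg_linear[OF assms(1)] assms(2)
  by (auto simp: linear_between_def direct_sum_def fun_scale_def)

lemma cg_proj_equivariant_bilinear:
  assumes j: "j \<in> Ghat" and s: "s \<in> {1..cgm J j l}"
  shows "equivariant_bilinear j (cg_proj j s)"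
  unfolding equivariant_bilinear_def
proof (intro conjI ballI)
  have comp: "linear_between (fun_scale (*)) sc (tensor j) (V J) (\<lambda>t. CG j l t (J, s))"
    using cg_component_linear[OF j, of "(J, s)"] s by simp
  show "linear_between sc sc (V l) (V J) (cg_proj j s v)" if "v \<in> V j" for v
    unfolding cg_proj_def by (rule linear_between_compose[OF pure_tensor_linear_right[OF that] comp])
  show "linear_between sc sc (V j) (V J) (\<lambda>v. cg_proj j s v w)" if "w \<in> V l" for w
    unfolding cg_proj_def by (rule linear_between_compose[OF pure_tensor_linear_left[OF that] comp])
  show "cg_proj j s (\<rho> j g v) (\<rho> l g w) = \<rho> J g (cg_proj j s v w)"
    if "g \<in> carrier G" "v \<in> V j" "w \<in> V l" for g v w
    using cg_equivariant[OF j that(1) pure_tensor_in[OF that(2,3)]] that s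
      tensor_action_pure_tensor[of sc "V j" "\<rho> j" g "V l" "\<rho> l"] rep_linear[OF rep] j l
    by (simp add: cg_proj_def)
qed

text \<open>Up to the isomorphism \<open>CG j l\<close>, an equivariant map \<open>V\<^sub>j \<otimes> V\<^sub>l \<rightarrow> V\<^sub>J\<close> is one on the direct sum,
  where Schur's lemma leaves only the summands \<open>V\<^sub>J\<close>.\<close>

lemma cg_decompose:
  assumes j: "j \<in> Ghat" and b: "equivariant_bilinear j b"
  shows "\<exists>C. (\<forall>s\<in>{1..cgm J j l}. C s \<in> endo) \<and>
    (\<forall>v\<in>V j. \<forall>w\<in>V l. b v w = (\<Sum>s = 1..cgm J j l. C s (cg_proj j s v w)))"
proof -
  interpret t: module "fun_scale ((*) :: 'k \<Rightarrow> _)" by (rule module_fun_scale[OF vector_space_mult])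
  interpret f: module "fun_scale sc" by (rule module_fun_scale[OF vector_space_axioms])
  let ?A = "tensor_action sc (V j) (V l) (\<rho> j) (\<rho> l)"
  let ?I = "cg_index Ghat cgm j l"
  obtain F where F: "linear_between (fun_scale (*)) sc (tensor j) (V J) F"
    and Fb: "\<And>v w. v \<in> V j \<Longrightarrow> w \<in> V l \<Longrightarrow> F (pure_tensor sc (V j) (V l) v w) = b v w"
    using tensor_lift_exists[OF onb[OF J] eqb_right[OF b] eqb_left[OF b]] by blast
  have A: "linear_between (fun_scale (*)) (fun_scale (*)) (tensor j) (tensor j) (?A g)"
    if "g \<in> carrier G" for g
    by (rule tensor_action_linear; rule rep_linear[OF rep that]) (use j l in auto)
  \<comment> \<open>Both sides are linear in \<open>t\<close>, so equivariance on pure tensors,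
    which is that of \<open>b\<close>, suffices.\<close>
  have FA: "F (?A g t) = \<rho> J g (F t)" if g: "g \<in> carrier G" and t: "t \<in> tensor j" for g t
  proof (rule tensor_linear_eqI[OF module_axioms _ _ _ t])
    show "linear_between (fun_scale (*)) sc (tensor j) (V J) (\<lambda>t. F (?A g t))"
      by (rule linear_between_compose[OF A[OF g] F])
    show "linear_between (fun_scale (*)) sc (tensor j) (V J) (\<lambda>t. \<rho> J g (F t))"
      by (rule linear_between_compose[OF F rep_linear[OF rep[OF J] g]])
    show "F (?A g (pure_tensor sc (V j) (V l) v w)) = \<rho> J g (F (pure_tensor sc (V j) (V l) v w))"
      if vw: "v \<in> V j" "w \<in> V l" for v w
    proof -
      have "?A g (pure_tensor sc (V j) (V l) v w) = pure_tensor sc (V j) (V l) (\<rho> j g v) (\<rho> l g w)"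
        by (rule tensor_action_pure_tensor; rule rep_linear[OF rep g]) (use j l in auto)
      then show ?thesis
        using vw rep_in[OF rep g] j l eqb_equivariant[OF b g] by (simp add: Fb)
    qed
  qed
  define H where "H u = F (inv_into (tensor j) (CG j l) u)" for u
  have inv: "linear_between (fun_scale sc) (fun_scale (*)) (cg_sum j) (tensor j) (inv_into (tensor j) (CG j l))"
    using linear_iso_inv_into[OF t.module_axioms tensor_space_subspace cg_iso[OF j]]
    by (simp add: linear_iso_def)
  have H: "linear_between (fun_scale sc) sc (cg_sum j) (V J) H"
    unfolding H_def by (rule linear_between_compose[OF inv F])
  have inj: "inj_on (CG j l) (tensor j)" and im: "CG j l ` tensor j = cg_sum j"
    using cg_iso[OF j] by (auto simp: linear_iso_def bij_betw_def)
  have HCG: "H (CG j l t) = F t" if "t \<in> tensor j" for t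
    using inj that by (simp add: H_def)
  have Heqv: "H (\<lambda>p. if p \<in> ?I then \<rho> (fst p) g (u p) else 0) = \<rho> J g (H u)"
    if g: "g \<in> carrier G" and u: "u \<in> cg_sum j" for g u
  proof -
    obtain t where t: "t \<in> tensor j" "u = CG j l t" using u im by blast
    have "?A g t \<in> tensor j" using linear_between_in[OF A[OF g] t(1)] .
    then show ?thesis
      unfolding t(2) using t(1) FA[OF g t(1)] by (simp add: HCG flip: cg_equivariant[OF j g t(1)])
  qed
  \<comment> \<open>The restriction of \<open>H\<close> to the summand \<open>p\<close>, extended by
    0 outside the carrier as membership in \<open>hom_space\<close> requires.\<close>
  define C where "C p v = (if v \<in> V (fst p) then H (direct_sum_single p v) else 0)" for p v
  have single: "direct_sum_single p v \<in> cg_sum j" if "p \<in> ?I" "v \<in> V (fst p)" for p v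
    using that zero_in_V cg_index_fst by (intro direct_sum_single_in) auto
  have C_lin: "linear_between sc sc (V (fst p)) (V J) (C p)" if p: "p \<in> ?I" for p
  proof -
    have "linear_between sc (fun_scale sc) (V (fst p)) (cg_sum j) (direct_sum_single p)"
      using single[OF p] by (auto simp: linear_between_def direct_sum_single_def fun_scale_def fun_eq_iff)
    from linear_between_compose[OF this H] show ?thesis
      using subspace_add[OF subspace_V[OF cg_index_fst[OF p]]]
        subspace_scale[OF subspace_V[OF cg_index_fst[OF p]]]
      unfolding linear_between_def C_def by simp
  qed
  have C_eqv: "C p (\<rho> (fst p) g v) = \<rho> J g (C p v)"
    if p: "p \<in> ?I" and g: "g \<in> carrier G" and v: "v \<in> V (fst p)" for p g v
  proof -
    have "direct_sum_single p (\<rho> (fst p) g v) =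
        (\<lambda>q. if q \<in> ?I then \<rho> (fst q) g (direct_sum_single p v q) else 0)"
      using p g rep_zero cg_index_fst by (auto simp: direct_sum_single_def fun_eq_iff)
    then show ?thesis
      using Heqv[OF g single[OF p v]] rep_in[OF rep[OF cg_index_fst[OF p]] g v] v by (simp add: C_def)
  qed
  have C_zero: "C p v = 0" if "p \<in> ?I" "fst p \<noteq> J" "v \<in> V (fst p)" for p v
    using schur_Ghat[OF cg_index_fst[OF that(1)] J that(2) C_lin[OF that(1)] C_eqv[OF that(1)] that(3)] .
  have H_sum: "H u = (\<Sum>s = 1..cgm J j l. C (J, s) (u (J, s)))" if u: "u \<in> cg_sum j" for u
  proof -
    let ?S = "{p. u p \<noteq> 0}" and ?P = "{J} \<times> {1..cgm J j l}"
    have fin: "finite ?S" and SI: "?S \<subseteq> ?I" and uV: "\<And>p. p \<in> ?I \<Longrightarrow> u p \<in> V (fst p)"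
      using u by (auto simp: direct_sum_def)
    have PI: "?P \<subseteq> ?I" by auto
    have "H u = H (\<Sum>p\<in>?S. direct_sum_single p (u p))"
      using direct_sum_decompose[OF u] by simp
    also have "\<dots> = (\<Sum>p\<in>?S. H (direct_sum_single p (u p)))"
      using SI uV single
      by (intro linear_between_sum[OF f.module_axioms direct_sum_subspace[OF vector_space_axioms] H])
        (auto intro!: subspace_V cg_index_fst)
    also have "\<dots> = (\<Sum>p\<in>?S. C p (u p))"
      using SI uV by (intro sum.cong) (auto simp: C_def)
    \<comment> \<open>The support of \<open>u\<close> may miss some copies of V_J. They are added
      with value 0 before the summands other than V_J are dropped by Schur's lemma.\<close>
    also have "\<dots> = (\<Sum>p\<in>?S \<union> ?P. C p (u p))"
      using fin PI C_lin linear_between_0[OF C_lin] zero_in_V[OF cg_index_fst]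
      by (intro sum.mono_neutral_left) auto
    also have "\<dots> = (\<Sum>p\<in>?P. C p (u p))"
    proof (intro sum.mono_neutral_right ballI)
      fix p assume p: "p \<in> ?S \<union> ?P - ?P"
      then have "p \<in> ?I" using SI by auto
      moreover from this p have "fst p \<noteq> J" by (auto simp: cg_index_def)
      ultimately show "C p (u p) = 0" using C_zero uV by blast
    qed (use fin in auto)
    also have "\<dots> = (\<Sum>s = 1..cgm J j l. C (J, s) (u (J, s)))"
      by (simp add: sum.cartesian_product' flip: sum.cartesian_product)
    finally show ?thesis .
  qed
  show ?thesis
  proof (intro exI[of _ "\<lambda>s. C (J, s)"] conjI ballI)
    show "C (J, s) \<in> endo" if "s \<in> {1..cgm J j l}" for s
      using C_lin[of "(J, s)"] C_eqv[of "(J, s)"] that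
      by (auto simp: endo_space_def hom_space_def C_def)
    fix v w assume vw: "v \<in> V j" "w \<in> V l"
    have "b v w = H (CG j l (pure_tensor sc (V j) (V l) v w))"
      using vw by (simp add: HCG pure_tensor_in Fb)
    also have "\<dots> = (\<Sum>s = 1..cgm J j l. C (J, s) (cg_proj j s v w))"
      unfolding cg_proj_def using vw im pure_tensor_in by (intro H_sum) blast
    finally show "b v w = (\<Sum>s = 1..cgm J j l. C (J, s) (cg_proj j s v w))" .
  qed
qed

text \<open>\<open>CG j l\<close> is onto, so some tensor has \<open>v\<close> in the copy (J, s)
  and 0 in all others; on it the sum reduces to \<open>C s v\<close>.\<close>

lemma cg_unique:
  assumes j: "j \<in> Ghat" and C: "\<And>s. s \<in> {1..cgm J j l} \<Longrightarrow> C s \<in> endo"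
    and 0: "\<And>v w. v \<in> V j \<Longrightarrow> w \<in> V l \<Longrightarrow> (\<Sum>s = 1..cgm J j l. C s (cg_proj j s v w)) = 0"
    and s: "s \<in> {1..cgm J j l}"
  shows "C s = 0"
proof
  let ?F = "\<lambda>t. \<Sum>s = 1..cgm J j l. C s (CG j l t (J, s))"
  interpret t: module "fun_scale ((*) :: 'k \<Rightarrow> _)" by (rule module_fun_scale[OF vector_space_mult])
  have F: "linear_between (fun_scale (*)) sc (tensor j) (V J) ?F"
  proof (rule linear_between_sum_fun[OF subspace_V[OF J]])
    fix s assume s: "s \<in> {1..cgm J j l}"
    show "linear_between (fun_scale (*)) sc (tensor j) (V J) (\<lambda>t. C s (CG j l t (J, s)))"
      using linear_between_compose[OF _ endo_linear[OF C[OF s]]] cg_component_linear[OF j, of "(J, s)"] s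
      by simp
  qed
  have F0: "?F t = 0" if "t \<in> tensor j" for t
  proof (rule tensor_linear_eqI[OF module_axioms F _ _ that])
    show "linear_between (fun_scale (*)) sc (tensor j) {0} (\<lambda>_. 0)"
      by (auto simp: linear_between_def)
  qed (use 0 in \<open>simp add: cg_proj_def\<close>)
  fix v
  show "C s v = 0 v"
  proof (cases "v \<in> V J")
    case True
    then have "direct_sum_single (J, s) v \<in> cg_sum j"
      using s zero_in_V cg_index_fst by (intro direct_sum_single_in) auto
    then obtain t where t: "t \<in> tensor j" "CG j l t = direct_sum_single (J, s) v"
      using cg_iso[OF j] unfolding linear_iso_def bij_betw_def by (metis imageE)
    have "?F t = (\<Sum>s'\<in>{1..cgm J j l}. if s' = s then C s v else 0)"
      using endo_0[OF C] by (intro sum.cong) (auto simp: t direct_sum_single_def)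
    then show ?thesis using F0[OF t(1)] s by simp
  qed (use endo_outside[OF C[OF s]] in simp)
qed

end

section \<open>Finiteness of the Clebsch-Gordan support\<close>

lemma (in inner_product_space) onb_linear_expand:
  assumes Y: "orthonormal_basis sc ip V Y" and F: "linear_between sc sc V W F" and v: "v \<in> V"
  shows "F v = (\<Sum>m = 1..dim V. sc (ip (Y m) v) (F (Y m)))"
proof -
  have scY: "sc a (Y m) \<in> V" if "m \<in> {1..dim V}" for a m
    by (rule subspace_scale[OF onb_subspace[OF Y] onb_in[OF Y that]])
  have "F v = F (\<Sum>m = 1..dim V. sc (ip (Y m) v) (Y m))" using onb_expand[OF Y v] by simp
  also have "\<dots> = (\<Sum>m = 1..dim V. F (sc (ip (Y m) v) (Y m)))"
    by (rule linear_between_sum[OF module_axioms onb_subspace[OF Y] F scY])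
  also have "\<dots> = (\<Sum>m = 1..dim V. sc (ip (Y m) v) (F (Y m)))"
    by (intro sum.cong refl linear_between_scale[OF F] onb_in[OF Y])
  finally show ?thesis .
qed

text \<open>Passes from kernels given by matrix elements to coordinate-free ones. The entries of
  \<open>A\<close> are compared only inside the index ranges, and outside the carrier both sides are
  0.\<close>

lemma (in inner_product_space) hom_of_matrix_eq:
  assumes V: "orthonormal_basis sc ip V YV" and W: "orthonormal_basis sc ip W YW"
    and F: "linear_between sc sc V W F"
    and A: "\<And>M n. M \<in> {1..dim W} \<Longrightarrow> n \<in> {1..dim V} \<Longrightarrow> A M n = ip (YW M) (F (YV n))"
  shows "hom_of_matrix sc ip V YV W YW A = (\<lambda>v. if v \<in> V then F v else 0)"
proof
  fix v
  show "hom_of_matrix sc ip V YV W YW A v = (if v \<in> V then F v else 0)"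
  proof (cases "v \<in> V")
    case True
    have Fv: "F v = (\<Sum>n = 1..dim V. sc (ip (YV n) v) (F (YV n)))"
      by (rule onb_linear_expand[OF V F True])
    have "hom_of_matrix sc ip V YV W YW A v =
        (\<Sum>M = 1..dim W. sc (\<Sum>n = 1..dim V. ip (YV n) v * ip (YW M) (F (YV n))) (YW M))"
      using True by (simp add: hom_of_matrix_def A scale_sum_left mult.commute)
    also have "\<dots> = (\<Sum>M = 1..dim W. sc (ip (YW M) (F v)) (YW M))"
      by (simp add: Fv ip_sum_right ip_scale_right)
    also have "\<dots> = F v" by (rule onb_expand[OF W linear_between_in[OF F True]])
    finally show ?thesis using True by simp
  qed (simp add: hom_of_matrix_def)
qed

context steerable_setting
begin

text \<open>The sum is the Hilbert-Schmidt pairing of \<open>A\<close> and \<open>B\<close>, which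
  has the same value on every orthonormal basis, and \<open>\<rho> l g\<close> maps one orthonormal
  basis to another.\<close>

lemma trace_invariant:
  assumes A: "linear_between sc sc (V l) (V J) A" and B: "linear_between sc sc (V l) (V J) B"
    and g: "g \<in> carrier G"
  shows "(\<Sum>n = 1..dim (V l). ip (A (\<rho> l g (Y l n))) (B (\<rho> l g (Y l n)))) =
    (\<Sum>n = 1..dim (V l). ip (A (Y l n)) (B (Y l n)))"
proof -
  let ?N = "{1..dim (V l)}"
  define u where "u p n = ip (Y l p) (\<rho> l g (Y l n))" for p n
  note Yl = onb[OF l]
  have gY: "\<rho> l h (Y l n) \<in> V l" if "h \<in> carrier G" "n \<in> ?N" for h n
    using that onb_in[OF Yl] rep_in[OF rep[OF l]] by blast
  have expand: "F (\<rho> l g (Y l n)) = (\<Sum>p\<in>?N. sc (u p n) (F (Y l p)))"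
    if "linear_between sc sc (V l) (V J) F" "n \<in> ?N" for F n
    unfolding u_def by (rule onb_linear_expand[OF Yl that(1) gY[OF g that(2)]])
  \<comment> \<open>Orthonormality of the rows of the unitary matrix \<open>u\<close> of
    \<open>\<rho> l g\<close>, obtained as the inner product of two basis vectors moved by the
    inverse group element.\<close>
  have delta: "(\<Sum>n\<in>?N. kcnj (u p n) * u q n) = (if p = q then 1 else 0)"
    if p: "p \<in> ?N" and q: "q \<in> ?N" for p q
  proof -
    have adj: "ip (\<rho> l g (Y l n)) (Y l r) = ip (Y l n) (\<rho> l (inv\<^bsub>G\<^esub> g) (Y l r))"
      if "n \<in> ?N" "r \<in> ?N" for n r
      using rep_ip_left[OF grp rep[OF l] g] onb_in[OF Yl] that by blast
    have "kcnj (u p n) * u q n =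
        ip (\<rho> l (inv\<^bsub>G\<^esub> g) (Y l q)) (Y l n) * ip (Y l n) (\<rho> l (inv\<^bsub>G\<^esub> g) (Y l p))"
      if n: "n \<in> ?N" for n
      using adj[OF n p] adj[OF n q] unfolding u_def
      by (metis ip_commute mult.commute)
    then have "(\<Sum>n\<in>?N. kcnj (u p n) * u q n) = ip (\<rho> l (inv\<^bsub>G\<^esub> g) (Y l q)) (\<rho> l (inv\<^bsub>G\<^esub> g) (Y l p))"
      by (subst onb_parseval[OF Yl gY[OF G.inv_closed[OF g] p]]) (rule sum.cong[OF refl])
    also have "\<dots> = ip (Y l q) (Y l p)"
      using rep_ip[OF rep[OF l] G.inv_closed[OF g]] onb_in[OF Yl] p q by blast
    finally show ?thesis using onb_ip[OF Yl q p] by auto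
  qed
  have "(\<Sum>n\<in>?N. ip (A (\<rho> l g (Y l n))) (B (\<rho> l g (Y l n)))) =
      (\<Sum>n\<in>?N. \<Sum>q\<in>?N. \<Sum>p\<in>?N. (kcnj (u p n) * u q n) * ip (A (Y l p)) (B (Y l q)))"
    by (simp add: expand[OF A] expand[OF B] ip_sum_left ip_sum_right ip_scale_left ip_scale_right
        sum_distrib_left mult_ac)
  also have "\<dots> = (\<Sum>q\<in>?N. \<Sum>p\<in>?N. \<Sum>n\<in>?N. (kcnj (u p n) * u q n) * ip (A (Y l p)) (B (Y l q)))"
    by (rule trans[OF sum.swap]) (rule sum.cong[OF refl sum.swap])
  also have "\<dots> = (\<Sum>q\<in>?N. \<Sum>p\<in>?N. (if p = q then 1 else 0) * ip (A (Y l p)) (B (Y l q)))"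
    by (intro sum.cong refl) (simp only: delta flip: sum_distrib_right)
  also have "\<dots> = (\<Sum>q\<in>?N. \<Sum>p\<in>?N. if p = q then ip (A (Y l p)) (B (Y l q)) else 0)"
    by (intro sum.cong refl) auto
  also have "\<dots> = (\<Sum>q\<in>?N. ip (A (Y l q)) (B (Y l q)))"
    by (intro sum.cong refl) (simp add: sum.delta)
  finally show ?thesis .
qed

text \<open>The Hilbert-Schmidt pairing of \<open>b v\<close> and \<open>b' v'\<close> is an invariant sesquilinear form on
  \<open>V\<^sub>j \<times> V\<^sub>k\<close>, hence represented by an equivariant map \<open>V\<^sub>k \<rightarrow> V\<^sub>j\<close>, which vanishes by Schur's lemma.\<close>

lemma hilbert_schmidt_orthogonal:
  assumes jk: "j \<in> Ghat" "k \<in> Ghat" "j \<noteq> k"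
    and b: "equivariant_bilinear j b" and b': "equivariant_bilinear k b'"
    and v: "v \<in> V j" and v': "v' \<in> V k"
  shows "(\<Sum>n = 1..dim (V l). ip (b v (Y l n)) (b' v' (Y l n))) = 0"
proof -
  define S where "S v v' = (\<Sum>n = 1..dim (V l). ip (b v (Y l n)) (b' v' (Y l n)))" for v v'
  \<comment> \<open>The Riesz vector of the form: \<open>S v v'\<close> is antilinear in
    \<open>v\<close>, hence it is the inner product of \<open>v\<close> with
    \<open>T v'\<close>.\<close>
  define T where "T v' = (\<Sum>m = 1..dim (V j). sc (S (Y j m) v') (Y j m))" for v'
  note Yj = onb[OF jk(1)] and Yl = onb[OF l]
  have S_inv: "S (\<rho> j g v) (\<rho> k g v') = S v v'" if g: "g \<in> carrier G" and v: "v \<in> V j" and v': "v' \<in> V k" for g v v'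
  proof -
    have "S (\<rho> j g v) (\<rho> k g v') =
        (\<Sum>n = 1..dim (V l). ip (b (\<rho> j g v) (\<rho> l g (Y l n))) (b' (\<rho> k g v') (\<rho> l g (Y l n))))"
      unfolding S_def
      using trace_invariant[OF eqb_right[OF b] eqb_right[OF b'] g] rep_in[OF rep g] jk v v' by simp
    also have "\<dots> = S v v'"
      unfolding S_def
      using onb_in[OF Yl] v v' g eqb_equivariant[OF b] eqb_equivariant[OF b'] eqb_in[OF b] eqb_in[OF b']
        rep_ip[OF rep[OF J]] by (intro sum.cong) auto
    finally show ?thesis .
  qed
  have S_T: "S v v' = ip v (T v')" if v: "v \<in> V j" for v v'
  proof -
    have "b v w = (\<Sum>m = 1..dim (V j). sc (ip (Y j m) v) (b (Y j m) w))" if w: "w \<in> V l" for w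
      by (rule onb_linear_expand[OF Yj eqb_left[OF b w] v])
    then have "S v v' = (\<Sum>n = 1..dim (V l). \<Sum>m = 1..dim (V j).
        kcnj (ip (Y j m) v) * ip (b (Y j m) (Y l n)) (b' v' (Y l n)))"
      unfolding S_def using onb_in[OF Yl] by (simp add: ip_sum_left ip_scale_left)
    also have "\<dots> = (\<Sum>m = 1..dim (V j). kcnj (ip (Y j m) v) * S (Y j m) v')"
      unfolding S_def sum_distrib_left by (rule sum.swap)
    also have "\<dots> = ip v (T v')"
      by (simp add: T_def ip_sum_right ip_scale_right mult.commute flip: ip_commute)
    finally show ?thesis .
  qed
  have T_in: "T v' \<in> V j" for v'
    unfolding T_def using onb_in[OF Yj] subspace_V[OF jk(1)] by (intro subspace_sum subspace_scale)
  have T_lin: "linear_between sc sc (V k) (V j) T"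
    unfolding linear_between_def
  proof (intro conjI ballI allI)
    fix x y assume xy: "x \<in> V k" "y \<in> V k"
    have "S u (x + y) = S u x + S u y" for u
      unfolding S_def using onb_in[OF Yl] xy linear_between_add[OF eqb_left[OF b']]
      by (simp add: ip_add_right sum.distrib)
    then show "T (x + y) = T x + T y" by (simp add: T_def scale_left_distrib sum.distrib)
  next
    fix a x assume x: "x \<in> V k"
    have "S u (sc a x) = a * S u x" for u
      unfolding S_def using onb_in[OF Yl] x linear_between_scale[OF eqb_left[OF b']]
      by (simp add: ip_scale_right sum_distrib_left)
    then show "T (sc a x) = sc a (T x)" by (simp add: T_def scale_sum_right)
  qed (rule T_in)
  have T_eqv: "T (\<rho> k g u) = \<rho> j g (T u)" if g: "g \<in> carrier G" and u: "u \<in> V k" for g u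
  proof (rule onb_eqI[OF Yj])
    fix m assume m: "m \<in> {1..dim (V j)}"
    note Ym = onb_in[OF Yj m]
    \<comment> \<open>Each basis vector is the image of some \<open>?w\<close> under
      \<open>\<rho> j g\<close>, so the invariance of \<open>S\<close> applies to the pair
      \<open>?w\<close> and \<open>u\<close>.\<close>
    let ?w = "\<rho> j (inv\<^bsub>G\<^esub> g) (Y j m)"
    have w: "?w \<in> V j" using rep_in[OF rep[OF jk(1)] _ Ym] g by simp
    have gw: "\<rho> j g ?w = Y j m" by (rule rep_inv_right[OF grp rep[OF jk(1)] g Ym])
    have "ip (Y j m) (T (\<rho> k g u)) = ip ?w (T u)"
      using S_T[OF Ym] S_inv[OF g w u] S_T[OF w] by (simp add: gw)
    also have "\<dots> = ip (Y j m) (\<rho> j g (T u))"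
      using rep_ip[OF rep[OF jk(1)] g w T_in] by (simp add: gw)
    finally show "ip (Y j m) (T (\<rho> k g u)) = ip (Y j m) (\<rho> j g (T u))" .
  qed (use T_in rep_in[OF rep[OF jk(1)] g] in auto)
  have "T v' = 0" using schur_Ghat[OF jk(2,1) _ T_lin T_eqv v'] jk(3) by simp
  then show ?thesis using S_T[OF v] by (simp add: S_def)
qed

text \<open>Were the projection zero, the family with the identity of V_J at \<open>s\<close> and 0
  at all other copies would be a nontrivial relation, against \<open>cg_unique\<close>, since V_J is
  not 0.\<close>

lemma cg_proj_nonzero:
  assumes j: "j \<in> Ghat" and s: "s \<in> {1..cgm J j l}"
  obtains v w where "v \<in> V j" "w \<in> V l" "cg_proj j s v w \<noteq> 0"
proof (rule ccontr)
  assume nex: "\<not> thesis"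
  have 0: "cg_proj j s v w = 0" if "v \<in> V j" "w \<in> V l" for v w
    using nex that(1,2) \<open>\<And>v w. v \<in> V j \<Longrightarrow> w \<in> V l \<Longrightarrow> cg_proj j s v w \<noteq> 0 \<Longrightarrow> thesis\<close> by blast
  define C where "C s' = (if s' = s then (\<lambda>v. if v \<in> V J then v else 0) else 0)" for s'
  have C: "C s' \<in> endo" for s'
    using subspace_V[OF J] subspace_add subspace_scale zero_in_V[OF J] rep_in[OF rep[OF J]] rep_zero[OF J]
    by (auto simp: C_def endo_space_def hom_space_def linear_between_def)
  have C0: "C s' 0 = 0" for s' by (simp add: C_def)
  have "C s = 0"
  proof (rule cg_unique[OF j C _ s])
    fix v w assume vw: "v \<in> V j" "w \<in> V l"
    have "C s' (cg_proj j s' v w) = 0" for s'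
      using 0[OF vw] by (cases "s' = s") (simp_all add: C_def)
    then show "(\<Sum>s' = 1..cgm J j l. C s' (cg_proj j s' v w)) = 0" by simp
  qed
  then have "v = 0" if "v \<in> V J" for v
  proof -
    have "C s v = 0 v" using \<open>C s = 0\<close> by (rule fun_cong)
    then show ?thesis using that by (simp add: C_def)
  qed
  then have "V J = {0}" using zero_in_V[OF J] by auto
  then show False using irr[OF J] by (simp add: irreducible_unitary_rep_def)
qed

text \<open>One nonzero slice \<open>cg_proj j 1 (v j)\<close> is picked for each contributing j.
  The slices are pairwise orthogonal, hence independent, in a space of dimension at most d_J d_l,
  which bounds their number.\<close>

lemma finite_cg_support: "finite {j \<in> Ghat. cgm J j l \<noteq> 0}"
proof -
  let ?S = "{j \<in> Ghat. cgm J j l \<noteq> 0}"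
  let ?P = "{1..dim (V J)} \<times> {1..dim (V l)}"
  interpret f: vector_space "fun_scale ((*) :: 'k \<Rightarrow> _) :: 'k \<Rightarrow> (nat \<times> nat \<Rightarrow> 'k) \<Rightarrow> _"
    by (rule vector_space_fun_scale[OF vector_space_mult])
  \<comment> \<open>A positive multiplicity guarantees a first copy, so the copy 1 can be used
    uniformly in j.\<close>
  have one: "1 \<in> {1..cgm J j l}" if "j \<in> ?S" for j using that by simp
  have "\<exists>v\<in>V j. \<exists>w\<in>V l. cg_proj j 1 v w \<noteq> 0" if "j \<in> ?S" for j
    using cg_proj_nonzero[OF _ one[OF that]] that by blast
  then have "\<forall>j\<in>?S. \<exists>v. v \<in> V j \<and> (\<exists>w\<in>V l. cg_proj j 1 v w \<noteq> 0)" by blast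
  from bchoice[OF this] obtain v where
    v: "v j \<in> V j" and nz: "\<exists>w\<in>V l. cg_proj j 1 (v j) w \<noteq> 0" if "j \<in> ?S" for j
    by blast
  have eb: "equivariant_bilinear j (cg_proj j 1)" if "j \<in> ?S" for j
    using cg_proj_equivariant_bilinear[OF _ one[OF that]] that by simp
  \<comment> \<open>The matrix of the chosen slice, padded by 0 outside the index rectangle so that
    it lies in the span of finitely many coordinate functions.\<close>
  define \<beta> where "\<beta> j p = (if p \<in> ?P then ip (Y J (fst p)) (cg_proj j 1 (v j) (Y l (snd p))) else 0)" for j p
  have \<beta>_ip: "(\<Sum>p\<in>?P. kcnj (\<beta> j p) * \<beta> k p) =
      (\<Sum>n = 1..dim (V l). ip (cg_proj j 1 (v j) (Y l n)) (cg_proj k 1 (v k) (Y l n)))"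
    if j: "j \<in> ?S" and k: "k \<in> ?S" for j k
  proof -
    have "(\<Sum>p\<in>?P. kcnj (\<beta> j p) * \<beta> k p) = (\<Sum>M = 1..dim (V J). \<Sum>n = 1..dim (V l).
        ip (cg_proj j 1 (v j) (Y l n)) (Y J M) * ip (Y J M) (cg_proj k 1 (v k) (Y l n)))"
      unfolding sum.cartesian_product by (intro sum.cong) (auto simp: \<beta>_def simp flip: ip_commute)
    also have "\<dots> = (\<Sum>n = 1..dim (V l). \<Sum>M = 1..dim (V J).
        ip (cg_proj j 1 (v j) (Y l n)) (Y J M) * ip (Y J M) (cg_proj k 1 (v k) (Y l n)))"
      by (rule sum.swap)
    also have "\<dots> = (\<Sum>n = 1..dim (V l). ip (cg_proj j 1 (v j) (Y l n)) (cg_proj k 1 (v k) (Y l n)))"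
      using eqb_in[OF eb[OF k] v[OF k]] onb_in[OF onb[OF l]]
      by (intro sum.cong refl onb_parseval[OF onb[OF J], symmetric]) blast
    finally show ?thesis .
  qed
  have orth: "(\<Sum>p\<in>?P. kcnj (\<beta> j p) * \<beta> k p) = 0" if "j \<in> ?S" "k \<in> ?S" "j \<noteq> k" for j k
    using hilbert_schmidt_orthogonal[OF _ _ _ eb eb v v] \<beta>_ip that by auto
  have self: "(\<Sum>p\<in>?P. kcnj (\<beta> j p) * \<beta> j p) \<noteq> 0" if j: "j \<in> ?S" for j
  proof
    assume "(\<Sum>p\<in>?P. kcnj (\<beta> j p) * \<beta> j p) = 0"
    then have "of_real (\<Sum>p\<in>?P. (norm (\<beta> j p))\<^sup>2) = (0 :: 'k)"
      by (simp add: mult.commute mult_kcnj)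
    then have "(\<Sum>p\<in>?P. (norm (\<beta> j p))\<^sup>2) = 0" by (simp only: of_real_eq_0_iff)
    then have \<beta>0: "\<beta> j p = 0" if "p \<in> ?P" for p
      using that by (auto simp: sum_nonneg_eq_0_iff)
    have "cg_proj j 1 (v j) (Y l n) = 0" if n: "n \<in> {1..dim (V l)}" for n
    proof (rule onb_eqI[OF onb[OF J]])
      show "cg_proj j 1 (v j) (Y l n) \<in> V J"
        using eqb_in[OF eb[OF j] v[OF j]] onb_in[OF onb[OF l] n] by blast
      show "ip (Y J M) (cg_proj j 1 (v j) (Y l n)) = ip (Y J M) 0" if "M \<in> {1..dim (V J)}" for M
        using \<beta>0[of "(M, n)"] that n by (simp add: \<beta>_def)
    qed (rule zero_in_V[OF J])
    then show False
      using nz[OF j] onb_linear_expand[OF onb[OF l] eqb_right[OF eb[OF j] v[OF j]]] by auto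
  qed
  \<comment> \<open>Orthogonal nonzero vectors are distinct; this brings the finiteness of the image
    under \<open>\<beta>\<close> back to the indices.\<close>
  have inj: "inj_on \<beta> ?S"
  proof (rule inj_onI, rule ccontr)
    fix j k assume "j \<in> ?S" "k \<in> ?S" "\<beta> j = \<beta> k" "j \<noteq> k"
    then show False using orth[of j k] self[of j] by simp
  qed
  have "f.independent (\<beta> ` ?S)"
    unfolding f.independent_explicit_module
  proof (intro allI impI)
    fix t u f assume t: "finite t" "t \<subseteq> \<beta> ` ?S" and 0: "(\<Sum>h\<in>t. fun_scale (*) (u h) h) = 0" and f: "f \<in> t"
    obtain j where j: "j \<in> ?S" "f = \<beta> j" using t f by blast
    \<comment> \<open>Pairing the relation with \<open>\<beta> j\<close> isolates the coefficient of
      \<open>f\<close>.\<close>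
    have "0 = (\<Sum>p\<in>?P. kcnj (\<beta> j p) * (\<Sum>h\<in>t. fun_scale (*) (u h) h) p)" by (simp add: 0)
    also have "\<dots> = (\<Sum>p\<in>?P. \<Sum>h\<in>t. u h * (kcnj (\<beta> j p) * h p))"
      by (simp add: sum_fun_apply fun_scale_def sum_distrib_left mult_ac)
    also have "\<dots> = (\<Sum>h\<in>t. u h * (\<Sum>p\<in>?P. kcnj (\<beta> j p) * h p))"
      unfolding sum_distrib_left by (rule sum.swap)
    also have "\<dots> = (\<Sum>h\<in>t. if h = f then u f * (\<Sum>p\<in>?P. kcnj (\<beta> j p) * \<beta> j p) else 0)"
    proof (rule sum.cong[OF refl])
      fix h assume "h \<in> t"
      then obtain k where k: "k \<in> ?S" "h = \<beta> k" using t by blast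
      show "u h * (\<Sum>p\<in>?P. kcnj (\<beta> j p) * h p) =
          (if h = f then u f * (\<Sum>p\<in>?P. kcnj (\<beta> j p) * \<beta> j p) else 0)"
      proof (cases "k = j")
        case False
        then have "h \<noteq> f" using inj_on_contraD[OF inj False k(1) j(1)] k j by simp
        then show ?thesis using orth[OF j(1) k(1)] False k by auto
      qed (use k j in simp)
    qed
    also have "\<dots> = u f * (\<Sum>p\<in>?P. kcnj (\<beta> j p) * \<beta> j p)" using t(1) f by simp
    finally show "u f = 0" using self[OF j(1)] by simp
  qed
  moreover have "\<beta> ` ?S \<subseteq> f.span ((\<lambda>p q. if q = p then 1 else 0) ` ?P)"
  proof
    fix f assume "f \<in> \<beta> ` ?S"
    then obtain j where f: "f = \<beta> j" by blast
    have "f = (\<Sum>p\<in>?P. fun_scale (*) (\<beta> j p) (\<lambda>q. if q = p then 1 else 0))"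
    proof
      fix q
      have "(\<Sum>p\<in>?P. \<beta> j p * (if q = p then 1 else 0)) = (\<Sum>p\<in>?P. if q = p then \<beta> j p else 0)"
        by (intro sum.cong) auto
      also have "\<dots> = f q" by (auto simp: f \<beta>_def)
      finally show "f q = (\<Sum>p\<in>?P. fun_scale (*) (\<beta> j p) (\<lambda>q. if q = p then 1 else 0)) q"
        by (simp add: sum_fun_apply fun_scale_def)
    qed
    then show "f \<in> f.span ((\<lambda>p q. if q = p then 1 else 0) ` ?P)"
      by (rule ssubst) (intro f.span_sum f.span_scale f.span_base imageI)
  qed
  ultimately have "finite (\<beta> ` ?S)"
    using f.independent_span_bound[of "(\<lambda>p q. if q = p then 1 else 0) ` ?P"] by auto
  then show ?thesis using inj by (rule finite_imageD)
qed

end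

section \<open>Steerable kernels from equivariant bilinear maps\<close>

context steerable_setting
begin

lemma harmonic_equivariant:
  assumes "j \<in> Ghat" "i \<in> {1..mlt j}" "m \<in> {1..dim (V j)}" "g \<in> carrier G"
  shows "Yh j i m (act (inv\<^bsub>G\<^esub> g) x) = (\<Sum>m' = 1..dim (V j). ip (Y j m') (\<rho> j g (Y j m)) * Yh j i m' x)"
  using harm assms unfolding harmonic_basis_def by blast

text \<open>The equivariant map \<open>\<psi>\<^sub>j\<^sub>i\<close>.\<close>

definition harm_vec :: "'j \<Rightarrow> nat \<Rightarrow> 'x \<Rightarrow> 'v" where
  "harm_vec j i x = (\<Sum>m = 1..dim (V j). sc (kcnj (Yh j i m x)) (Y j m))"

lemma harm_vec_in: "j \<in> Ghat \<Longrightarrow> harm_vec j i x \<in> V j"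
  unfolding harm_vec_def using onb_in[OF onb] subspace_V by (intro subspace_sum subspace_scale)

lemma ip_harm_vec:
  assumes j: "j \<in> Ghat" and m: "m \<in> {1..dim (V j)}"
  shows "ip (harm_vec j i x) (Y j m) = Yh j i m x"
proof -
  have "ip (harm_vec j i x) (Y j m) = (\<Sum>m' = 1..dim (V j). if m' = m then Yh j i m x else 0)"
    unfolding harm_vec_def ip_sum_left ip_scale_left
    using onb_ip[OF onb[OF j] _ m] by (intro sum.cong) auto
  then show ?thesis using m by simp
qed

text \<open>The harmonic transformation law concerns the inverse group element, so it is used at the
  inverse of \<open>g\<close>, and unitarity then moves the action to the other slot. Comparing in
  the first slot, where the coordinates are the unconjugated \<open>Yh j i m x\<close>, makes the
  law directly applicable.\<close>

lemma harm_vec_equivariant: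
  assumes j: "j \<in> Ghat" and i: "i \<in> {1..mlt j}" and g: "g \<in> carrier G"
  shows "harm_vec j i (act g x) = \<rho> j g (harm_vec j i x)"
proof (rule onb_eqI[OF onb[OF j]])
  fix m assume m: "m \<in> {1..dim (V j)}"
  let ?g' = "inv\<^bsub>G\<^esub> g"
  note Ym = onb_in[OF onb[OF j] m]
  have gYm: "\<rho> j ?g' (Y j m) \<in> V j" using rep_in[OF rep[OF j] _ Ym] g by simp
  have "ip (harm_vec j i (act g x)) (Y j m) =
      (\<Sum>m' = 1..dim (V j). ip (Y j m') (\<rho> j ?g' (Y j m)) * Yh j i m' x)"
    using harmonic_equivariant[OF j i m, of ?g' x] g by (simp add: ip_harm_vec[OF j m])
  also have "\<dots> = (\<Sum>m' = 1..dim (V j). ip (harm_vec j i x) (Y j m') * ip (Y j m') (\<rho> j ?g' (Y j m)))"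
    by (intro sum.cong refl) (simp add: ip_harm_vec[OF j])
  also have "\<dots> = ip (harm_vec j i x) (\<rho> j ?g' (Y j m))"
    by (rule onb_parseval[OF onb[OF j] gYm, symmetric])
  also have "\<dots> = ip (\<rho> j g (harm_vec j i x)) (Y j m)"
    using rep_ip_left[OF grp rep[OF j] g harm_vec_in[OF j] Ym] by simp
  finally show "ip (Y j m) (harm_vec j i (act g x)) = ip (Y j m) (\<rho> j g (harm_vec j i x))"
    by (metis ip_commute)
qed (use harm_vec_in[OF j] rep_in[OF rep[OF j] g] in auto)

section \<open>The vector space of steerable kernels\<close>

abbreviation "steer \<equiv> steerable_kernels G act sc (V l) (\<rho> l) (V J) (\<rho> J)"

text \<open>Substituting \<open>\<rho> l g v\<close> for the argument, which then still runs over
  all of \<open>V l\<close>, removes the inverse from the steerability constraint.\<close>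

lemma steer_iff:
  "K \<in> steer \<longleftrightarrow> (\<forall>x. linear_between sc sc (V l) (V J) (K x)) \<and> (\<forall>x v. v \<notin> V l \<longrightarrow> K x v = 0) \<and>
     (\<forall>g\<in>carrier G. \<forall>x. \<forall>v\<in>V l. K (act g x) (\<rho> l g v) = \<rho> J g (K x v))"
proof -
  have "(\<forall>v\<in>V l. K (act g x) v = \<rho> J g (K x (inv_into (V l) (\<rho> l g) v))) \<longleftrightarrow>
      (\<forall>v\<in>V l. K (act g x) (\<rho> l g v) = \<rho> J g (K x v))" if g: "g \<in> carrier G" for g x
  proof -
    note b = rep_bij[OF rep[OF l] g]
    have "(\<forall>v\<in>V l. P v) \<longleftrightarrow> (\<forall>v\<in>V l. P (\<rho> l g v))" for P
      by (subst bij_betw_imp_surj_on[OF b, symmetric]) blast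
    from this[of "\<lambda>v. K (act g x) v = \<rho> J g (K x (inv_into (V l) (\<rho> l g) v))"] show ?thesis
      using bij_betw_inv_into_left[OF b] by simp
  qed
  then show ?thesis by (auto simp: steerable_kernels_def hom_space_def)
qed

lemma steerD:
  assumes "K \<in> steer"
  shows steer_linear: "linear_between sc sc (V l) (V J) (K x)"
    and steer_outside: "v \<notin> V l \<Longrightarrow> K x v = 0"
    and steer_equivariant: "g \<in> carrier G \<Longrightarrow> v \<in> V l \<Longrightarrow> K (act g x) (\<rho> l g v) = \<rho> J g (K x v)"
    and steer_in: "v \<in> V l \<Longrightarrow> K x v \<in> V J"
  using assms by (auto simp: steer_iff linear_between_def)

text \<open>The index type is left free: it is the homogeneous space for kernels and the type of
  triples (j, i, s) for families of endomorphisms.\<close>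

lemma vector_space_kernels:
  "vector_space (fun_scale (fun_scale sc) :: 'k \<Rightarrow> ('y \<Rightarrow> 'v \<Rightarrow> 'v) \<Rightarrow> 'y \<Rightarrow> 'v \<Rightarrow> 'v)"
  by (intro vector_space_fun_scale vector_space_axioms)

lemma steer_subspace: "module.subspace (fun_scale (fun_scale sc)) steer"
proof -
  interpret f: vector_space "fun_scale (fun_scale sc) :: 'k \<Rightarrow> ('x \<Rightarrow> 'v \<Rightarrow> 'v) \<Rightarrow> _"
    by (rule vector_space_kernels)
  note \<rho>J = rep_linear[OF rep[OF J]]
  show ?thesis
  proof (rule f.subspaceI)
    show "0 \<in> steer"
      using zero_in_V[OF J] rep_zero[OF J] by (auto simp: steer_iff linear_between_def)
  next
    fix K L assume K: "K \<in> steer" and L: "L \<in> steer"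
    show "K + L \<in> steer"
      using steer_outside[OF K] steer_outside[OF L] steer_equivariant[OF K] steer_equivariant[OF L]
        steer_in[OF K] steer_in[OF L] steer_linear[OF K] steer_linear[OF L]
        subspace_add[OF subspace_V[OF J]] linear_between_add[OF \<rho>J]
      by (auto simp: steer_iff linear_between_def scale_right_distrib)
  next
    fix a K assume K: "K \<in> steer"
    show "fun_scale (fun_scale sc) a K \<in> steer"
      using steer_outside[OF K] steer_equivariant[OF K] steer_in[OF K] steer_linear[OF K]
        subspace_scale[OF subspace_V[OF J]] linear_between_scale[OF \<rho>J]
      by (auto simp: steer_iff linear_between_def fun_scale_def scale_right_distrib mult.commute)
  qed
qed

definition bilinear_kernel :: "('v \<Rightarrow> 'v \<Rightarrow> 'v) \<Rightarrow> 'j \<Rightarrow> nat \<Rightarrow> 'x \<Rightarrow> 'v \<Rightarrow> 'v" where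
  "bilinear_kernel b j i x = (\<lambda>w. if w \<in> V l then b (harm_vec j i x) w else 0)"

lemma bilinear_kernel_steer:
  assumes j: "j \<in> Ghat" and i: "i \<in> {1..mlt j}" and b: "equivariant_bilinear j b"
  shows "bilinear_kernel b j i \<in> steer"
proof -
  have "linear_between sc sc (V l) (V J) (bilinear_kernel b j i x)" for x
    using eqb_right[OF b harm_vec_in[OF j]] subspace_add[OF subspace_V[OF l]] subspace_scale[OF subspace_V[OF l]]
    by (auto simp: linear_between_def bilinear_kernel_def)
  then show ?thesis
    using eqb_equivariant[OF b _ harm_vec_in[OF j]] harm_vec_equivariant[OF j i] rep_in[OF rep[OF l]]
    by (auto simp: steer_iff bilinear_kernel_def)
qed

lemma endo_comp_equivariant_bilinear:
  assumes c: "c \<in> endo" and b: "equivariant_bilinear j b"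
  shows "equivariant_bilinear j (\<lambda>v w. c (b v w))"
  unfolding equivariant_bilinear_def
  using linear_between_compose[OF eqb_right[OF b] endo_linear[OF c]]
    linear_between_compose[OF eqb_left[OF b] endo_linear[OF c]]
    eqb_equivariant[OF b] endo_equivariant[OF c _ eqb_in[OF b]] by simp

section \<open>Kernels built from Clebsch-Gordan components\<close>

abbreviation "cg_kernel c j i s \<equiv> bilinear_kernel (\<lambda>v w. c (cg_proj j s v w)) j i"

lemma cg_kernel_steer:
  assumes "c \<in> endo" "j \<in> Ghat" "i \<in> {1..mlt j}" "s \<in> {1..cgm J j l}"
  shows "cg_kernel c j i s \<in> steer"
  using bilinear_kernel_steer endo_comp_equivariant_bilinear cg_proj_equivariant_bilinear assms by blast

text \<open>The common support in \<open>direct_sum_ip\<close> is at most the single index (J, s).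
  If the component there vanishes, the sum is empty and both sides are 0.\<close>

lemma cg_coeff_eq:
  assumes "M \<in> {1..dim (V J)}"
  shows "cg_coeff sc ip V Y CG s J M j m l n = ip (Y J M) (cg_proj j s (Y j m) (Y l n))"
proof -
  have "Y J M \<noteq> 0" using onb_ip[OF onb[OF J] assms assms] by auto
  then have *: "{p. direct_sum_single (J, s) (Y J M) p \<noteq> 0 \<and> u p \<noteq> 0} = (if u (J, s) = 0 then {} else {(J, s)})"
    for u :: "'j \<times> nat \<Rightarrow> 'v"
    by (auto simp: direct_sum_single_def)
  show ?thesis
    unfolding cg_coeff_def direct_sum_ip_def cg_proj_def * by (simp add: direct_sum_single_def)
qed

text \<open>Two expansions make up the double sum: that of \<open>harm_vec j i x\<close> in the
  basis of V_j, with coordinates \<open>kcnj (Yh j i m x)\<close>, and that of the Clebsch-Gordan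
  component in the basis of V_J.\<close>

lemma kernel_coeff_eq:
  assumes c: "c \<in> endo" and j: "j \<in> Ghat" and s: "s \<in> {1..cgm J j l}" and n: "n \<in> {1..dim (V l)}"
  shows "kernel_coeff sc ip V Y Yh CG l J c j i s x M n =
    ip (Y J M) (c (cg_proj j s (harm_vec j i x) (Y l n)))"
proof -
  note b = cg_proj_equivariant_bilinear[OF j s]
  note Yn = onb_in[OF onb[OF l] n]
  have lin: "linear_between sc sc (V j) (V J) (\<lambda>v. c (cg_proj j s v (Y l n)))"
    by (rule linear_between_compose[OF eqb_left[OF b Yn] endo_linear[OF c]])
  have coord: "ip (Y j m) (harm_vec j i x) = kcnj (Yh j i m x)" if "m \<in> {1..dim (V j)}" for m
    using ip_harm_vec[OF j that, of i x] by (metis ip_commute)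
  have "ip (Y J M) (c (cg_proj j s (harm_vec j i x) (Y l n))) =
      (\<Sum>m = 1..dim (V j). kcnj (Yh j i m x) * ip (Y J M) (c (cg_proj j s (Y j m) (Y l n))))"
    by (subst onb_linear_expand[OF onb[OF j] lin harm_vec_in[OF j]])
      (simp add: ip_sum_right ip_scale_right coord)
  also have "\<dots> = (\<Sum>m = 1..dim (V j). kcnj (Yh j i m x) * (\<Sum>M' = 1..dim (V J).
      ip (Y J M') (cg_proj j s (Y j m) (Y l n)) * ip (Y J M) (c (Y J M'))))"
  proof (intro sum.cong refl arg_cong2[where f = "(*)"])
    fix m assume m: "m \<in> {1..dim (V j)}"
    have "cg_proj j s (Y j m) (Y l n) \<in> V J" by (rule eqb_in[OF b onb_in[OF onb[OF j] m] Yn])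
    from onb_linear_expand[OF onb[OF J] endo_linear[OF c] this]
    show "ip (Y J M) (c (cg_proj j s (Y j m) (Y l n))) = (\<Sum>M' = 1..dim (V J).
      ip (Y J M') (cg_proj j s (Y j m) (Y l n)) * ip (Y J M) (c (Y J M')))"
      by (simp add: ip_sum_right ip_scale_right)
  qed
  also have "\<dots> = kernel_coeff sc ip V Y Yh CG l J c j i s x M n"
    unfolding kernel_coeff_def sum_distrib_left
    by (intro sum.cong refl) (simp add: cg_coeff_eq mult_ac)
  finally show ?thesis by simp
qed

lemma basis_kernel_eq:
  assumes c: "c r \<in> endo" and j: "j \<in> Ghat" and s: "s \<in> {1..cgm J j l}"
  shows "basis_kernel sc ip V Y Yh CG l J c j i s r = cg_kernel (c r) j i s"
proof
  fix x
  have "equivariant_bilinear j (\<lambda>v w. c r (cg_proj j s v w))"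
    by (rule endo_comp_equivariant_bilinear[OF c cg_proj_equivariant_bilinear[OF j s]])
  from eqb_right[OF this harm_vec_in[OF j]]
  have "hom_of_matrix sc ip (V l) (Y l) (V J) (Y J) (kernel_coeff sc ip V Y Yh CG l J (c r) j i s x) =
      (\<lambda>w. if w \<in> V l then c r (cg_proj j s (harm_vec j i x) w) else 0)"
    by (rule hom_of_matrix_eq[OF onb[OF l] onb[OF J]]) (rule kernel_coeff_eq[OF c j s])
  then show "basis_kernel sc ip V Y Yh CG l J c j i s r x = cg_kernel (c r) j i s x"
    by (simp add: basis_kernel_def bilinear_kernel_def)
qed

abbreviation "blocks \<equiv> block_index Ghat mlt cgm l J"

lemma finite_blocks: "finite blocks"
proof -
  have "blocks \<subseteq> (SIGMA j:{j \<in> Ghat. cgm J j l \<noteq> 0}. {1..mlt j} \<times> {1..cgm J j l})"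
    by (auto simp: block_index_def)
  then show ?thesis by (rule finite_subset) (use finite_cg_support in \<open>auto intro!: finite_SigmaI\<close>)
qed

lemma cg_kernel_sum_steer:
  assumes "\<And>p. p \<in> blocks \<Longrightarrow> C p \<in> endo"
  shows "(\<Sum>(j, i, s)\<in>blocks. cg_kernel (C (j, i, s)) j i s) \<in> steer"
proof -
  interpret f: vector_space "fun_scale (fun_scale sc) :: 'k \<Rightarrow> ('x \<Rightarrow> 'v \<Rightarrow> 'v) \<Rightarrow> _"
    by (rule vector_space_kernels)
  show ?thesis
    using assms by (intro f.subspace_sum[OF steer_subspace]) (auto simp: block_index_def intro!: cg_kernel_steer)
qed

lemma GKer_eq:
  assumes C: "C \<in> direct_sum blocks (\<lambda>_. endo)"
  shows "GKer sc ip V Y Yh CG l J C = (\<Sum>(j, i, s)\<in>blocks. cg_kernel (C (j, i, s)) j i s)"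
proof
  fix x
  have Cin: "C p \<in> endo" if "p \<in> blocks" for p using C that by (simp add: direct_sum_def)
  have C0: "C p = 0" if "p \<notin> blocks" for p
    using C that by (cases p) (simp add: direct_sum_def)
  have coeff: "(\<Sum>(j, i, s) | C (j, i, s) \<noteq> 0. kernel_coeff sc ip V Y Yh CG l J (C (j, i, s)) j i s x M n) =
      ip (Y J M) ((\<Sum>(j, i, s)\<in>blocks. cg_kernel (C (j, i, s)) j i s) x (Y l n))"
    if n: "n \<in> {1..dim (V l)}" for M n
  proof -
    \<comment> \<open>\<open>GKer\<close> sums over the support of \<open>C\<close>; the zero
      endomorphism contributes 0, so the sum extends to the finite set
      \<open>blocks\<close>.\<close>
    have "(\<Sum>p | C p \<noteq> 0. (\<lambda>(j, i, s). kernel_coeff sc ip V Y Yh CG l J (C (j, i, s)) j i s x M n) p) =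
        (\<Sum>p\<in>blocks. (\<lambda>(j, i, s). kernel_coeff sc ip V Y Yh CG l J (C (j, i, s)) j i s x M n) p)"
      using finite_blocks C0 by (intro sum.mono_neutral_left) (auto simp: kernel_coeff_def)
    also have "\<dots> = (\<Sum>p\<in>blocks. ip (Y J M) ((\<lambda>(j, i, s). cg_kernel (C (j, i, s)) j i s) p x (Y l n)))"
      using onb_in[OF onb[OF l] n] Cin
      by (intro sum.cong refl) (auto simp: block_index_def bilinear_kernel_def intro!: kernel_coeff_eq n)
    finally show ?thesis
      by (simp add: case_prod_unfold sum_fun_apply ip_sum_right)
  qed
  have K: "(\<Sum>(j, i, s)\<in>blocks. cg_kernel (C (j, i, s)) j i s) \<in> steer"
    by (rule cg_kernel_sum_steer[OF Cin])
  show "GKer sc ip V Y Yh CG l J C x = (\<Sum>(j, i, s)\<in>blocks. cg_kernel (C (j, i, s)) j i s) x"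
    unfolding GKer_def
    by (subst hom_of_matrix_eq[OF onb[OF l] onb[OF J] steer_linear[OF K, of x] coeff])
      (use steer_outside[OF K, of _ x] in auto)
qed

end

section \<open>Integration over the homogeneous space\<close>

lemma square_integrable_mult:
  fixes f g :: "'x \<Rightarrow> 'k::real_or_complex"
  assumes "square_integrable \<mu> f" "square_integrable \<mu> g"
  shows "integrable \<mu> (\<lambda>x. kcnj (f x) * g x)"
proof (rule Bochner_Integration.integrable_bound)
  have [measurable]: "f \<in> borel_measurable \<mu>" "g \<in> borel_measurable \<mu>"
    using assms by (auto simp: square_integrable_def)
  have [measurable]: "kcnj \<in> borel_measurable (borel :: 'k measure)"
    by (intro borel_measurable_continuous_onI linear_continuous_on bounded_linear_kcnj)
  show "(\<lambda>x. kcnj (f x) * g x) \<in> borel_measurable \<mu>" by measurable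
  show "integrable \<mu> (\<lambda>x. (norm (f x))\<^sup>2 + (norm (g x))\<^sup>2)"
    using assms by (auto simp: square_integrable_def)
  have "norm (f x) * norm (g x) \<le> (norm (f x))\<^sup>2 + (norm (g x))\<^sup>2" for x
    using sum_squares_bound[of "norm (f x)" "norm (g x)"]
      mult_nonneg_nonneg[OF norm_ge_zero norm_ge_zero, of "f x" "g x"] by linarith
  then show "AE x in \<mu>. norm (kcnj (f x) * g x) \<le> norm ((norm (f x))\<^sup>2 + (norm (g x))\<^sup>2)"
    by (simp add: norm_mult)
qed

lemma square_integrable_scale:
  fixes f :: "'x \<Rightarrow> 'k::real_or_complex"
  shows "square_integrable \<mu> f \<Longrightarrow> square_integrable \<mu> (\<lambda>x. a * f x)"
  by (auto simp: square_integrable_def norm_mult power_mult_distrib)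

lemma square_integrable_add:
  fixes f g :: "'x \<Rightarrow> 'k::real_or_complex"
  assumes f: "square_integrable \<mu> f" and g: "square_integrable \<mu> g"
  shows "square_integrable \<mu> (\<lambda>x. f x + g x)"
proof -
  have [measurable]: "f \<in> borel_measurable \<mu>" "g \<in> borel_measurable \<mu>"
    using assms by (auto simp: square_integrable_def)
  have "integrable \<mu> (\<lambda>x. (norm (f x + g x))\<^sup>2)"
  proof (rule Bochner_Integration.integrable_bound)
    show "integrable \<mu> (\<lambda>x. 2 * (norm (f x))\<^sup>2 + 2 * (norm (g x))\<^sup>2)"
      using assms by (auto simp: square_integrable_def)
    have "(norm (f x + g x))\<^sup>2 \<le> 2 * (norm (f x))\<^sup>2 + 2 * (norm (g x))\<^sup>2" for x
    proof -
      have "(norm (f x + g x))\<^sup>2 \<le> (norm (f x) + norm (g x))\<^sup>2"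
        by (intro power_mono norm_triangle_ineq norm_ge_zero)
      also have "\<dots> \<le> 2 * (norm (f x))\<^sup>2 + 2 * (norm (g x))\<^sup>2"
        using sum_squares_bound[of "norm (f x)" "norm (g x)"] by (simp add: power2_sum)
      finally show ?thesis .
    qed
    then show "AE x in \<mu>. norm ((norm (f x + g x))\<^sup>2) \<le> norm (2 * (norm (f x))\<^sup>2 + 2 * (norm (g x))\<^sup>2)"
      by simp
  qed measurable
  then show ?thesis by (simp add: square_integrable_def)
qed

lemma square_integrable_sum:
  fixes f :: "'i \<Rightarrow> 'x \<Rightarrow> 'k::real_or_complex"
  shows "(\<And>i. i \<in> I \<Longrightarrow> square_integrable \<mu> (f i)) \<Longrightarrow> square_integrable \<mu> (\<lambda>x. \<Sum>i\<in>I. f i x)"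
proof (induction I rule: infinite_finite_induct)
  case (insert i I)
  then show ?case using square_integrable_add[of \<mu> "f i"] by simp
qed (auto simp: square_integrable_def)

text \<open>Completeness is given as density of finite combinations. If such an \<open>s\<close>
  approximates \<open>h\<close> while \<open>h\<close> is orthogonal to it, Pythagoras bounds the
  squared norm of \<open>h\<close> by the squared error of approximation.\<close>

lemma hilbert_basis_L2_complete:
  fixes e :: "'i \<Rightarrow> 'x \<Rightarrow> 'k::real_or_complex"
  assumes e: "hilbert_basis_L2 \<mu> I e" and h: "square_integrable \<mu> h"
    and orth: "\<And>p. p \<in> I \<Longrightarrow> L2_ip \<mu> (e p) h = 0"
  shows "AE x in \<mu>. h x = 0"
proof -
  have bound: "(LINT x|\<mu>. (norm (h x))\<^sup>2) \<le> \<epsilon>" if "\<epsilon> > 0" for \<epsilon>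
  proof -
    have "\<forall>\<epsilon>>0. \<exists>F a. finite F \<and> F \<subseteq> I \<and> (LINT x|\<mu>. (norm (h x - (\<Sum>p\<in>F. a p * e p x)))\<^sup>2) < \<epsilon>"
      using e h by (simp add: hilbert_basis_L2_def)
    then obtain F a where F: "finite F" "F \<subseteq> I"
      and le: "(LINT x|\<mu>. (norm (h x - (\<Sum>p\<in>F. a p * e p x)))\<^sup>2) < \<epsilon>"
      using \<open>\<epsilon> > 0\<close> by meson
    define s where "s x = (\<Sum>p\<in>F. a p * e p x)" for x
    have ep: "square_integrable \<mu> (e p)" if "p \<in> F" for p
      using e F that by (auto simp: hilbert_basis_L2_def)
    have s: "square_integrable \<mu> s"
      unfolding s_def using ep by (intro square_integrable_sum square_integrable_scale)
    have "(LINT x|\<mu>. kcnj (s x) * h x) = (LINT x|\<mu>. (\<Sum>p\<in>F. kcnj (a p) * (kcnj (e p x) * h x)))"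
      by (simp add: s_def kcnj_sum kcnj_mult sum_distrib_right mult.assoc)
    also have "\<dots> = (\<Sum>p\<in>F. kcnj (a p) * (LINT x|\<mu>. kcnj (e p x) * h x))"
      using square_integrable_mult[OF ep h] by (subst Bochner_Integration.integral_sum) auto
    also have "\<dots> = 0"
      using orth F by (intro sum.neutral) (auto simp: L2_ip_def)
    finally have sh: "(LINT x|\<mu>. kcnj (s x) * h x) = 0" .
    have "(LINT x|\<mu>. kcnj (h x) * s x) = (LINT x|\<mu>. kcnj (kcnj (s x) * h x))"
      by (simp add: kcnj_mult mult.commute)
    also have "\<dots> = kcnj (LINT x|\<mu>. kcnj (s x) * h x)"
      by (rule integral_bounded_linear[OF bounded_linear_kcnj square_integrable_mult[OF s h]])
    finally have hs: "(LINT x|\<mu>. kcnj (h x) * s x) = 0" using sh by simp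
    have hI: "integrable \<mu> (\<lambda>x. (norm (h x))\<^sup>2)" and sI: "integrable \<mu> (\<lambda>x. (norm (s x))\<^sup>2)"
      using h s by (auto simp: square_integrable_def)
    have dI: "integrable \<mu> (\<lambda>x. (norm (h x - s x))\<^sup>2)"
      using square_integrable_add[OF h square_integrable_scale[OF s, of "- 1"]]
      by (simp add: square_integrable_def)
    have ofr: "(LINT x|\<mu>. (of_real (f x) :: 'k)) = of_real (LINT x|\<mu>. f x)" if "integrable \<mu> f" for f
      by (rule integral_bounded_linear[OF bounded_linear_of_real that])
    have ofrI: "integrable \<mu> (\<lambda>x. (of_real (f x) :: 'k))" if "integrable \<mu> f" for f
      by (rule integrable_bounded_linear[OF bounded_linear_of_real that])
    \<comment> \<open>The square is expanded in the scalar field because each cross term is a field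
      element, not a real number; both integrate to 0.\<close>
    have "of_real ((norm (h x - s x))\<^sup>2) = (of_real ((norm (h x))\<^sup>2) + of_real ((norm (s x))\<^sup>2) :: 'k)
        - (kcnj (s x) * h x + kcnj (h x) * s x)" for x
      unfolding mult_kcnj[symmetric] kcnj_diff by (simp add: algebra_simps)
    then have "(LINT x|\<mu>. (of_real ((norm (h x - s x))\<^sup>2) :: 'k)) =
        (LINT x|\<mu>. of_real ((norm (h x))\<^sup>2)) + (LINT x|\<mu>. of_real ((norm (s x))\<^sup>2))
        - ((LINT x|\<mu>. kcnj (s x) * h x) + (LINT x|\<mu>. kcnj (h x) * s x))"
      using ofrI[OF hI] ofrI[OF sI] square_integrable_mult[OF s h] square_integrable_mult[OF h s]
      by (simp only: Bochner_Integration.integral_diff Bochner_Integration.integral_add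
          Bochner_Integration.integrable_add)
    then have "(of_real (LINT x|\<mu>. (norm (h x - s x))\<^sup>2) :: 'k) =
        of_real ((LINT x|\<mu>. (norm (h x))\<^sup>2) + (LINT x|\<mu>. (norm (s x))\<^sup>2))"
      unfolding ofr[OF dI] ofr[OF hI] ofr[OF sI] sh hs by simp
    then have "(LINT x|\<mu>. (norm (h x - s x))\<^sup>2) = (LINT x|\<mu>. (norm (h x))\<^sup>2) + (LINT x|\<mu>. (norm (s x))\<^sup>2)"
      by (simp only: of_real_eq_iff)
    moreover have "(LINT x|\<mu>. (norm (s x))\<^sup>2) \<ge> 0" by simp
    ultimately show ?thesis using le unfolding s_def[symmetric] by linarith
  qed
  have "(LINT x|\<mu>. (norm (h x))\<^sup>2) \<le> 0"
    by (rule field_le_epsilon) (use bound in simp)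
  then have "(LINT x|\<mu>. (norm (h x))\<^sup>2) = 0"
    by (intro antisym) simp_all
  then show ?thesis
    using h integral_nonneg_eq_0_iff_AE[of \<mu> "\<lambda>x. (norm (h x))\<^sup>2"] by (simp add: square_integrable_def)
qed

lemma Hausdorff_space_t2: "Hausdorff_space (euclidean :: 'x::t2_space topology)"
  unfolding Hausdorff_space_def disjnt_def by (simp, meson hausdorff)

section \<open>Compactness, continuity and invariance on the homogeneous space\<close>

context steerable_setting
begin

sublocale act: transitive_action G UNIV act
  using hs by (simp add: homogeneous_space_def)

lemma topspace_TG: "topspace TG = carrier G"
  using cg by (simp add: compact_group_def)

lemma act_continuous_map:
  "continuous_map (prod_topology TG euclidean) euclidean (\<lambda>(g, x). act g x)"
  using hs by (simp add: homogeneous_space_def)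

lemma orbit_continuous: "continuous_map TG euclidean (\<lambda>g. act g x)"
proof -
  have "continuous_map TG (prod_topology TG euclidean) (\<lambda>g. (g, x))"
    by (simp add: continuous_map_pairwise o_def)
  from continuous_map_compose[OF this act_continuous_map] show ?thesis by (simp add: o_def)
qed

lemma act_continuous: "g \<in> carrier G \<Longrightarrow> continuous_on UNIV (act g)"
proof -
  assume "g \<in> carrier G"
  then have "continuous_map euclidean (prod_topology TG euclidean) (\<lambda>x::'x. (g, x))"
    by (simp add: continuous_map_pairwise o_def topspace_TG)
  from continuous_map_compose[OF this act_continuous_map] show ?thesis by (simp add: o_def)
qed

lemma orbit_surj: "(\<lambda>g. act g x) ` carrier G = UNIV"
  using act.unique_orbit[of x] by (auto simp: image_iff) metis

text \<open>Transitivity makes the space the image of the compact group under one orbit map.\<close>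

lemma compact_X: "compact (UNIV :: 'x set)"
proof -
  have "compactin TG (topspace TG)"
    using cg unfolding compact_group_def compact_space_def by blast
  from image_compactin[OF this orbit_continuous] show ?thesis
    by (simp add: topspace_TG orbit_surj compactin_euclidean_iff)
qed

text \<open>The orbit map is a closed map from a compact space to a Hausdorff space, hence a quotient map.\<close>

lemma continuous_if_orbit_continuous:
  fixes f :: "'x \<Rightarrow> 'b::topological_space"
  assumes "continuous_map TG euclidean (\<lambda>g. f (act g x))"
  shows "continuous_on UNIV f"
proof -
  have "closed_map TG (euclidean :: 'x topology) (\<lambda>g. act g x)"
    using cg by (intro T1_Spaces.continuous_imp_closed_map orbit_continuous Hausdorff_space_t2)
      (auto simp: compact_group_def)
  then have "quotient_map TG (euclidean :: 'x topology) (\<lambda>g. act g x)"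
    using orbit_continuous orbit_surj
    by (intro continuous_closed_imp_quotient_map) (auto simp: topspace_TG)
  then have "continuous_map euclidean euclidean f"
    by (rule continuous_compose_quotient_map) (use assms in \<open>simp add: o_def\<close>)
  then show ?thesis by simp
qed

lemma sets_\<mu> [measurable_cong]: "sets \<mu> = sets borel"
  and emeasure_\<mu>: "emeasure \<mu> UNIV = 1"
  and \<mu>_invariant: "g \<in> carrier G \<Longrightarrow> distr \<mu> borel (act g) = \<mu>"
  using haar by (auto simp: haar_measure_def)

lemma space_\<mu>: "space \<mu> = UNIV"
  using sets_eq_imp_space_eq[OF sets_\<mu>] by simp

lemma finite_measure_\<mu>: "finite_measure \<mu>"
  by standard (simp add: space_\<mu> emeasure_\<mu>)

text \<open>Continuous functions on a compact space are bounded and the measure is finite; later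
  integrability claims reduce to continuity.\<close>

lemma continuous_integrable:
  fixes f :: "'x \<Rightarrow> 'b::{banach, second_countable_topology}"
  assumes f: "continuous_on UNIV f"
  shows "integrable \<mu> f"
proof -
  obtain B where "\<And>x. norm (f x) \<le> B"
    using compact_imp_bounded[OF compact_continuous_image[OF f compact_X]] by (auto simp: bounded_iff)
  moreover have "f \<in> borel_measurable \<mu>"
    using borel_measurable_continuous_onI[OF f] by (simp cong: measurable_cong_sets add: sets_\<mu>)
  ultimately show ?thesis
    by (intro finite_measure.integrable_const_bound[OF finite_measure_\<mu>]) auto
qed

lemma integral_translate:
  fixes f :: "'x \<Rightarrow> 'b::{banach, second_countable_topology}"
  assumes f: "continuous_on UNIV f" and g: "g \<in> carrier G"
  shows "(LINT x|\<mu>. f (act g x)) = (LINT x|\<mu>. f x)"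
proof -
  have "act g \<in> borel_measurable \<mu>"
    using borel_measurable_continuous_onI[OF act_continuous[OF g]]
    by (simp cong: measurable_cong_sets add: sets_\<mu>)
  from integral_distr[OF this borel_measurable_continuous_onI[OF f]] show ?thesis
    by (simp add: \<mu>_invariant[OF g])
qed

lemma rep_coeff_continuous:
  assumes "j \<in> Ghat" "v \<in> V j"
  shows "continuous_map TG euclidean (\<lambda>g. ip u (\<rho> j g v))"
    and "continuous_map TG euclidean (\<lambda>g. ip u (\<rho> j (inv\<^bsub>G\<^esub> g) v))"
proof -
  show *: "continuous_map TG euclidean (\<lambda>g. ip u (\<rho> j g v))"
    by (rule rep_matrix_coeff_continuous[OF rep onb]) fact+
  have "continuous_map TG TG (\<lambda>g. inv\<^bsub>G\<^esub> g)" using cg by (simp add: compact_group_def)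
  from continuous_map_compose[OF this *] show "continuous_map TG euclidean (\<lambda>g. ip u (\<rho> j (inv\<^bsub>G\<^esub> g) v))"
    by (simp add: o_def)
qed

text \<open>The transformation law holds at every point, so along an orbit each
  \<open>Yh j i m\<close> is a finite combination of matrix coefficients of V_j. The base point is
  arbitrary.\<close>

lemma harmonic_continuous:
  assumes j: "j \<in> Ghat" and i: "i \<in> {1..mlt j}" and m: "m \<in> {1..dim (V j)}"
  shows "continuous_on UNIV (Yh j i m)"
proof -
  fix x
  have "continuous_map TG euclidean (\<lambda>g. \<Sum>m' = 1..dim (V j).
      ip (Y j m') (\<rho> j (inv\<^bsub>G\<^esub> g) (Y j m)) * Yh j i m' x)"
    using rep_coeff_continuous[OF j onb_in[OF onb[OF j] m]]
    by (intro continuous_map_sum continuous_map_mult) auto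
  then have "continuous_map TG euclidean (\<lambda>g. Yh j i m (act g x))"
  proof (rule continuous_map_eq)
    fix g assume "g \<in> topspace TG"
    then show "(\<Sum>m' = 1..dim (V j). ip (Y j m') (\<rho> j (inv\<^bsub>G\<^esub> g) (Y j m)) * Yh j i m' x) = Yh j i m (act g x)"
      using harmonic_equivariant[OF j i m, of "inv\<^bsub>G\<^esub> g" x] by (simp add: topspace_TG)
  qed
  then show ?thesis by (rule continuous_if_orbit_continuous)
qed

lemma harm_vec_ip_eq:
  assumes "j \<in> Ghat" "v \<in> V j"
  shows "ip (harm_vec j i x) v = (\<Sum>m = 1..dim (V j). Yh j i m x * ip (Y j m) v)"
  by (subst onb_parseval[OF onb assms(2)], fact, intro sum.cong refl) (simp add: ip_harm_vec assms)

lemma harm_vec_continuous: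
  assumes "j \<in> Ghat" "i \<in> {1..mlt j}" "v \<in> V j"
  shows "continuous_on UNIV (\<lambda>x. ip (harm_vec j i x) v)"
  unfolding harm_vec_ip_eq[OF assms(1,3)]
  by (intro continuous_intros harmonic_continuous assms) auto

text \<open>Equivariance alone writes the kernel along an orbit, applied to \<open>w\<close> and
  paired with \<open>u\<close>, as a finite sum of products of matrix coefficients of V_l and
  V_J.\<close>

lemma steer_continuous:
  assumes K: "K \<in> steer" and w: "w \<in> V l"
  shows "continuous_on UNIV (\<lambda>x. ip u (K x w))"
proof -
  fix x
  have "continuous_map TG euclidean (\<lambda>g. \<Sum>n = 1..dim (V l).
      ip (Y l n) (\<rho> l (inv\<^bsub>G\<^esub> g) w) * ip u (\<rho> J g (K x (Y l n))))"
    using rep_coeff_continuous(2)[OF l w] rep_coeff_continuous(1)[OF J steer_in[OF K onb_in[OF onb[OF l]]]]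
    by (intro continuous_map_sum continuous_map_mult) auto
  then have "continuous_map TG euclidean (\<lambda>g. ip u (K (act g x) w))"
  proof (rule continuous_map_eq)
    fix g assume "g \<in> topspace TG"
    then have g: "g \<in> carrier G" by (simp add: topspace_TG)
    have w': "\<rho> l (inv\<^bsub>G\<^esub> g) w \<in> V l" using rep_in[OF rep[OF l] _ w] g by simp
    have "K (act g x) w = \<rho> J g (K x (\<rho> l (inv\<^bsub>G\<^esub> g) w))"
      using steer_equivariant[OF K g w'] rep_inv_right[OF grp rep[OF l] g w] by simp
    also have "\<dots> = (\<Sum>n = 1..dim (V l). sc (ip (Y l n) (\<rho> l (inv\<^bsub>G\<^esub> g) w)) (\<rho> J g (K x (Y l n))))"
      by (rule onb_linear_expand[OF onb[OF l] linear_between_compose[OF steer_linear[OF K] rep_linear[OF rep[OF J] g]] w'])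
    finally show "(\<Sum>n = 1..dim (V l). ip (Y l n) (\<rho> l (inv\<^bsub>G\<^esub> g) w) * ip u (\<rho> J g (K x (Y l n)))) =
        ip u (K (act g x) w)"
      by (simp add: ip_sum_right ip_scale_right)
  qed
  then show ?thesis by (rule continuous_if_orbit_continuous)
qed

text \<open>The vector-valued integral of \<open>K x w\<close> with weight
  \<open>ip (harm_vec j i x) v\<close>, assembled from scalar integrals because V_J is only a
  carrier. \<open>harm_vec\<close> occupies the antilinear slot so that the result is linear in
  \<open>v\<close>.\<close>

definition kernel_transform :: "('x \<Rightarrow> 'v \<Rightarrow> 'v) \<Rightarrow> 'j \<Rightarrow> nat \<Rightarrow> 'v \<Rightarrow> 'v \<Rightarrow> 'v" where
  "kernel_transform K j i v w =
     (\<Sum>M = 1..dim (V J). sc (LINT x|\<mu>. ip (harm_vec j i x) v * ip (Y J M) (K x w)) (Y J M))"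

lemma kernel_transform_in: "kernel_transform K j i v w \<in> V J"
  unfolding kernel_transform_def
  using onb_in[OF onb[OF J]] by (intro subspace_sum subspace_scale subspace_V J)

lemma transform_integrable:
  assumes "K \<in> steer" "j \<in> Ghat" "i \<in> {1..mlt j}" "v \<in> V j" "w \<in> V l"
  shows "integrable \<mu> (\<lambda>x. ip (harm_vec j i x) v * ip u (K x w))"
  using assms by (intro continuous_integrable continuous_on_mult harm_vec_continuous steer_continuous)

text \<open>The weak form of the vector-valued integral: \<open>u\<close> is arbitrary, so the
  description is independent of the basis in the definition, and identities between transforms are
  verified through it.\<close>

lemma ip_kernel_transform:
  assumes K: "K \<in> steer" and j: "j \<in> Ghat" and i: "i \<in> {1..mlt j}" and v: "v \<in> V j" and w: "w \<in> V l"
  shows "ip u (kernel_transform K j i v w) = (LINT x|\<mu>. ip (harm_vec j i x) v * ip u (K x w))"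
proof -
  have "ip u (kernel_transform K j i v w) =
      (\<Sum>M = 1..dim (V J). (LINT x|\<mu>. ip u (Y J M) * (ip (harm_vec j i x) v * ip (Y J M) (K x w))))"
    by (simp add: kernel_transform_def ip_sum_right ip_scale_right mult.commute)
  also have "\<dots> = (LINT x|\<mu>. (\<Sum>M = 1..dim (V J). ip u (Y J M) * (ip (harm_vec j i x) v * ip (Y J M) (K x w))))"
    using transform_integrable[OF assms] by (subst Bochner_Integration.integral_sum) auto
  also have "\<dots> = (LINT x|\<mu>. ip (harm_vec j i x) v * ip u (K x w))"
  proof (rule Bochner_Integration.integral_cong[OF refl])
    fix x
    show "(\<Sum>M = 1..dim (V J). ip u (Y J M) * (ip (harm_vec j i x) v * ip (Y J M) (K x w))) =
        ip (harm_vec j i x) v * ip u (K x w)"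
      unfolding onb_parseval[OF onb[OF J] steer_in[OF K w, of x], of u] sum_distrib_left
      by (simp add: mult.left_commute)
  qed
  finally show ?thesis .
qed

text \<open>Equivariance comes from the invariance of \<open>\<mu>\<close>: once the integration
  variable is translated by \<open>g\<close>, the scalar weight is unchanged by unitarity and the
  kernel releases \<open>\<rho> J g\<close> by steerability.\<close>

lemma kernel_transform_equivariant_bilinear:
  assumes K: "K \<in> steer" and j: "j \<in> Ghat" and i: "i \<in> {1..mlt j}"
  shows "equivariant_bilinear j (kernel_transform K j i)"
proof -
  let ?B = "kernel_transform K j i"
  note ipB = ip_kernel_transform[OF K j i] and int = transform_integrable[OF K j i]
  have eqI: "x = y" if "x \<in> V J" "y \<in> V J" "\<And>u. u \<in> V J \<Longrightarrow> ip u x = ip u y" for x y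
    using onb_eqI[OF onb[OF J] that(1,2)] that(3) onb_in[OF onb[OF J]] by blast
  note add = subspace_add[OF subspace_V] and scale = subspace_scale[OF subspace_V]
  show ?thesis
    unfolding equivariant_bilinear_def linear_between_def
  proof (intro conjI ballI allI)
    fix v x y assume v: "v \<in> V j" and xy: "x \<in> V l" "y \<in> V l"
    show "?B v (x + y) = ?B v x + ?B v y"
      by (rule eqI) (use v xy linear_between_add[OF steer_linear[OF K]] int[OF v xy(1)] int[OF v xy(2)] in
        \<open>auto simp: kernel_transform_in add[OF J] ipB ip_add_right add[OF l] distrib_left\<close>)
  next
    fix v a x assume v: "v \<in> V j" and x: "x \<in> V l"
    show "?B v (sc a x) = sc a (?B v x)"
      by (rule eqI) (use v x linear_between_scale[OF steer_linear[OF K]] in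
        \<open>auto simp: kernel_transform_in scale[OF J] ipB ip_scale_right scale[OF l] mult.left_commute\<close>)
  next
    fix w x y assume w: "w \<in> V l" and xy: "x \<in> V j" "y \<in> V j"
    show "?B (x + y) w = ?B x w + ?B y w"
      by (rule eqI) (use w xy int[OF xy(1) w] int[OF xy(2) w] in
        \<open>auto simp: kernel_transform_in add[OF J] ipB ip_add_right add[OF j] distrib_right\<close>)
  next
    fix w a x assume w: "w \<in> V l" and x: "x \<in> V j"
    show "?B (sc a x) w = sc a (?B x w)"
      by (rule eqI) (use w x in
        \<open>auto simp: kernel_transform_in scale[OF J] ipB ip_scale_right scale[OF j] mult.assoc\<close>)
  next
    fix g v w assume g: "g \<in> carrier G" and v: "v \<in> V j" and w: "w \<in> V l"
    have gv: "\<rho> j g v \<in> V j" and gw: "\<rho> l g w \<in> V l"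
      using rep_in[OF rep g] j l v w by auto
    show "?B (\<rho> j g v) (\<rho> l g w) = \<rho> J g (?B v w)"
    proof (rule eqI)
      fix u assume u: "u \<in> V J"
      let ?u = "\<rho> J (inv\<^bsub>G\<^esub> g) u"
      have u': "?u \<in> V J" using rep_in[OF rep[OF J] _ u] g by simp
      have gu: "\<rho> J g ?u = u" by (rule rep_inv_right[OF grp rep[OF J] g u])
      have ipu: "ip u (\<rho> J g z) = ip ?u z" if "z \<in> V J" for z
        using rep_ip[OF rep[OF J] g u' that] by (simp add: gu)
      have "ip u (?B (\<rho> j g v) (\<rho> l g w)) =
          (LINT x|\<mu>. ip (harm_vec j i (act g x)) (\<rho> j g v) * ip u (K (act g x) (\<rho> l g w)))"
        unfolding ipB[OF gv gw]
        by (rule integral_translate[symmetric, OF _ g])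
          (intro continuous_on_mult harm_vec_continuous steer_continuous K j i gv gw)
      also have "\<dots> = (LINT x|\<mu>. ip (harm_vec j i x) v * ip ?u (K x w))"
        by (simp add: harm_vec_equivariant[OF j i g] rep_ip[OF rep[OF j] g harm_vec_in[OF j] v]
            steer_equivariant[OF K g w] ipu[OF steer_in[OF K w]])
      also have "\<dots> = ip u (\<rho> J g (?B v w))"
        by (simp add: ipB[OF v w] ipu[OF kernel_transform_in])
      finally show "ip u (?B (\<rho> j g v) (\<rho> l g w)) = ip u (\<rho> J g (?B v w))" .
    qed (use kernel_transform_in rep_in[OF rep[OF J] g] in auto)
  qed (rule kernel_transform_in)+
qed

lemma harmonic_orthonormal:
  assumes "j \<in> Ghat" "i \<in> {1..mlt j}" "m \<in> {1..dim (V j)}"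
    and "j' \<in> Ghat" "i' \<in> {1..mlt j'}" "m' \<in> {1..dim (V j')}"
  shows "(LINT x|\<mu>. kcnj (Yh j i m x) * Yh j' i' m' x) = (if j = j' \<and> i = i' \<and> m = m' then 1 else 0)"
proof -
  let ?I = "{(j, i, m). j \<in> Ghat \<and> i \<in> {1..mlt j} \<and> m \<in> {1..dim (V j)}}"
  have "\<forall>p\<in>?I. \<forall>q\<in>?I. L2_ip \<mu> ((\<lambda>(j, i, m). Yh j i m) p) ((\<lambda>(j, i, m). Yh j i m) q) = (if p = q then 1 else 0)"
    using harm unfolding harmonic_basis_def hilbert_basis_L2_def by blast
  moreover have "(j, i, m) \<in> ?I" "(j', i', m') \<in> ?I" using assms by auto
  ultimately show ?thesis by (auto simp: L2_ip_def)
qed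

text \<open>In coordinates of \<open>harm_vec\<close> the integral becomes one of two harmonic
  functions, and orthonormality keeps only equal labels. This inverts the passage from a bilinear
  map to its kernel.\<close>

lemma integral_harmonic_kernel:
  assumes j: "j \<in> Ghat" and i: "i \<in> {1..mlt j}" and m: "m \<in> {1..dim (V j)}"
    and j': "j' \<in> Ghat" and i': "i' \<in> {1..mlt j'}" and b: "equivariant_bilinear j' b" and w: "w \<in> V l"
  shows "(LINT x|\<mu>. Yh j i m x * ip u (bilinear_kernel b j' i' x w)) =
    (if j' = j \<and> i' = i then ip u (b (Y j m) w) else 0)"
proof -
  have coord: "ip (Y j' m') (harm_vec j' i' x) = kcnj (Yh j' i' m' x)" if "m' \<in> {1..dim (V j')}" for m' x
    using ip_harm_vec[OF j' that, of i' x] by (metis ip_commute)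
  have expand: "Yh j i m x * ip u (bilinear_kernel b j' i' x w) =
      (\<Sum>m' = 1..dim (V j'). ip u (b (Y j' m') w) * (kcnj (Yh j' i' m' x) * Yh j i m x))" for x
    using w onb_linear_expand[OF onb[OF j'] eqb_left[OF b w] harm_vec_in[OF j'], of i' x]
    by (simp add: bilinear_kernel_def ip_sum_right ip_scale_right coord sum_distrib_left mult_ac)
  have int: "integrable \<mu> (\<lambda>x. kcnj (Yh j' i' m' x) * Yh j i m x)" if "m' \<in> {1..dim (V j')}" for m'
    by (intro continuous_integrable continuous_on_mult harmonic_continuous j i m
        continuous_on_compose2[OF linear_continuous_on[OF bounded_linear_kcnj] harmonic_continuous[OF j' i' that]])
      auto
  have "(LINT x|\<mu>. Yh j i m x * ip u (bilinear_kernel b j' i' x w)) =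
      (\<Sum>m' = 1..dim (V j'). ip u (b (Y j' m') w) * (LINT x|\<mu>. kcnj (Yh j' i' m' x) * Yh j i m x))"
    unfolding expand using int by (subst Bochner_Integration.integral_sum) auto
  also have "\<dots> = (\<Sum>m' = 1..dim (V j'). if m' = m then (if j' = j \<and> i' = i then ip u (b (Y j m) w) else 0) else 0)"
    using harmonic_orthonormal[OF j' i' _ j i m] by (intro sum.cong) auto
  also have "\<dots> = (if j' = j \<and> i' = i then ip u (b (Y j m) w) else 0)"
    using m by auto
  finally show ?thesis .
qed

lemma integral_harmonic_cg_kernel_sum:
  assumes C: "\<And>p. p \<in> blocks \<Longrightarrow> C p \<in> endo"
    and j: "j \<in> Ghat" and i: "i \<in> {1..mlt j}" and m: "m \<in> {1..dim (V j)}" and w: "w \<in> V l"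
  shows "(LINT x|\<mu>. Yh j i m x * ip u ((\<Sum>(j, i, s)\<in>blocks. cg_kernel (C (j, i, s)) j i s) x w)) =
    ip u (\<Sum>s = 1..cgm J j l. C (j, i, s) (cg_proj j s (Y j m) w))"
proof -
  let ?k = "\<lambda>(j, i, s). cg_kernel (C (j, i, s)) j i s"
  let ?t = "\<lambda>(j', i', s). if j' = j \<and> i' = i then ip u (C (j, i, s) (cg_proj j s (Y j m) w)) else 0"
  have idx: "j' \<in> Ghat" "i' \<in> {1..mlt j'}" "s \<in> {1..cgm J j' l}" if "(j', i', s) \<in> blocks" for j' i' s
    using that by (auto simp: block_index_def)
  have b: "equivariant_bilinear j' (\<lambda>v w. C (j', i', s) (cg_proj j' s v w))"
    if p: "(j', i', s) \<in> blocks" for j' i' s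
    by (rule endo_comp_equivariant_bilinear[OF C[OF p] cg_proj_equivariant_bilinear[OF idx(1,3)[OF p]]])
  have st: "?k p \<in> steer" if "p \<in> blocks" for p
    using bilinear_kernel_steer[OF idx(1,2) b] that by (cases p) simp
  have int: "integrable \<mu> (\<lambda>x. Yh j i m x * ip u (?k p x w))" if "p \<in> blocks" for p
    by (intro continuous_integrable continuous_on_mult harmonic_continuous j i m steer_continuous st that w)
  have "(LINT x|\<mu>. Yh j i m x * ip u ((\<Sum>p\<in>blocks. ?k p) x w)) =
      (LINT x|\<mu>. (\<Sum>p\<in>blocks. Yh j i m x * ip u (?k p x w)))"
    by (simp add: sum_fun_apply ip_sum_right sum_distrib_left)
  also have "\<dots> = (\<Sum>p\<in>blocks. (LINT x|\<mu>. Yh j i m x * ip u (?k p x w)))"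
    by (rule Bochner_Integration.integral_sum[OF int])
  also have "\<dots> = (\<Sum>p\<in>blocks. ?t p)"
  proof (rule sum.cong[OF refl])
    fix p assume p: "p \<in> blocks"
    obtain j' i' s where p': "p = (j', i', s)" by (cases p)
    show "(LINT x|\<mu>. Yh j i m x * ip u (?k p x w)) = ?t p"
      using integral_harmonic_kernel[OF j i m idx(1,2)[OF p[unfolded p']] b[OF p[unfolded p']] w, of u]
      by (simp add: p')
  qed
  \<comment> \<open>Only the triples over the chosen \<open>j\<close> and \<open>i\<close> survive.
    Integration does not separate the copies \<open>s\<close>; that is left to
    \<open>cg_unique\<close>.\<close>
  also have "\<dots> = (\<Sum>p\<in>(\<lambda>s. (j, i, s)) ` {1..cgm J j l}. ?t p)"
    using finite_blocks j i by (intro sum.mono_neutral_right) (auto simp: block_index_def)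
  also have "\<dots> = (\<Sum>s = 1..cgm J j l. ip u (C (j, i, s) (cg_proj j s (Y j m) w)))"
    by (subst sum.reindex) (auto simp: inj_on_def)
  finally show ?thesis by (simp add: ip_sum_right)
qed

text \<open>By completeness of the harmonic basis the matrix elements vanish almost everywhere, hence at
  some point, and transitivity transports the zero to all of the homogeneous space.\<close>

lemma steer_zeroI:
  assumes D: "D \<in> steer"
    and orth: "\<And>j i m M n. j \<in> Ghat \<Longrightarrow> i \<in> {1..mlt j} \<Longrightarrow> m \<in> {1..dim (V j)} \<Longrightarrow>
      M \<in> {1..dim (V J)} \<Longrightarrow> n \<in> {1..dim (V l)} \<Longrightarrow> (LINT x|\<mu>. Yh j i m x * ip (Y J M) (D x (Y l n))) = 0"
  shows "D = 0"
proof -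
  let ?P = "{1..dim (V J)} \<times> {1..dim (V l)}"
  have cont: "continuous_on UNIV (\<lambda>x. ip u (D x (Y l n)))" if "n \<in> {1..dim (V l)}" for u n
    by (rule steer_continuous[OF D onb_in[OF onb[OF l] that]])
  \<comment> \<open>\<open>L2_ip\<close> conjugates its first argument; with the matrix element
    conjugated too, the inner product is the conjugate of an integral that vanishes by
    assumption.\<close>
  have "AE x in \<mu>. kcnj (ip (Y J M) (D x (Y l n))) = 0"
    if M: "M \<in> {1..dim (V J)}" and n: "n \<in> {1..dim (V l)}" for M n
  proof (rule hilbert_basis_L2_complete)
    show "hilbert_basis_L2 \<mu> {(j, i, m). j \<in> Ghat \<and> i \<in> {1..mlt j} \<and> m \<in> {1..dim (V j)}} (\<lambda>(j, i, m). Yh j i m)"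
      using harm by (simp add: harmonic_basis_def)
    have c: "continuous_on UNIV (\<lambda>x. kcnj (ip (Y J M) (D x (Y l n))))"
      by (rule continuous_on_compose2[OF linear_continuous_on[OF bounded_linear_kcnj] cont[OF n]]) auto
    show "square_integrable \<mu> (\<lambda>x. kcnj (ip (Y J M) (D x (Y l n))))"
      using continuous_integrable[OF c] continuous_integrable[OF continuous_on_power[OF continuous_on_norm[OF cont[OF n]]]]
      by (auto simp: square_integrable_def)
    fix p assume "p \<in> {(j, i, m). j \<in> Ghat \<and> i \<in> {1..mlt j} \<and> m \<in> {1..dim (V j)}}"
    then obtain j i m where p: "p = (j, i, m)" and j: "j \<in> Ghat" and i: "i \<in> {1..mlt j}" and m: "m \<in> {1..dim (V j)}"
      by auto
    have "integrable \<mu> (\<lambda>x. Yh j i m x * ip (Y J M) (D x (Y l n)))"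
      by (intro continuous_integrable continuous_on_mult harmonic_continuous j i m cont[OF n])
    from integral_bounded_linear[OF bounded_linear_kcnj this]
    show "L2_ip \<mu> ((\<lambda>(j, i, m). Yh j i m) p) (\<lambda>x. kcnj (ip (Y J M) (D x (Y l n)))) = 0"
      by (simp add: L2_ip_def p kcnj_mult orth[OF j i m M n])
  qed
  then have "AE x in \<mu>. \<forall>p\<in>?P. ip (Y J (fst p)) (D x (Y l (snd p))) = 0"
    by (intro AE_finite_allI) auto
  \<comment> \<open>Total mass 1 excludes the trivial filter, so the finitely many matrix elements
    have a common zero \<open>x0\<close>.\<close>
  moreover have "ae_filter \<mu> \<noteq> bot"
    by (simp add: ae_filter_eq_bot_iff space_\<mu> emeasure_\<mu>)
  ultimately obtain x0 where x0: "\<forall>p\<in>?P. ip (Y J (fst p)) (D x0 (Y l (snd p))) = 0"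
    using eventually_happens' by blast
  have "D x0 (Y l n) = 0" if n: "n \<in> {1..dim (V l)}" for n
  proof (rule onb_eqI[OF onb[OF J] steer_in[OF D onb_in[OF onb[OF l] n]] zero_in_V[OF J]])
    show "ip (Y J M) (D x0 (Y l n)) = ip (Y J M) 0" if "M \<in> {1..dim (V J)}" for M
      using x0 that n by fastforce
  qed
  then have D0: "D x0 w = 0" if "w \<in> V l" for w
    using onb_linear_expand[OF onb[OF l] steer_linear[OF D] that, of x0] by simp
  have "D x w = 0" for x w
  proof (cases "w \<in> V l")
    case True
    obtain g where g: "g \<in> carrier G" "act g x0 = x" using act.unique_orbit[of x0 x] by auto
    have w': "\<rho> l (inv\<^bsub>G\<^esub> g) w \<in> V l" using rep_in[OF rep[OF l] _ True] g by simp
    show ?thesis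
      using steer_equivariant[OF D g(1) w', of x0] rep_inv_right[OF grp rep[OF l] g(1) True]
        D0[OF w'] rep_zero[OF J g(1)] g(2) by simp
  qed (rule steer_outside[OF D])
  then show ?thesis by (simp add: fun_eq_iff)
qed

text \<open>If V_j \<otimes> V_l contains no copy of V_J, the decomposition of the transform is an
  empty sum and the transform is 0. Hence the finite set \<open>blocks\<close> accounts for all
  harmonic coefficients of \<open>K\<close>.\<close>

lemma steer_expand:
  assumes K: "K \<in> steer"
  shows "\<exists>C. (\<forall>p\<in>blocks. C p \<in> endo) \<and> K = (\<Sum>(j, i, s)\<in>blocks. cg_kernel (C (j, i, s)) j i s)"
proof -
  interpret f: vector_space "fun_scale (fun_scale sc) :: 'k \<Rightarrow> ('x \<Rightarrow> 'v \<Rightarrow> 'v) \<Rightarrow> _"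
    by (rule vector_space_kernels)
  let ?I = "{(j, i). j \<in> Ghat \<and> i \<in> {1..mlt j}}"
  have "\<forall>q\<in>?I. \<exists>C. (\<forall>s\<in>{1..cgm J (fst q) l}. C s \<in> endo) \<and> (\<forall>v\<in>V (fst q). \<forall>w\<in>V l.
      kernel_transform K (fst q) (snd q) v w = (\<Sum>s = 1..cgm J (fst q) l. C s (cg_proj (fst q) s v w)))"
  proof
    fix q assume "q \<in> ?I"
    then have j: "fst q \<in> Ghat" and i: "snd q \<in> {1..mlt (fst q)}" by auto
    from cg_decompose[OF j kernel_transform_equivariant_bilinear[OF K j i]]
    show "\<exists>C. (\<forall>s\<in>{1..cgm J (fst q) l}. C s \<in> endo) \<and> (\<forall>v\<in>V (fst q). \<forall>w\<in>V l.
      kernel_transform K (fst q) (snd q) v w = (\<Sum>s = 1..cgm J (fst q) l. C s (cg_proj (fst q) s v w)))"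
      .
  qed
  from bchoice[OF this] obtain B where
    B: "\<forall>q\<in>?I. (\<forall>s\<in>{1..cgm J (fst q) l}. B q s \<in> endo) \<and> (\<forall>v\<in>V (fst q). \<forall>w\<in>V l.
      kernel_transform K (fst q) (snd q) v w = (\<Sum>s = 1..cgm J (fst q) l. B q s (cg_proj (fst q) s v w)))"
    by blast
  define C where "C = (\<lambda>(j, i, s). B (j, i) s)"
  have C: "C p \<in> endo" if "p \<in> blocks" for p
  proof -
    obtain j i s where p: "p = (j, i, s)" by (cases p)
    have "(j, i) \<in> ?I" "s \<in> {1..cgm J j l}" using that by (auto simp: p block_index_def)
    then show ?thesis using bspec[OF B, of "(j, i)"] by (simp add: C_def p)
  qed
  have trans: "kernel_transform K j i v w = (\<Sum>s = 1..cgm J j l. C (j, i, s) (cg_proj j s v w))"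
    if "j \<in> Ghat" "i \<in> {1..mlt j}" "v \<in> V j" "w \<in> V l" for j i v w
    using bspec[OF B, of "(j, i)"] that by (simp add: C_def)
  define K' where "K' = (\<Sum>(j, i, s)\<in>blocks. cg_kernel (C (j, i, s)) j i s)"
  have K': "K' \<in> steer" unfolding K'_def by (rule cg_kernel_sum_steer[OF C])
  have "K - K' = 0"
  proof (rule steer_zeroI)
    show "K - K' \<in> steer" by (rule f.subspace_diff[OF steer_subspace K K'])
    fix j i m M n
    assume j: "j \<in> Ghat" and i: "i \<in> {1..mlt j}" and m: "m \<in> {1..dim (V j)}"
      and M: "M \<in> {1..dim (V J)}" and n: "n \<in> {1..dim (V l)}"
    note Yn = onb_in[OF onb[OF l] n] and Ym = onb_in[OF onb[OF j] m]
    have int: "integrable \<mu> (\<lambda>x. Yh j i m x * ip (Y J M) (L x (Y l n)))" if "L \<in> steer" for L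
      by (intro continuous_integrable continuous_on_mult harmonic_continuous j i m steer_continuous[OF that Yn])
    \<comment> \<open>At the vector \<open>Y j m\<close> the weight in the transform is exactly
      \<open>Yh j i m x\<close>.\<close>
    have "(LINT x|\<mu>. Yh j i m x * ip (Y J M) (K x (Y l n))) = ip (Y J M) (kernel_transform K j i (Y j m) (Y l n))"
      by (simp add: ip_kernel_transform[OF K j i Ym Yn] ip_harm_vec[OF j m])
    also have "\<dots> = (LINT x|\<mu>. Yh j i m x * ip (Y J M) (K' x (Y l n)))"
      unfolding K'_def
      by (simp add: integral_harmonic_cg_kernel_sum[where C = C, OF C j i m Yn] trans[OF j i Ym Yn])
    finally show "(LINT x|\<mu>. Yh j i m x * ip (Y J M) ((K - K') x (Y l n))) = 0"
      using int[OF K] int[OF K'] by (simp add: ip_diff_right right_diff_distrib)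
  qed
  then have "K = K'" by simp
  then show ?thesis using C unfolding K'_def by blast
qed

text \<open>Integrating against the harmonic functions isolates one pair (j, i), after which
  \<open>cg_unique\<close> separates the copies.\<close>

lemma cg_kernel_sum_eq_0:
  assumes C: "\<And>p. p \<in> blocks \<Longrightarrow> C p \<in> endo"
    and 0: "(\<Sum>(j, i, s)\<in>blocks. cg_kernel (C (j, i, s)) j i s) = 0" and p: "p \<in> blocks"
  shows "C p = 0"
proof -
  obtain j i s where p_eq: "p = (j, i, s)" and j: "j \<in> Ghat" and i: "i \<in> {1..mlt j}" and s: "s \<in> {1..cgm J j l}"
    using p by (auto simp: block_index_def)
  have C': "C (j, i, s) \<in> endo" if "s \<in> {1..cgm J j l}" for s
    using C[of "(j, i, s)"] that j i by (simp add: block_index_def)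
  have eb: "equivariant_bilinear j (\<lambda>v w. C (j, i, s) (cg_proj j s v w))" if "s \<in> {1..cgm J j l}" for s
    using endo_comp_equivariant_bilinear C' cg_proj_equivariant_bilinear[OF j] that by blast
  have "C (j, i, s) = 0"
  proof (rule cg_unique[OF j C' _ s])
    fix v w assume v: "v \<in> V j" and w: "w \<in> V l"
    let ?F = "\<lambda>v. \<Sum>s = 1..cgm J j l. C (j, i, s) (cg_proj j s v w)"
    have lin: "linear_between sc sc (V j) (V J) ?F"
      by (rule linear_between_sum_fun[OF subspace_V[OF J] eqb_left[OF eb w]])
    have "?F (Y j m) = 0" if m: "m \<in> {1..dim (V j)}" for m
    proof -
      have "ip u (?F (Y j m)) = 0" for u
        using integral_harmonic_cg_kernel_sum[where C = C, OF C j i m w, where u = u] by (simp add: 0)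
      from this[of "?F (Y j m)"] show ?thesis by (simp only: ip_self_eq_0_iff)
    qed
    then show "?F v = 0" using onb_linear_expand[OF onb[OF j] lin v] by simp
  qed
  then show ?thesis by (simp add: p_eq)
qed

end

section \<open>Coordinates of steerable kernels\<close>

context steerable_setting
begin

lemma blocks_Sigma:
  "blocks = (SIGMA j:{j \<in> Ghat. cgm J j l \<noteq> 0}. {1..mlt j} \<times> {1..cgm J j l})"
  by (auto simp: block_index_def)

abbreviation "quads E \<equiv> kernel_index Ghat mlt cgm E l J"

lemma quads_image: "quads E = (\<lambda>((j, i, s), r). (j, i, s, r)) ` (blocks \<times> {1..E})"
  by (force simp: kernel_index_def block_index_def image_iff)

lemma inj_quads: "inj_on (\<lambda>((j, i, s), r). (j, i, s, r)) A"
  by (auto simp: inj_on_def)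

lemma finite_quads: "finite (quads E)"
  unfolding quads_image using finite_blocks by simp

lemma card_quads: "card (quads E) = num_params Ghat mlt cgm E l J"
proof -
  have "card blocks = (\<Sum>j | j \<in> Ghat \<and> cgm J j l \<noteq> 0. cgm J j l * mlt j)"
    unfolding blocks_Sigma using finite_cg_support by (subst card_SigmaI) (auto simp: mult.commute)
  then show ?thesis
    unfolding quads_image card_image[OF inj_quads] card_cartesian_product num_params_def by simp
qed

lemma sum_quads: "(\<Sum>p\<in>quads E. f p) = (\<Sum>(j, i, s)\<in>blocks. \<Sum>r = 1..E. f (j, i, s, r))"
  unfolding quads_image sum.reindex[OF inj_quads]
  by (simp add: case_prod_unfold o_def sum.cartesian_product)

end

section \<open>Scalar coordinates from a basis of the endomorphisms\<close>

locale steerable_setting_basis = steerable_setting sc ip G TG act \<mu> Ghat V \<rho> Y mlt Yh cgm CG l J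
  for sc :: "'k::real_or_complex \<Rightarrow> 'v::ab_group_add \<Rightarrow> 'v" and ip :: "'v \<Rightarrow> 'v \<Rightarrow> 'k"
    and G :: "('g, 'z) monoid_scheme" and TG :: "'g topology"
    and act :: "'g \<Rightarrow> 'x::t2_space \<Rightarrow> 'x" and \<mu> :: "'x measure"
    and Ghat :: "'j set" and V :: "'j \<Rightarrow> 'v set" and \<rho> :: "'j \<Rightarrow> 'g \<Rightarrow> 'v \<Rightarrow> 'v"
    and Y :: "'j \<Rightarrow> nat \<Rightarrow> 'v"
    and mlt :: "'j \<Rightarrow> nat" and Yh :: "'j \<Rightarrow> nat \<Rightarrow> nat \<Rightarrow> 'x \<Rightarrow> 'k"
    and cgm :: "'j \<Rightarrow> 'j \<Rightarrow> 'j \<Rightarrow> nat"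
    and CG :: "'j \<Rightarrow> 'j \<Rightarrow> (('v \<Rightarrow> 'v \<Rightarrow> 'k) \<Rightarrow> 'k) \<Rightarrow> 'j \<times> nat \<Rightarrow> 'v"
    and l J :: 'j +
  fixes E :: nat and c :: "nat \<Rightarrow> 'v \<Rightarrow> 'v"
  assumes c_basis: "basis_family (fun_scale sc) {1..E} c endo"
begin

interpretation h: vector_space "fun_scale sc :: 'k \<Rightarrow> ('v \<Rightarrow> 'v) \<Rightarrow> _"
  by (rule vector_space_fun_scale[OF vector_space_axioms])

interpretation k: vector_space "fun_scale (fun_scale sc) :: 'k \<Rightarrow> ('x \<Rightarrow> 'v \<Rightarrow> 'v) \<Rightarrow> _"
  by (rule vector_space_kernels)

lemmas c_basisD = basis_familyD[OF h.vector_space_axioms finite_atLeastAtMost c_basis]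

lemma c_endo: "r \<in> {1..E} \<Longrightarrow> c r \<in> endo"
  by (rule c_basisD(2))

abbreviation "block_sum \<equiv> direct_sum blocks (\<lambda>_. endo)"

text \<open>\<open>Omega\<close> with coordinates labelled by quadruples instead of numbers, which
  keeps the linear algebra free of the choice of \<open>\<nu>\<close>.\<close>

definition comb :: "('j \<times> nat \<times> nat \<times> nat \<Rightarrow> 'k) \<Rightarrow> 'j \<times> nat \<times> nat \<Rightarrow> 'v \<Rightarrow> 'v" where
  "comb \<alpha> = (\<lambda>(j, i, s). if (j, i, s) \<in> blocks then \<Sum>r = 1..E. fun_scale sc (\<alpha> (j, i, s, r)) (c r) else 0)"

lemma comb_in: "comb \<alpha> \<in> block_sum"
proof -
  have "{p. comb \<alpha> p \<noteq> 0} \<subseteq> blocks" by (auto simp: comb_def split: if_splits)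
  then have "finite {p. comb \<alpha> p \<noteq> 0}" using finite_blocks by (rule finite_subset)
  then show ?thesis
    using c_basisD(1) c_endo
    by (auto simp: direct_sum_def comb_def intro!: h.subspace_sum h.subspace_scale)
qed

lemma comb_surj:
  assumes C: "\<And>p. p \<in> blocks \<Longrightarrow> C p \<in> endo"
  shows "\<exists>\<alpha>. \<forall>p\<in>blocks. C p = comb \<alpha> p"
proof -
  have "\<forall>p\<in>blocks. \<exists>a. C p = (\<Sum>r = 1..E. fun_scale sc (a r) (c r))"
    using c_basisD(3)[OF C] by blast
  from bchoice[OF this] obtain A where
    A: "\<forall>p\<in>blocks. C p = (\<Sum>r = 1..E. fun_scale sc (A p r) (c r))" by blast
  have "C p = comb (\<lambda>(j, i, s, r). A (j, i, s) r) p" if "p \<in> blocks" for p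
    using bspec[OF A that] that by (cases p) (simp add: comb_def)
  then show ?thesis by blast
qed

lemma comb_eq_0:
  assumes "\<And>p. p \<in> blocks \<Longrightarrow> comb \<alpha> p = 0" and "q \<in> quads E"
  shows "\<alpha> q = 0"
proof -
  obtain j i s r where q: "q = (j, i, s, r)" and b: "(j, i, s) \<in> blocks" and r: "r \<in> {1..E}"
    using assms(2) by (auto simp: kernel_index_def block_index_def)
  have "(\<Sum>r = 1..E. fun_scale sc (\<alpha> (j, i, s, r)) (c r)) = 0"
    using assms(1)[OF b] b by (simp add: comb_def)
  from c_basisD(4)[OF this r] show ?thesis by (simp add: q)
qed

text \<open>These are the images under \<open>Omega\<close> of the standard coordinate
  vectors.\<close>

definition unit_block :: "'j \<times> nat \<times> nat \<times> nat \<Rightarrow> 'j \<times> nat \<times> nat \<Rightarrow> 'v \<Rightarrow> 'v" where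
  "unit_block = (\<lambda>(j, i, s, r). direct_sum_single (j, i, s) (c r))"

lemma comb_sum: "(\<Sum>q\<in>quads E. fun_scale (fun_scale sc) (\<alpha> q) (unit_block q)) = comb \<alpha>"
proof
  fix p
  have "(\<Sum>q\<in>quads E. fun_scale (fun_scale sc) (\<alpha> q) (unit_block q)) p =
      (\<Sum>p'\<in>blocks. if p = p' then comb \<alpha> p else 0)"
    unfolding sum_quads sum_fun_apply[where x = p]
    by (intro sum.cong refl)
      (auto simp: sum_fun_apply unit_block_def direct_sum_single_def comb_def fun_scale_def fun_eq_iff)
  also have "\<dots> = comb \<alpha> p" using finite_blocks by (auto simp: comb_def split: prod.splits)
  finally show "(\<Sum>q\<in>quads E. fun_scale (fun_scale sc) (\<alpha> q) (unit_block q)) p = comb \<alpha> p" .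
qed

abbreviation "bker \<equiv> \<lambda>(j, i, s, r). basis_kernel sc ip V Y Yh CG l J c j i s r"

lemma bker_eq: "(j, i, s, r) \<in> quads E \<Longrightarrow> bker (j, i, s, r) = cg_kernel (c r) j i s"
  by (auto simp: kernel_index_def intro!: basis_kernel_eq c_endo)

lemma bker_steer: "q \<in> quads E \<Longrightarrow> bker q \<in> steer"
proof -
  assume q: "q \<in> quads E"
  obtain j i s r where q': "q = (j, i, s, r)" by (cases q)
  show ?thesis
    unfolding q' bker_eq[OF q[unfolded q']]
    using q by (intro cg_kernel_steer c_endo) (auto simp: q' kernel_index_def)
qed

text \<open>A kernel depends linearly on its endomorphism, so summing over \<open>r\<close> inside a
  block amounts to forming the endomorphism \<open>comb \<alpha>\<close> first.\<close>

lemma bker_sum: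
  "(\<Sum>q\<in>quads E. fun_scale (fun_scale sc) (\<alpha> q) (bker q)) =
    (\<Sum>(j, i, s)\<in>blocks. cg_kernel (comb \<alpha> (j, i, s)) j i s)"
  unfolding sum_quads
proof (rule sum.cong[OF refl])
  fix p assume p: "p \<in> blocks"
  obtain j i s where p': "p = (j, i, s)" by (cases p)
  have "(\<Sum>r = 1..E. fun_scale (fun_scale sc) (\<alpha> (j, i, s, r)) (bker (j, i, s, r))) =
      (\<Sum>r = 1..E. fun_scale (fun_scale sc) (\<alpha> (j, i, s, r)) (cg_kernel (c r) j i s))"
    using p by (intro sum.cong refl arg_cong2[where f = "fun_scale (fun_scale sc)"] bker_eq)
      (auto simp: p' kernel_index_def block_index_def)
  also have "\<dots> = cg_kernel (comb \<alpha> (j, i, s)) j i s"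
    using p by (auto simp: p' fun_eq_iff sum_fun_apply fun_scale_def bilinear_kernel_def comb_def)
  finally show "(case p of (j, i, s) \<Rightarrow> \<Sum>r = 1..E. fun_scale (fun_scale sc) (\<alpha> (j, i, s, r)) (bker (j, i, s, r))) =
      (case p of (j, i, s) \<Rightarrow> cg_kernel (comb \<alpha> (j, i, s)) j i s)"
    by (simp add: p')
qed

lemma block_sum_basis: "basis_family (fun_scale (fun_scale sc)) (quads E) unit_block block_sum"
proof (rule basis_familyI)
  show "vector_space (fun_scale (fun_scale sc) :: 'k \<Rightarrow> ('j \<times> nat \<times> nat \<Rightarrow> 'v \<Rightarrow> 'v) \<Rightarrow> _)"
    by (rule vector_space_kernels)
  show "finite (quads E)" by (rule finite_quads)
  show "module.subspace (fun_scale (fun_scale sc)) block_sum"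
    by (rule direct_sum_subspace[OF h.vector_space_axioms c_basisD(1)])
  show "unit_block q \<in> block_sum" if "q \<in> quads E" for q
    using that h.subspace_0[OF c_basisD(1)] unfolding unit_block_def
    by (cases q) (auto simp: kernel_index_def block_index_def intro!: direct_sum_single_in c_endo)
  show "\<exists>\<alpha>. u = (\<Sum>q\<in>quads E. fun_scale (fun_scale sc) (\<alpha> q) (unit_block q))" if u: "u \<in> block_sum" for u
  proof -
    obtain \<alpha> where \<alpha>: "\<And>p. p \<in> blocks \<Longrightarrow> u p = comb \<alpha> p"
      using comb_surj[of u] u by (auto simp: direct_sum_def)
    have "u p = comb \<alpha> p" for p
    proof (cases "p \<in> blocks")
      case False
      then show ?thesis using u comb_in[of \<alpha>] by (cases p) (simp add: direct_sum_def)
    qed (rule \<alpha>)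
    then show ?thesis unfolding comb_sum by (intro exI[of _ \<alpha>]) (rule ext)
  qed
  show "\<alpha> q = 0" if "(\<Sum>q\<in>quads E. fun_scale (fun_scale sc) (\<alpha> q) (unit_block q)) = 0" "q \<in> quads E" for \<alpha> q
    using that comb_eq_0 by (simp add: comb_sum)
qed

text \<open>Existence and uniqueness of coefficients in \<open>endo\<close> are refined to scalars
  by expanding each coefficient in the basis \<open>c\<close>.\<close>

lemma steer_basis: "basis_family (fun_scale (fun_scale sc)) (quads E) bker steer"
proof (rule basis_familyI[OF k.vector_space_axioms finite_quads steer_subspace bker_steer])
  show "\<exists>\<alpha>. K = (\<Sum>q\<in>quads E. fun_scale (fun_scale sc) (\<alpha> q) (bker q))" if K: "K \<in> steer" for K
  proof -
    obtain C where C: "\<And>p. p \<in> blocks \<Longrightarrow> C p \<in> endo"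
      and KC: "K = (\<Sum>(j, i, s)\<in>blocks. cg_kernel (C (j, i, s)) j i s)"
      using steer_expand[OF K] by blast
    obtain \<alpha> where \<alpha>: "\<And>p. p \<in> blocks \<Longrightarrow> C p = comb \<alpha> p"
      using comb_surj[where C = C, OF C] by blast
    have "K = (\<Sum>(j, i, s)\<in>blocks. cg_kernel (comb \<alpha> (j, i, s)) j i s)"
      unfolding KC by (intro sum.cong refl) (auto simp: \<alpha>)
    then show ?thesis by (intro exI[of _ \<alpha>]) (simp only: bker_sum)
  qed
  show "\<alpha> q = 0" if 0: "(\<Sum>q\<in>quads E. fun_scale (fun_scale sc) (\<alpha> q) (bker q)) = 0" and q: "q \<in> quads E" for \<alpha> q
  proof (rule comb_eq_0[OF _ q])
    show "comb \<alpha> p = 0" if "p \<in> blocks" for p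
    proof (rule cg_kernel_sum_eq_0[OF _ _ that])
      show "comb \<alpha> p \<in> endo" if "p \<in> blocks" for p
        using comb_in[of \<alpha>] that by (simp add: direct_sum_def)
    qed (use 0 in \<open>simp only: bker_sum\<close>)
  qed
qed

lemma Omega_eq:
  "Omega sc Ghat mlt cgm E l J c \<nu> = (\<lambda>a. \<Sum>q\<in>quads E. fun_scale (fun_scale sc) (a (\<nu> q)) (unit_block q))"
  unfolding comb_sum by (auto simp: Omega_def comb_def fun_eq_iff)

text \<open>Exhibits the composite as the coordinate map of the basis kernels, so that its
  bijectivity becomes their basis property.\<close>

lemma GKer_Omega_eq:
  "GKer sc ip V Y Yh CG l J \<circ> Omega sc Ghat mlt cgm E l J c \<nu> =
    (\<lambda>a. \<Sum>q\<in>quads E. fun_scale (fun_scale sc) (a (\<nu> q)) (bker q))"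
  unfolding Omega_eq comb_sum bker_sum o_def by (intro ext, subst GKer_eq[OF comb_in]) simp

lemma steer_iff_sum:
  "K \<in> steer \<longleftrightarrow> (\<exists>a. K = (\<Sum>(j, i, s, r)\<in>quads E.
     fun_scale (fun_scale sc) (a j i s r) (basis_kernel sc ip V Y Yh CG l J c j i s r)))"
proof
  assume "K \<in> steer"
  then obtain \<alpha> where \<alpha>: "K = (\<Sum>q\<in>quads E. fun_scale (fun_scale sc) (\<alpha> q) (bker q))"
    using basis_familyD(3)[OF k.vector_space_axioms finite_quads steer_basis] by blast
  show "\<exists>a. K = (\<Sum>(j, i, s, r)\<in>quads E.
     fun_scale (fun_scale sc) (a j i s r) (basis_kernel sc ip V Y Yh CG l J c j i s r))"
    unfolding \<alpha> by (intro exI[of _ "\<lambda>j i s r. \<alpha> (j, i, s, r)"] sum.cong) auto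
next
  assume "\<exists>a. K = (\<Sum>(j, i, s, r)\<in>quads E.
     fun_scale (fun_scale sc) (a j i s r) (basis_kernel sc ip V Y Yh CG l J c j i s r))"
  then show "K \<in> steer"
    using bker_steer by (auto intro!: k.subspace_sum[OF steer_subspace] k.subspace_scale[OF steer_subspace])
qed

lemma basis_kernel_matrix_element:
  assumes q: "(j, i, s, r) \<in> quads E" and n: "n \<in> {1..dim (V l)}"
  shows "ip (Y J M) (basis_kernel sc ip V Y Yh CG l J c j i s r x (Y l n)) =
    kernel_coeff sc ip V Y Yh CG l J (c r) j i s x M n"
proof -
  have "j \<in> Ghat" "s \<in> {1..cgm J j l}" "c r \<in> endo" using q c_endo by (auto simp: kernel_index_def)
  then show ?thesis
    using n onb_in[OF onb[OF l] n] by (simp add: basis_kernel_eq kernel_coeff_eq bilinear_kernel_def)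
qed

end

theorem corollary4p2:
  fixes G :: "('g, 'z) monoid_scheme" and TG :: "'g topology"
    and act :: "'g \<Rightarrow> 'x::t2_space \<Rightarrow> 'x" and \<mu> :: "'x measure"
    and sc :: "'k::real_or_complex \<Rightarrow> 'v::ab_group_add \<Rightarrow> 'v" and ip :: "'v \<Rightarrow> 'v \<Rightarrow> 'k"
    and Ghat :: "'j set" and V :: "'j \<Rightarrow> 'v set" and \<rho> :: "'j \<Rightarrow> 'g \<Rightarrow> 'v \<Rightarrow> 'v"
    and Y :: "'j \<Rightarrow> nat \<Rightarrow> 'v"
    and mlt :: "'j \<Rightarrow> nat" and Yh :: "'j \<Rightarrow> nat \<Rightarrow> nat \<Rightarrow> 'x \<Rightarrow> 'k"
    and cgm :: "'j \<Rightarrow> 'j \<Rightarrow> 'j \<Rightarrow> nat"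
    and CG :: "'j \<Rightarrow> 'j \<Rightarrow> (('v \<Rightarrow> 'v \<Rightarrow> 'k) \<Rightarrow> 'k) \<Rightarrow> 'j \<times> nat \<Rightarrow> 'v"
    and l J :: 'j and E \<Lambda> :: nat and c :: "nat \<Rightarrow> 'v \<Rightarrow> 'v"
  assumes "compact_group G TG"
    and "homogeneous_space G TG act"
    and "haar_measure G act \<mu>"
    and "inner_product_space sc ip"
    and "unitary_dual G TG sc ip Ghat V \<rho>"
    and "\<forall>j\<in>Ghat. orthonormal_basis sc ip (V j) (Y j)"
    and "harmonic_basis G act \<mu> sc ip Ghat V \<rho> Y mlt Yh"
    and "clebsch_gordan G sc Ghat V \<rho> cgm CG"
    and "l \<in> Ghat" and "J \<in> Ghat"
    and "E = vector_space.dim (fun_scale sc) (endo_space G sc (V J) (\<rho> J))"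
    and "basis_family (fun_scale sc) {1..E} c (endo_space G sc (V J) (\<rho> J))"
    and "\<Lambda> = num_params Ghat mlt cgm E l J"
  shows
    "basis_family (fun_scale (fun_scale sc)) (kernel_index Ghat mlt cgm E l J)
       (\<lambda>(j, i, s, r). basis_kernel sc ip V Y Yh CG l J c j i s r)
       (steerable_kernels G act sc (V l) (\<rho> l) (V J) (\<rho> J)) \<and>
     (\<forall>j i s r. (j, i, s, r) \<in> kernel_index Ghat mlt cgm E l J \<longrightarrow>
        (\<forall>x. \<forall>M\<in>{1..vector_space.dim sc (V J)}. \<forall>n\<in>{1..vector_space.dim sc (V l)}.
           ip (Y J M) (basis_kernel sc ip V Y Yh CG l J c j i s r x (Y l n)) =
             (\<Sum>m = 1..vector_space.dim sc (V j). \<Sum>M' = 1..vector_space.dim sc (V J).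
                ip (Y J M) (c r (Y J M')) * cg_coeff sc ip V Y CG s J M' j m l n
                  * kcnj (Yh j i m x)))) \<and>
     finite {j \<in> Ghat. cgm J j l \<noteq> 0} \<and>
     finite (kernel_index Ghat mlt cgm E l J) \<and>
     card (kernel_index Ghat mlt cgm E l J) = \<Lambda> \<and>
     (\<forall>K. K \<in> steerable_kernels G act sc (V l) (\<rho> l) (V J) (\<rho> J) \<longleftrightarrow>
        (\<exists>a. K = (\<Sum>(j, i, s, r)\<in>kernel_index Ghat mlt cgm E l J.
                     fun_scale (fun_scale sc) (a j i s r)
                       (basis_kernel sc ip V Y Yh CG l J c j i s r)))) \<and>
     (\<forall>\<nu>. bij_betw \<nu> (kernel_index Ghat mlt cgm E l J) {1..\<Lambda>} \<longrightarrow>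
        linear_iso (fun_scale (*)) (fun_scale (fun_scale sc)) (coord_space \<Lambda>)
          (direct_sum (block_index Ghat mlt cgm l J) (\<lambda>_. endo_space G sc (V J) (\<rho> J)))
          (Omega sc Ghat mlt cgm E l J c \<nu>) \<and>
        linear_iso (fun_scale (*)) (fun_scale (fun_scale sc)) (coord_space \<Lambda>)
          (steerable_kernels G act sc (V l) (\<rho> l) (V J) (\<rho> J))
          (GKer sc ip V Y Yh CG l J \<circ> Omega sc Ghat mlt cgm E l J c \<nu>))"
proof -
  let ?D = "vector_space.dim sc"
  interpret steerable_setting_basis sc ip G TG act \<mu> Ghat V \<rho> Y mlt Yh cgm CG l J E c
    using assms by (intro steerable_setting_basis.intro steerable_setting.intro
        steerable_setting_axioms.intro steerable_setting_basis_axioms.intro) auto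
  have "linear_iso (fun_scale (*)) (fun_scale (fun_scale sc)) (coord_space \<Lambda>) block_sum
      (Omega sc Ghat mlt cgm E l J c \<nu>)"
    and "linear_iso (fun_scale (*)) (fun_scale (fun_scale sc)) (coord_space \<Lambda>) steer
      (GKer sc ip V Y Yh CG l J \<circ> Omega sc Ghat mlt cgm E l J c \<nu>)"
    if "bij_betw \<nu> (quads E) {1..\<Lambda>}" for \<nu>
    unfolding GKer_Omega_eq unfolding Omega_eq
    by (rule basis_family_linear_iso[OF vector_space_kernels finite_quads _ that];
        rule block_sum_basis steer_basis)+
  moreover have "ip (Y J M) (basis_kernel sc ip V Y Yh CG l J c j i s r x (Y l n)) =
      (\<Sum>m = 1..?D (V j). \<Sum>M' = 1..?D (V J).
        ip (Y J M) (c r (Y J M')) * cg_coeff sc ip V Y CG s J M' j m l n * kcnj (Yh j i m x))"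
    if "(j, i, s, r) \<in> quads E" "n \<in> {1..?D (V l)}" for j i s r x M n
    using basis_kernel_matrix_element[OF that] by (simp add: kernel_coeff_def)
  ultimately show ?thesis
    using steer_basis finite_cg_support finite_quads card_quads steer_iff_sum
    unfolding \<open>\<Lambda> = num_params Ghat mlt cgm E l J\<close> by (intro conjI allI impI ballI) blast+
qed

end
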